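(* Let $p\ge2$ be an integer. Let $\mathcal X\subseteq\mathbb R^d$ be nonempty, compact and convex, let $F:\mathbb R^d\to\mathbb R^d$ be continuous, monotone on $\mathcal X$ and $p$th-order $L_p$-smooth on $\mathcal X$ ($L_p>0$), let $x^*$ satisfy $0\in F(x^* )+\mathcal N_{\mathcal X}(x^* )$, and let $x_0\in\mathcal X$ with $D=\|x_0-x^*\|>0$. For every integer $T\ge1$, the Inexact Accelerated Halpern Iteration described in the context (with the parameters given there, and with $R$-Adaptive-ATM as inner solver) uses $\mathcal O(T)$ $p$th-order oracle calls of $F$ in total, and returns $(u_{T-1},v_{T-1})$ with $$\|v_{T-1}\|\le\frac{c_pL_pD^p}{T^{(3p-1)/2}},\qquad v_{T-1}\in F(u_{T-1})+\mathcal N_{\mathcal X}(u_{T-1}),$$ where $c_p$ and the constant in $\mathcal O(T)$ depend only on $p$. Consequently, for every $\epsilon>0$, the $p$th-order oracle complexity of finding (with this method, for a suitable $T$) an $\epsilon$-solution, i.e. a point $\hat x\in\mathcal X$ with $\operatorname{dist}(0,F(\hat x)+\mathcal N_{\mathcal X}(\hat x))\le\epsilon$, is $$\mathcal O\Bigl(\max\Bigl\{1,\Bigl(\frac{L_pD^p}{\epsilon}\Bigr)^{2/(3p-1)}\Bigr\}\Bigr),$$ with a constant depending only on $p$.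
   Context: **Notation.** $\|\cdot\|$ is the Euclidean norm for vectors and the spectral (operator) norm for matrices and tensors. $\mathcal N_{\mathcal X}(x)=\{n:\langle n,y-x\rangle\le0\ \forall y\in\mathcal X\}$ is the normal cone at $x\in\mathcal X$; $\operatorname{dist}(0,S)=\inf_{s\in S}\|s\|$; $\mathrm{Proj}_{\mathcal X}$ is Euclidean projection; $\log_+(s)=\max\{0,\log s\}$. Monotone on $\mathcal X$: $\langle F(x)-F(y),x-y\rangle\ge0$ for $x,y\in\mathcal X$. $p$th-order $L_p$-smooth on $\mathcal X$: derivatives up to order $p-1$ exist and are continuous and $\|D^{p-1}F(x)-D^{p-1}F(y)\|\le L_p\|x-y\|$ for $x,y\in\mathcal X$. An operator $G$ is $\mu$-strongly monotone on $\mathcal X$ if $\langle G(x)-G(y),x-y\rangle\ge\mu\|x-y\|^2$ for $x,y\in\mathcal X$. A $p$th-order oracle call at $x$ returns $(F(x),DF(x),\dots,D^{p-1}F(x))$; only oracle calls are counted. **Tensor step.** For an operator $G$, $x\in\mathcal X$ and $M\ge L_p$, let $\bar G_x^p(y)=\sum_{k=0}^{p-1}\frac1{k!}D^kG(x)[y-x]^k$. Then $\mathcal T_G^p(x;M)$ denotes a point $y\in\mathcal X$ with $0\in\bar G_x^p(y)+\frac{M}{p!}\|y-x\|^{p-1}(y-x)+\mathcal N_{\mathcal X}(y)$. It uses one oracle call. **Constants.** Fix constants $a_p>0$, $m_p\ge1$, $\theta_p\in(0,1)$ depending only on $p$ with the following property (such constants are known to exist): whenever $G$ is $\mu$-strongly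 monotone and $p$th-order $L_p$-smooth on $\mathcal X$ and $0\in G(y^* )+\mathcal N_{\mathcal X}(y^* )$, then for $M=m_pL_p$ and $y\in\mathcal X$, $\|y-y^*\|\le\rho(\mu):=a_p(\mu/L_p)^{1/(p-1)}$ implies $\|\mathcal T_G^p(y;M)-y^*\|\le\theta_p\|y-y^*\|$. Throughout, $M=m_pL_p$. **Anchored-Tensor-Method**$(G,z_0,\mu,M,R,S)$, for $R\ge\rho(\mu)$. Put $r_k=\max\{\rho(\mu),(\frac1R+\frac{k(1-\theta_p)}{2R(p-1)})^{-1}\}$, $\mu_k=\mu(r_k/\rho(\mu))^{p-1}$, $K=\min\{k\ge0:r_k=\rho(\mu)\}$. For $k=0,\dots,K-1$ let $G_k(z)=G(z)+(\mu_k-\mu)(z-z_0)$ and $z_{k+1}=\mathcal T_{G_k}^p(z_k;M)$. For $s=K,\dots,K+S-1$ let $z_{s+1}=\mathcal T_G^p(z_s;M)$. Return $z_{K+S}$. **$R$-Adaptive-ATM**$(G,y,\mu,M,\delta)$. Put $h_p=\frac{2^p(m_p+1)a_p^{p-1}}{p!}$ and $S=\max\{1,\lceil\frac{\log_+(h_p\rho(\mu)/\delta)}{p\log(1/\theta_p)}\rceil\}$. For $j=0,1,2,\dots$: set $R_j=2^jS\rho(\mu)$; let $w$ be the output of Anchored-Tensor-Method$(G,y,\mu,M,R_j,S)$; let $u=\mathcal T_G^p(w;M)$ and $n=-\bar G_w^p(u)-\frac{M}{p!}\|u-w\|^{p-1}(u-w)\in\mathcal N_{\mathcal X}(u)$;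 if $\mu^{-1}\|G(u)+n\|\le\delta$, return $(u,n)$ and stop. **Inexact Accelerated Halpern Iteration.** Parameters: $q=\frac{3p-1}2$, $\eta_0=\frac1{L_pD^{p-1}}$, $\beta_t=\frac q{t+q}$, $\eta_t=\eta_{t-1}\frac{t+2q-1}{t+q}$ for $t\ge1$, $\delta_T=D/T^{3/2}$. Set $y_0=x_0$, $G_0(x)=F(x)+\eta_0^{-1}(x-x_0)$, $(u_0,n_0)=R$-Adaptive-ATM$(G_0,y_0,\eta_0^{-1},M,\delta_T)$, $v_0=F(u_0)+n_0$. For $t=1,\dots,T-1$: $x_t=(1-\beta_t)u_{t-1}+\beta_tx_0$; $y_t=\mathrm{Proj}_{\mathcal X}(x_t-\eta_tv_{t-1})$; $G_t(x)=F(x)+\eta_t^{-1}(x-x_t)$; $(u_t,n_t)=R$-Adaptive-ATM$(G_t,y_t,\eta_t^{-1},M,\delta_T)$; $v_t=F(u_t)+n_t$. Return $(u_{T-1},v_{T-1})$. *)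

theory Defs
  imports "HOL-Analysis.Analysis" "HOL-Library.Poly_Mapping"
begin

section \<open>Euclidean spaces of all dimensions inside one type\<close>

text \<open>
  The constants of the theorem must not depend on the dimension \<open>d\<close>, so \<open>d\<close> has to be bound inside
  the statement and cannot be a type. We use the library type of finitely supported sequences with
  the \<open>\<ell>\<^sup>2\<close> inner product; \<open>\<real>\<^sup>d\<close> is the subspace \<open>Rd d\<close> of the sequences that vanish from
  position \<open>d\<close> on.
\<close>

instantiation poly_mapping :: (type, real_vector) real_vector
begin

definition scaleR_poly_mapping :: "real \<Rightarrow> ('a \<Rightarrow>\<^sub>0 'b) \<Rightarrow> 'a \<Rightarrow>\<^sub>0 'b" where
  "scaleR_poly_mapping r x = Poly_Mapping.map (scaleR r) x"

lemma lookup_scaleR [simp]: "Poly_Mapping.lookup (r *\<^sub>R x) i = r *\<^sub>R Poly_Mapping.lookup x i"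
  by (simp add: scaleR_poly_mapping_def Poly_Mapping.map.rep_eq when_def)

instance
  by standard (auto intro!: poly_mapping_eqI simp: lookup_add scaleR_add_right scaleR_add_left)

end

instantiation poly_mapping :: (type, real_inner) real_inner
begin

definition inner_poly_mapping :: "('a \<Rightarrow>\<^sub>0 'b) \<Rightarrow> ('a \<Rightarrow>\<^sub>0 'b) \<Rightarrow> real" where
  "inner_poly_mapping x y =
     (\<Sum>i\<in>Poly_Mapping.keys x. Poly_Mapping.lookup x i \<bullet> Poly_Mapping.lookup y i)"

definition norm_poly_mapping :: "('a \<Rightarrow>\<^sub>0 'b) \<Rightarrow> real" where
  "norm_poly_mapping x = sqrt (x \<bullet> x)"

definition dist_poly_mapping :: "('a \<Rightarrow>\<^sub>0 'b) \<Rightarrow> ('a \<Rightarrow>\<^sub>0 'b) \<Rightarrow> real" where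
  "dist_poly_mapping x y = norm (x - y)"

definition sgn_poly_mapping :: "('a \<Rightarrow>\<^sub>0 'b) \<Rightarrow> 'a \<Rightarrow>\<^sub>0 'b" where
  "sgn_poly_mapping x = x /\<^sub>R norm x"

definition uniformity_poly_mapping :: "(('a \<Rightarrow>\<^sub>0 'b) \<times> ('a \<Rightarrow>\<^sub>0 'b)) filter" where
  "uniformity_poly_mapping = (INF e\<in>{0<..}. principal {(x, y). dist x y < e})"

definition open_poly_mapping :: "('a \<Rightarrow>\<^sub>0 'b) set \<Rightarrow> bool" where
  "open_poly_mapping U \<longleftrightarrow> (\<forall>x\<in>U. \<forall>\<^sub>F (x', y) in uniformity. x' = x \<longrightarrow> y \<in> U)"

lemma inner_poly_mapping_superset:
  assumes "finite A" "Poly_Mapping.keys x \<subseteq> A"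
  shows "x \<bullet> y = (\<Sum>i\<in>A. Poly_Mapping.lookup x i \<bullet> Poly_Mapping.lookup y i)"
  unfolding inner_poly_mapping_def using assms
  by (intro sum.mono_neutral_left) (auto simp: in_keys_iff)

instance
proof
  fix x y z :: "'a \<Rightarrow>\<^sub>0 'b" and r :: real and U :: "('a \<Rightarrow>\<^sub>0 'b) set"
  let ?l = "Poly_Mapping.lookup" and ?k = "Poly_Mapping.keys"
  let ?A = "?k x \<union> ?k y \<union> ?k (x + y) \<union> ?k (r *\<^sub>R x)"
  note sup = inner_poly_mapping_superset[of ?A]
  show "dist x y = norm (x - y)" by (rule dist_poly_mapping_def)
  show "sgn x = x /\<^sub>R norm x" by (rule sgn_poly_mapping_def)
  show "uniformity = (INF e\<in>{0<..}. principal {(x :: 'a \<Rightarrow>\<^sub>0 'b, y). dist x y < e})"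
    by (rule uniformity_poly_mapping_def)
  show "open U \<longleftrightarrow> (\<forall>x\<in>U. \<forall>\<^sub>F (x', y) in uniformity. x' = x \<longrightarrow> y \<in> U)"
    by (rule open_poly_mapping_def)
  show "norm x = sqrt (x \<bullet> x)" by (rule norm_poly_mapping_def)
  show "x \<bullet> y = y \<bullet> x"
    by (subst (1 2) sup) (auto simp: inner_commute)
  show "(x + y) \<bullet> z = x \<bullet> z + y \<bullet> z"
    by (subst (1 2 3) sup) (auto simp: lookup_add inner_add_left sum.distrib)
  show "(r *\<^sub>R x) \<bullet> y = r * (x \<bullet> y)"
    by (subst (1 2) sup) (auto simp: sum_distrib_left)
  show "0 \<le> x \<bullet> x" unfolding inner_poly_mapping_def by (simp add: sum_nonneg)
  show "x \<bullet> x = 0 \<longleftrightarrow> x = 0"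
    unfolding inner_poly_mapping_def
    by (subst sum_nonneg_eq_0_iff)
      (auto intro!: poly_mapping_eqI simp: in_keys_iff)
qed

end

type_synonym vec = "nat \<Rightarrow>\<^sub>0 real"

definition Rd :: "nat \<Rightarrow> vec set" where
  "Rd d = {x. Poly_Mapping.keys x \<subseteq> {..<d}}"


section \<open>Higher derivatives and smoothness\<close>

text \<open>
  \<open>higher_deriv d G [h\<^sub>1, \<dots>, h\<^sub>k] x\<close> is \<open>D\<^sup>kG(x)[h\<^sub>1, \<dots>, h\<^sub>k]\<close> for directions \<open>h\<^sub>i\<close> in \<open>Rd d\<close>. The
  derivative within \<open>Rd d\<close> is the ordinary Frechet derivative on \<open>\<real>\<^sup>d\<close>; it is unique on directions
  in \<open>Rd d\<close>, and only such directions are ever used. Since \<open>d\<close> is finite, differentiability or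
  continuity of the tensor-valued map \<open>D\<^sup>kG\<close> is the same as that of all its evaluations.
\<close>

primrec higher_deriv :: "nat \<Rightarrow> (vec \<Rightarrow> vec) \<Rightarrow> vec list \<Rightarrow> vec \<Rightarrow> vec" where
  "higher_deriv d G [] = G"
| "higher_deriv d G (h # hs) =
     (\<lambda>x. frechet_derivative (higher_deriv d G hs) (at x within Rd d) h)"

definition cont_derivs_on :: "nat \<Rightarrow> vec set \<Rightarrow> nat \<Rightarrow> (vec \<Rightarrow> vec) \<Rightarrow> bool" where
  "cont_derivs_on d U k G \<longleftrightarrow>
     (\<forall>hs. set hs \<subseteq> Rd d \<and> length hs < k \<longrightarrow>
        (\<forall>x\<in>U. higher_deriv d G hs differentiable (at x within Rd d))) \<and>
     (\<forall>hs. set hs \<subseteq> Rd d \<and> length hs \<le> k \<longrightarrow> continuous_on U (higher_deriv d G hs))"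

definition tensor_norm :: "nat \<Rightarrow> nat \<Rightarrow> (vec list \<Rightarrow> vec) \<Rightarrow> real" where
  "tensor_norm d k A =
     (SUP hs\<in>{hs. length hs = k \<and> (\<forall>h\<in>set hs. h \<in> Rd d \<and> norm h \<le> 1)}. norm (A hs))"

text \<open>
  \<open>\<X>\<close> may have boundary points, or empty interior, so the derivatives at points of \<open>\<X>\<close> are taken
  to exist (and be continuous) on some open neighbourhood of \<open>\<X>\<close> in \<open>\<real>\<^sup>d\<close>.
\<close>

definition smooth_order :: "nat \<Rightarrow> vec set \<Rightarrow> nat \<Rightarrow> real \<Rightarrow> (vec \<Rightarrow> vec) \<Rightarrow> bool" where
  "smooth_order d X p L G \<longleftrightarrow>
     (\<exists>U. openin (top_of_set (Rd d)) U \<and> X \<subseteq> U \<and> cont_derivs_on d U (p - 1) G) \<and>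
     (\<forall>x\<in>X. \<forall>y\<in>X.
        tensor_norm d (p - 1) (\<lambda>hs. higher_deriv d G hs x - higher_deriv d G hs y)
          \<le> L * norm (x - y))"

definition monotone_op :: "vec set \<Rightarrow> (vec \<Rightarrow> vec) \<Rightarrow> bool" where
  "monotone_op X G \<longleftrightarrow> (\<forall>x\<in>X. \<forall>y\<in>X. (G x - G y) \<bullet> (x - y) \<ge> 0)"

definition strongly_monotone_op :: "vec set \<Rightarrow> real \<Rightarrow> (vec \<Rightarrow> vec) \<Rightarrow> bool" where
  "strongly_monotone_op X \<mu> G \<longleftrightarrow>
     (\<forall>x\<in>X. \<forall>y\<in>X. (G x - G y) \<bullet> (x - y) \<ge> \<mu> * (norm (x - y))\<^sup>2)"


section \<open>Variational inequalities and the tensor step\<close>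

definition normal_cone :: "nat \<Rightarrow> vec set \<Rightarrow> vec \<Rightarrow> vec set" where
  "normal_cone d X x = {n \<in> Rd d. \<forall>y\<in>X. n \<bullet> (y - x) \<le> 0}"

definition plus_normal_cone :: "nat \<Rightarrow> vec set \<Rightarrow> vec \<Rightarrow> vec \<Rightarrow> vec set" where
  "plus_normal_cone d X g x = {g + n | n. n \<in> normal_cone d X x}"

text \<open>The library's \<open>closest_point\<close> is restricted to \<open>heine_borel\<close> types.\<close>

definition proj_onto :: "vec set \<Rightarrow> vec \<Rightarrow> vec" where
  "proj_onto X x = arg_min_on (\<lambda>z. norm (z - x)) X"

definition taylor_model :: "nat \<Rightarrow> nat \<Rightarrow> (vec \<Rightarrow> vec) \<Rightarrow> vec \<Rightarrow> vec \<Rightarrow> vec" where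
  "taylor_model d p G x y = (\<Sum>k<p. (1 / fact k) *\<^sub>R higher_deriv d G (replicate k (y - x)) x)"

definition reg_model :: "nat \<Rightarrow> nat \<Rightarrow> real \<Rightarrow> (vec \<Rightarrow> vec) \<Rightarrow> vec \<Rightarrow> vec \<Rightarrow> vec" where
  "reg_model d p M G x y =
     taylor_model d p G x y + (M / fact p * norm (y - x) ^ (p - 1)) *\<^sub>R (y - x)"

definition is_tensor_step ::
  "nat \<Rightarrow> vec set \<Rightarrow> nat \<Rightarrow> real \<Rightarrow> (vec \<Rightarrow> vec) \<Rightarrow> vec \<Rightarrow> vec \<Rightarrow> bool" where
  "is_tensor_step d X p M G x y \<longleftrightarrow>
     y \<in> X \<and> 0 \<in> plus_normal_cone d X (reg_model d p M G x y) y"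

text \<open>
  The inclusion may have several solutions; the algorithms below work with an arbitrary selection
  \<open>tstep G x\<close> of solutions (the set \<open>X\<close>, the order \<open>p\<close> and the parameter \<open>M\<close> never change).
\<close>

definition tensor_step_selection ::
  "nat \<Rightarrow> vec set \<Rightarrow> nat \<Rightarrow> real \<Rightarrow> real \<Rightarrow> ((vec \<Rightarrow> vec) \<Rightarrow> vec \<Rightarrow> vec) \<Rightarrow> bool" where
  "tensor_step_selection d X p L M tstep \<longleftrightarrow>
     (\<forall>G x. G ` Rd d \<subseteq> Rd d \<and> smooth_order d X p L G \<and> x \<in> X \<longrightarrow>
        is_tensor_step d X p M G x (tstep G x))"

definition rho :: "nat \<Rightarrow> real \<Rightarrow> real \<Rightarrow> real \<Rightarrow> real" where
  "rho p L a \<mu> = a * root (p - 1) (\<mu> / L)"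

definition tensor_constants :: "nat \<Rightarrow> real \<Rightarrow> real \<Rightarrow> real \<Rightarrow> bool" where
  "tensor_constants p a m \<theta> \<longleftrightarrow> a > 0 \<and> m \<ge> 1 \<and> 0 < \<theta> \<and> \<theta> < 1 \<and>
     (\<forall>d X L \<mu> G ys y z.
        X \<subseteq> Rd d \<and> X \<noteq> {} \<and> compact X \<and> convex X \<and> L > 0 \<and> \<mu> > 0 \<and>
        G ` Rd d \<subseteq> Rd d \<and> strongly_monotone_op X \<mu> G \<and> smooth_order d X p L G \<and>
        ys \<in> X \<and> 0 \<in> plus_normal_cone d X (G ys) ys \<and>
        y \<in> X \<and> norm (y - ys) \<le> rho p L a \<mu> \<and>
        is_tensor_step d X p (m * L) G y z
        \<longrightarrow> norm (z - ys) \<le> \<theta> * norm (y - ys))"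


section \<open>Anchored-Tensor-Method\<close>

definition atm_r :: "nat \<Rightarrow> real \<Rightarrow> real \<Rightarrow> real \<Rightarrow> real \<Rightarrow> real \<Rightarrow> nat \<Rightarrow> real" where
  "atm_r p L a \<theta> \<mu> R k =
     max (rho p L a \<mu>) (inverse (1 / R + real k * (1 - \<theta>) / (2 * R * real (p - 1))))"

definition atm_mu :: "nat \<Rightarrow> real \<Rightarrow> real \<Rightarrow> real \<Rightarrow> real \<Rightarrow> real \<Rightarrow> nat \<Rightarrow> real" where
  "atm_mu p L a \<theta> \<mu> R k = \<mu> * (atm_r p L a \<theta> \<mu> R k / rho p L a \<mu>) ^ (p - 1)"

definition atm_K :: "nat \<Rightarrow> real \<Rightarrow> real \<Rightarrow> real \<Rightarrow> real \<Rightarrow> real \<Rightarrow> nat" where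
  "atm_K p L a \<theta> \<mu> R = (LEAST k. atm_r p L a \<theta> \<mu> R k = rho p L a \<mu>)"

primrec atm_iter ::
  "nat \<Rightarrow> real \<Rightarrow> real \<Rightarrow> real \<Rightarrow> ((vec \<Rightarrow> vec) \<Rightarrow> vec \<Rightarrow> vec) \<Rightarrow>
   (vec \<Rightarrow> vec) \<Rightarrow> vec \<Rightarrow> real \<Rightarrow> real \<Rightarrow> nat \<Rightarrow> vec" where
  "atm_iter p L a \<theta> tstep G z0 \<mu> R 0 = z0"
| "atm_iter p L a \<theta> tstep G z0 \<mu> R (Suc k) =
     tstep (if k < atm_K p L a \<theta> \<mu> R
            then (\<lambda>z. G z + (atm_mu p L a \<theta> \<mu> R k - \<mu>) *\<^sub>R (z - z0)) else G)
       (atm_iter p L a \<theta> tstep G z0 \<mu> R k)"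

text \<open>The second component of the result is the number of oracle calls.\<close>

definition anchored_tensor_method ::
  "nat \<Rightarrow> real \<Rightarrow> real \<Rightarrow> real \<Rightarrow> ((vec \<Rightarrow> vec) \<Rightarrow> vec \<Rightarrow> vec) \<Rightarrow>
   (vec \<Rightarrow> vec) \<Rightarrow> vec \<Rightarrow> real \<Rightarrow> real \<Rightarrow> nat \<Rightarrow> vec \<times> nat" where
  "anchored_tensor_method p L a \<theta> tstep G z0 \<mu> R S =
     (let K = atm_K p L a \<theta> \<mu> R in (atm_iter p L a \<theta> tstep G z0 \<mu> R (K + S), K + S))"


section \<open>R-Adaptive-ATM\<close>

definition log_plus :: "real \<Rightarrow> real" where
  "log_plus s = max 0 (ln s)"

definition h_const :: "nat \<Rightarrow> real \<Rightarrow> real \<Rightarrow> real" where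
  "h_const p a m = 2 ^ p * (m + 1) * a ^ (p - 1) / fact p"

definition adaptive_S :: "nat \<Rightarrow> real \<Rightarrow> real \<Rightarrow> real \<Rightarrow> real \<Rightarrow> real \<Rightarrow> real \<Rightarrow> nat" where
  "adaptive_S p L a m \<theta> \<mu> \<delta> =
     max 1 (nat \<lceil>log_plus (h_const p a m * rho p L a \<mu> / \<delta>) / (real p * ln (1 / \<theta>))\<rceil>)"

text \<open>
  One pass of the loop, with result \<open>(u, n, c)\<close>. The number \<open>c\<close> of oracle calls counts those of the
  inner method, one for the tensor step at \<open>w\<close> and one for evaluating \<open>G u\<close> in the stopping test.
\<close>

definition adaptive_pass ::
  "nat \<Rightarrow> nat \<Rightarrow> real \<Rightarrow> real \<Rightarrow> real \<Rightarrow> real \<Rightarrow> ((vec \<Rightarrow> vec) \<Rightarrow> vec \<Rightarrow> vec) \<Rightarrow>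
   (vec \<Rightarrow> vec) \<Rightarrow> vec \<Rightarrow> real \<Rightarrow> real \<Rightarrow> nat \<Rightarrow> vec \<times> vec \<times> nat" where
  "adaptive_pass d p L a m \<theta> tstep G y \<mu> \<delta> j =
     (let S = adaptive_S p L a m \<theta> \<mu> \<delta>;
          R = 2 ^ j * real S * rho p L a \<mu>;
          (w, c) = anchored_tensor_method p L a \<theta> tstep G y \<mu> R S;
          u = tstep G w;
          n = - reg_model d p (m * L) G w u
      in (u, n, c + 2))"

definition adaptive_stop ::
  "nat \<Rightarrow> nat \<Rightarrow> real \<Rightarrow> real \<Rightarrow> real \<Rightarrow> real \<Rightarrow> ((vec \<Rightarrow> vec) \<Rightarrow> vec \<Rightarrow> vec) \<Rightarrow>
   (vec \<Rightarrow> vec) \<Rightarrow> vec \<Rightarrow> real \<Rightarrow> real \<Rightarrow> nat \<Rightarrow> bool" where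
  "adaptive_stop d p L a m \<theta> tstep G y \<mu> \<delta> j \<longleftrightarrow>
     (let (u, n, _) = adaptive_pass d p L a m \<theta> tstep G y \<mu> \<delta> j
      in inverse \<mu> * norm (G u + n) \<le> \<delta>)"

text \<open>
  The result is \<open>None\<close> if the loop does not terminate, and otherwise \<open>Some (u, n, N)\<close> with the total
  number \<open>N\<close> of oracle calls of all passes up to and including the accepted one.
\<close>

definition r_adaptive_atm ::
  "nat \<Rightarrow> nat \<Rightarrow> real \<Rightarrow> real \<Rightarrow> real \<Rightarrow> real \<Rightarrow> ((vec \<Rightarrow> vec) \<Rightarrow> vec \<Rightarrow> vec) \<Rightarrow>
   (vec \<Rightarrow> vec) \<Rightarrow> vec \<Rightarrow> real \<Rightarrow> real \<Rightarrow> (vec \<times> vec \<times> nat) option" where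
  "r_adaptive_atm d p L a m \<theta> tstep G y \<mu> \<delta> =
     (let pass = adaptive_pass d p L a m \<theta> tstep G y \<mu> \<delta>;
          stop = adaptive_stop d p L a m \<theta> tstep G y \<mu> \<delta>
      in if \<exists>j. stop j
         then let J = (LEAST j. stop j); (u, n, _) = pass J
              in Some (u, n, \<Sum>j\<le>J. snd (snd (pass j)))
         else None)"


section \<open>Inexact Accelerated Halpern Iteration\<close>

definition halpern_q :: "nat \<Rightarrow> real" where
  "halpern_q p = (3 * real p - 1) / 2"

definition halpern_beta :: "nat \<Rightarrow> nat \<Rightarrow> real" where
  "halpern_beta p t = halpern_q p / (real t + halpern_q p)"

primrec halpern_eta :: "nat \<Rightarrow> real \<Rightarrow> real \<Rightarrow> nat \<Rightarrow> real" where
  "halpern_eta p L D 0 = 1 / (L * D ^ (p - 1))"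
| "halpern_eta p L D (Suc t) =
     halpern_eta p L D t * (real (Suc t) + 2 * halpern_q p - 1) / (real (Suc t) + halpern_q p)"

text \<open>
  The state after step \<open>t\<close> is \<open>Some (u\<^sub>t, v\<^sub>t, N\<^sub>t)\<close> with the number \<open>N\<^sub>t\<close> of oracle calls of \<open>F\<close> so far,
  or \<open>None\<close> if an inner call did not terminate. An oracle call for an operator \<open>F + \<lambda>(\<cdot> - c)\<close> is one
  oracle call of \<open>F\<close>; the evaluation of \<open>F u\<close> in \<open>v = F u + n\<close> is charged as a further call.
\<close>

primrec halpern_state ::
  "nat \<Rightarrow> vec set \<Rightarrow> nat \<Rightarrow> real \<Rightarrow> real \<Rightarrow> real \<Rightarrow> real \<Rightarrow> ((vec \<Rightarrow> vec) \<Rightarrow> vec \<Rightarrow> vec) \<Rightarrow>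
   (vec \<Rightarrow> vec) \<Rightarrow> vec \<Rightarrow> real \<Rightarrow> real \<Rightarrow> nat \<Rightarrow> (vec \<times> vec \<times> nat) option" where
  "halpern_state d X p L a m \<theta> tstep F x0 D \<delta> 0 =
     (let \<mu> = inverse (halpern_eta p L D 0)
      in map_option (\<lambda>(u, n, N). (u, F u + n, N + 1))
           (r_adaptive_atm d p L a m \<theta> tstep (\<lambda>x. F x + \<mu> *\<^sub>R (x - x0)) x0 \<mu> \<delta>))"
| "halpern_state d X p L a m \<theta> tstep F x0 D \<delta> (Suc t) =
     Option.bind (halpern_state d X p L a m \<theta> tstep F x0 D \<delta> t)
       (\<lambda>(u, v, N).
          let \<beta> = halpern_beta p (Suc t);
              \<eta> = halpern_eta p L D (Suc t);
              \<mu> = inverse \<eta>;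
              xt = (1 - \<beta>) *\<^sub>R u + \<beta> *\<^sub>R x0;
              yt = proj_onto X (xt - \<eta> *\<^sub>R v)
          in map_option (\<lambda>(u', n', N'). (u', F u' + n', N + N' + 1))
               (r_adaptive_atm d p L a m \<theta> tstep (\<lambda>x. F x + \<mu> *\<^sub>R (x - xt)) yt \<mu> \<delta>))"

definition inexact_halpern ::
  "nat \<Rightarrow> vec set \<Rightarrow> nat \<Rightarrow> real \<Rightarrow> real \<Rightarrow> real \<Rightarrow> real \<Rightarrow> ((vec \<Rightarrow> vec) \<Rightarrow> vec \<Rightarrow> vec) \<Rightarrow>
   (vec \<Rightarrow> vec) \<Rightarrow> vec \<Rightarrow> real \<Rightarrow> nat \<Rightarrow> (vec \<times> vec \<times> nat) option" where
  "inexact_halpern d X p L a m \<theta> tstep F x0 D T =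
     halpern_state d X p L a m \<theta> tstep F x0 D (D / real T powr (3 / 2)) (T - 1)"

end

theory Submission
  imports Defs
begin

text \<open>
  The outer loop is a Halpern iteration with growing step sizes, the inner loop a path-following
  method for the resolvents that it needs. Each of the two is controlled by one estimate, and the
  running time is controlled by a third estimate that links them.

  \<^emph>\<open>Inner loop.\<close> A tensor step contracts towards the solution of a strongly monotone problem as soon
  as it starts within the radius \<open>\<rho>(\<mu>)\<close>, which is proportional to \<open>\<mu>\<^sup>1\<^sup>/\<^sup>(\<^sup>p\<^sup>-\<^sup>1\<^sup>)\<close>. Adding the anchor term
  \<open>(\<mu>\<^sub>k - \<mu>)(z - z\<^sub>0)\<close> enlarges this radius to \<open>r\<^sub>k\<close>. The solutions of the anchored problems form a path
  that moves slowly when \<open>\<mu>\<^sub>k\<close> decreases slowly, and \<open>1/r\<^sub>k\<close> grows at just the rate for which one tensor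
  step per change of \<open>k\<close> keeps the iterate inside the shrinking radius (\<open>radius_step_inequality\<close>,
  \<open>anchored_phase\<close>). Once \<open>r\<^sub>k = \<rho>(\<mu>)\<close> the anchor is gone and the remaining steps converge linearly;
  by Taylor's formula (\<open>taylor_model_error\<close>) the residual after one more step is of \<open>p\<close>-th order
  in the distance, so that the prescribed number \<open>S\<close> of steps meets the stopping test. Doubling the
  guess \<open>R\<close> costs a geometric sum, and the whole inner call costs a multiple of
  \<open>S + \<parallel>y - y\<^sup>*\<parallel> / \<rho>(\<mu>)\<close>, where \<open>y\<close> is the starting point and \<open>y\<^sup>*\<close> the solution
  (\<open>r_adaptive_atm_guarantee\<close>).

  \<^emph>\<open>Outer loop.\<close> Let \<open>v\<^sub>t \<in> (F + N)(u\<^sub>t)\<close> be the operator value at the approximate resolvent \<open>u\<^sub>t\<close>. For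
  suitable weights \<open>B\<^sub>t\<close> the quantity
  \<open>B\<^sub>t (\<eta>\<^sub>t (t + 2q)/(2q) \<parallel>v\<^sub>t\<parallel>\<^sup>2 + \<langle>v\<^sub>t, u\<^sub>t - x\<^sub>0\<rangle>)\<close> decreases, up to errors that the tolerance
  \<open>D/T\<^sup>3\<^sup>/\<^sup>2\<close> makes summable, and it decreases by a multiple of \<open>\<parallel>v\<^sub>t - v\<^sub>t\<^sub>-\<^sub>1\<parallel>\<^sup>2\<close> (\<open>potential_step\<close>).
  Monotonicity bounds it below by a quadratic polynomial in \<open>\<parallel>v\<^sub>t\<parallel>\<close>. This gives
  \<open>\<parallel>v\<^sub>t\<parallel> = O(D / (t \<eta>\<^sub>t))\<close>, which is the rate in the theorem because \<open>\<eta>\<^sub>t\<close> grows like \<open>t\<^sup>q\<^sup>-\<^sup>1\<close>, and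
  it also gives \<open>\<Sum> t\<^sup>2 \<eta>\<^sub>t\<^sup>2 \<parallel>v\<^sub>t - v\<^sub>t\<^sub>-\<^sub>1\<parallel>\<^sup>2 = O(D\<^sup>2)\<close>.

  \<^emph>\<open>Running time.\<close> The warm start \<open>y\<^sub>t\<close> lies within \<open>\<eta>\<^sub>t \<parallel>v\<^sub>t - v\<^sub>t\<^sub>-\<^sub>1\<parallel> + 2 D/T\<^sup>3\<^sup>/\<^sup>2\<close> of the resolvent, and
  \<open>\<rho>(1/\<eta>\<^sub>t)\<close> is of the order \<open>D (t + 1)\<^sup>-\<^sup>3\<^sup>/\<^sup>2\<close>. By the Cauchy-Schwarz inequality and the last sum above,
  the quotients add up to \<open>O(T)\<close> (\<open>displacement_sum_le\<close>). The numbers \<open>S\<close> are of the order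
  \<open>1 + log (T/(t+1))\<close>, and these also add up to \<open>O(T)\<close> by Stirling's bound \<open>T\<^sup>T / T! \<le> e\<^sup>T\<close>.
\<close>

section \<open>Linear algebra and derivatives on \<open>\<real>\<^sup>d\<close> inside the sequence space\<close>

lemma subspace_Rd: "subspace (Rd d)"
proof (rule subspaceI)
  show "0 \<in> Rd d" by (simp add: Rd_def)
next
  fix x y assume "x \<in> Rd d" "y \<in> Rd d"
  then show "x + y \<in> Rd d"
    using keys_add[of x y] by (auto simp: Rd_def)
next
  fix c x assume "x \<in> Rd d"
  then show "c *\<^sub>R x \<in> Rd d"
    by (auto simp: Rd_def in_keys_iff subset_iff)
qed

lemmas Rd_closed [simp, intro] =
  subspace_0[OF subspace_Rd] subspace_add[OF subspace_Rd]
  subspace_diff[OF subspace_Rd] subspace_scale[OF subspace_Rd] subspace_neg[OF subspace_Rd]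
  subspace_sum[OF subspace_Rd]

definition unit_vec :: "nat \<Rightarrow> vec" where
  "unit_vec i = Poly_Mapping.single i 1"

lemma unit_vec_Rd [simp, intro]: "i < d \<Longrightarrow> unit_vec i \<in> Rd d"
  by (simp add: Rd_def unit_vec_def)

lemma Rd_expansion:
  assumes "x \<in> Rd d"
  shows "x = (\<Sum>i<d. Poly_Mapping.lookup x i *\<^sub>R unit_vec i)"
proof (rule poly_mapping_eqI)
  fix j
  have "Poly_Mapping.lookup (\<Sum>i<d. Poly_Mapping.lookup x i *\<^sub>R unit_vec i) j
      = (\<Sum>i<d. Poly_Mapping.lookup x i * (if i = j then 1 else 0))"
    by (simp add: lookup_sum unit_vec_def lookup_single when_def)
  also have "\<dots> = Poly_Mapping.lookup x j"
    using assms by (auto simp: Rd_def in_keys_iff subset_iff if_distrib cong: if_cong)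
  finally show "Poly_Mapping.lookup x j
      = Poly_Mapping.lookup (\<Sum>i<d. Poly_Mapping.lookup x i *\<^sub>R unit_vec i) j" by simp
qed

lemma abs_lookup_le_norm:
  fixes x :: vec
  shows "\<bar>Poly_Mapping.lookup x i\<bar> \<le> norm x"
proof -
  have "(Poly_Mapping.lookup x i)\<^sup>2
      = (\<Sum>j\<in>{i}. Poly_Mapping.lookup x j \<bullet> Poly_Mapping.lookup x j)"
    by (simp add: power2_eq_square)
  also have "\<dots> \<le> (\<Sum>j\<in>insert i (Poly_Mapping.keys x).
                      Poly_Mapping.lookup x j \<bullet> Poly_Mapping.lookup x j)"
    by (intro sum_mono2) auto
  also have "\<dots> = x \<bullet> x"
    by (subst inner_poly_mapping_superset[of "insert i (Poly_Mapping.keys x)"]) auto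
  also have "\<dots> = (norm x)\<^sup>2" by (simp add: power2_norm_eq_inner)
  finally show ?thesis
    by (metis abs_le_square_iff abs_norm_cancel)
qed

lemma has_derivative_line:
  assumes "(f has_derivative f') (at (x + t *\<^sub>R h) within Rd d)" "x \<in> Rd d" "h \<in> Rd d"
  shows "((\<lambda>s. f (x + s *\<^sub>R h)) has_derivative (\<lambda>s. f' (s *\<^sub>R h))) (at t)"
proof -
  have "((\<lambda>s. x + s *\<^sub>R h) has_derivative (\<lambda>s. s *\<^sub>R h)) (at t)"
    by (auto intro!: derivative_eq_intros)
  moreover have "(f has_derivative f') (at (x + t *\<^sub>R h) within range (\<lambda>s. x + s *\<^sub>R h))"
    by (rule has_derivative_subset[OF assms(1)]) (use assms in auto)
  ultimately show ?thesis
    by (rule has_derivative_in_compose)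
qed

text \<open>
  The \<open>frechet_derivative\<close> within \<open>Rd d\<close> is chosen among linear maps on the whole sequence space that
  may differ outside \<open>Rd d\<close>; restricting to a line shows that the choice has no influence on
  directions in \<open>Rd d\<close>.
\<close>

lemma frechet_derivative_Rd:
  assumes "(f has_derivative f') (at x within Rd d)" "x \<in> Rd d" "h \<in> Rd d"
  shows "frechet_derivative f (at x within Rd d) h = f' h"
proof -
  have "f differentiable (at x within Rd d)"
    using assms(1) by (auto simp: differentiable_def)
  then have "(f has_derivative frechet_derivative f (at x within Rd d)) (at x within Rd d)"
    by (simp add: frechet_derivative_works)
  then have "((\<lambda>s. f (x + s *\<^sub>R h)) has_derivative
      (\<lambda>s. frechet_derivative f (at x within Rd d) (s *\<^sub>R h))) (at 0)"
    using assms by (intro has_derivative_line) auto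
  moreover have "((\<lambda>s. f (x + s *\<^sub>R h)) has_derivative (\<lambda>s. f' (s *\<^sub>R h))) (at 0)"
    using assms by (intro has_derivative_line) auto
  ultimately have "(\<lambda>s. frechet_derivative f (at x within Rd d) (s *\<^sub>R h)) = (\<lambda>s. f' (s *\<^sub>R h))"
    by (rule has_derivative_unique)
  then show ?thesis by (metis scaleR_one)
qed

lemma has_derivative_cong_openin:
  assumes "openin (top_of_set (Rd d)) U" "x \<in> U" "\<And>z. z \<in> U \<Longrightarrow> f z = g z"
    and "(f has_derivative f') (at x within Rd d)"
  shows "(g has_derivative f') (at x within Rd d)"
proof -
  have "U \<subseteq> Rd d" using assms(1) by (simp add: openin_imp_subset)
  obtain T where T: "open T" "U = Rd d \<inter> T"
    using assms(1) by (auto simp: openin_open)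
  then obtain e where e: "e > 0" "ball x e \<subseteq> T"
    using assms(2) by (metis IntE open_contains_ball)
  show ?thesis
  proof (rule has_derivative_transform_within[OF assms(4) e(1)])
    show "x \<in> Rd d" using assms(2) T by simp
    fix x' assume "x' \<in> Rd d" "dist x' x < e"
    then show "f x' = g x'" using e T assms(3)[of x'] by (auto simp: dist_commute)
  qed
qed

section \<open>Higher derivatives as multilinear maps\<close>

definition linear_on_Rd :: "nat \<Rightarrow> (vec \<Rightarrow> vec) \<Rightarrow> bool" where
  "linear_on_Rd d f \<longleftrightarrow>
     (\<forall>x\<in>Rd d. \<forall>y\<in>Rd d. f (x + y) = f x + f y) \<and> (\<forall>r. \<forall>x\<in>Rd d. f (r *\<^sub>R x) = r *\<^sub>R f x)"

text \<open>
  The recursion follows that of \<open>higher_deriv\<close>, which differentiates in the direction at the head of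
  the list last; linearity in the head and multilinearity of the tail need different arguments.
\<close>

primrec multilinear_on_Rd :: "nat \<Rightarrow> nat \<Rightarrow> (vec list \<Rightarrow> vec) \<Rightarrow> bool" where
  "multilinear_on_Rd d 0 A = True"
| "multilinear_on_Rd d (Suc k) A \<longleftrightarrow>
     (\<forall>hs. set hs \<subseteq> Rd d \<and> length hs = k \<longrightarrow> linear_on_Rd d (\<lambda>h. A (h # hs))) \<and>
     (\<forall>h\<in>Rd d. multilinear_on_Rd d k (\<lambda>hs. A (h # hs)))"

lemma linear_on_Rd_diff:
  "linear_on_Rd d f \<Longrightarrow> linear_on_Rd d g \<Longrightarrow> linear_on_Rd d (\<lambda>x. f x - g x)"
  by (auto simp: linear_on_Rd_def algebra_simps)

lemma linear_on_Rd_sum: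
  assumes "linear_on_Rd d f" "finite I" "\<And>i. i \<in> I \<Longrightarrow> v i \<in> Rd d"
  shows "f (\<Sum>i\<in>I. c i *\<^sub>R v i) = (\<Sum>i\<in>I. c i *\<^sub>R f (v i))"
  using assms(2,3)
proof (induction I)
  case empty
  have "f (0 *\<^sub>R 0) = 0 *\<^sub>R f 0"
    using assms(1) Rd_closed(1) unfolding linear_on_Rd_def by blast
  then show ?case by simp
next
  case (insert i I)
  then have "f (c i *\<^sub>R v i + (\<Sum>i\<in>I. c i *\<^sub>R v i))
      = c i *\<^sub>R f (v i) + f (\<Sum>i\<in>I. c i *\<^sub>R v i)"
    using assms(1) unfolding linear_on_Rd_def by auto
  with insert show ?case by simp
qed

lemma multilinear_on_Rd_diff:
  "multilinear_on_Rd d k A \<Longrightarrow> multilinear_on_Rd d k B \<Longrightarrow>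
    multilinear_on_Rd d k (\<lambda>hs. A hs - B hs)"
  by (induction k arbitrary: A B) (auto intro!: linear_on_Rd_diff)

lemma multilinear_on_Rd_replicate:
  assumes "multilinear_on_Rd d k A" "h \<in> Rd d"
  shows "A (replicate k (r *\<^sub>R h)) = r ^ k *\<^sub>R A (replicate k h)"
  using assms(1)
proof (induction k arbitrary: A)
  case (Suc k)
  have "A (replicate (Suc k) (r *\<^sub>R h)) = r ^ k *\<^sub>R A ((r *\<^sub>R h) # replicate k h)"
    using Suc.IH[of "\<lambda>hs. A ((r *\<^sub>R h) # hs)"] Suc.prems assms(2) by auto
  also have "A ((r *\<^sub>R h) # replicate k h) = r *\<^sub>R A (h # replicate k h)"
  proof -
    have "linear_on_Rd d (\<lambda>g. A (g # replicate k h))"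
      using Suc.prems assms(2) by (auto simp: set_replicate_conv_if)
    then show ?thesis using assms(2) by (auto simp: linear_on_Rd_def)
  qed
  finally show ?case by (simp add: mult.commute)
qed simp

text \<open>
  Expanding the first direction in the \<open>d\<close> unit vectors reduces the order by one. The resulting bound
  makes the supremum in \<open>tensor_norm\<close> a genuine upper bound.
\<close>

lemma multilinear_on_Rd_bounded:
  assumes "multilinear_on_Rd d k A"
  shows "\<exists>B. \<forall>hs. length hs = k \<and> (\<forall>h\<in>set hs. h \<in> Rd d \<and> norm h \<le> 1) \<longrightarrow> norm (A hs) \<le> B"
  using assms
proof (induction k arbitrary: A)
  case 0
  then show ?case by (intro exI[of _ "norm (A [])"]) auto
next
  case (Suc k)
  have "\<forall>i<d. \<exists>B. \<forall>hs. length hs = k \<and> (\<forall>h\<in>set hs. h \<in> Rd d \<and> norm h \<le> 1)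
          \<longrightarrow> norm (A (unit_vec i # hs)) \<le> B"
    using Suc.IH Suc.prems by auto
  then obtain B where B: "\<And>i hs. i < d \<Longrightarrow> length hs = k \<Longrightarrow>
      (\<forall>h\<in>set hs. h \<in> Rd d \<and> norm h \<le> 1) \<Longrightarrow> norm (A (unit_vec i # hs)) \<le> B i"
    by metis
  show ?case
  proof (intro exI allI impI)
    fix hs :: "vec list" assume hs: "length hs = Suc k \<and> (\<forall>h\<in>set hs. h \<in> Rd d \<and> norm h \<le> 1)"
    then obtain g gs where gs: "hs = g # gs" by (cases hs) auto
    have g: "g \<in> Rd d" "norm g \<le> 1" and gs': "set gs \<subseteq> Rd d" "length gs = k"
      "\<forall>h\<in>set gs. h \<in> Rd d \<and> norm h \<le> 1"
      using hs gs by auto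
    have lin: "linear_on_Rd d (\<lambda>h. A (h # gs))"
      using Suc.prems gs' by auto
    have "A hs = (\<Sum>i<d. Poly_Mapping.lookup g i *\<^sub>R A (unit_vec i # gs))"
      unfolding gs using linear_on_Rd_sum[OF lin, of "{..<d}" unit_vec "Poly_Mapping.lookup g"]
      by (subst Rd_expansion[OF g(1)]) auto
    also have "norm \<dots> \<le> (\<Sum>i<d. B i)"
    proof (rule order_trans[OF norm_sum], rule sum_mono)
      fix i assume "i \<in> {..<d}"
      then have "norm (A (unit_vec i # gs)) \<le> B i" using B gs' by auto
      moreover have "\<bar>Poly_Mapping.lookup g i\<bar> \<le> 1"
        using abs_lookup_le_norm[of g i] g(2) by linarith
      ultimately have "\<bar>Poly_Mapping.lookup g i\<bar> * norm (A (unit_vec i # gs)) \<le> 1 * B i"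
        by (intro mult_mono) auto
      then show "norm (Poly_Mapping.lookup g i *\<^sub>R A (unit_vec i # gs)) \<le> B i" by simp
    qed
    finally show "norm (A hs) \<le> (\<Sum>i<d. B i)" .
  qed
qed

lemma norm_le_tensor_norm:
  assumes "multilinear_on_Rd d k A" "h \<in> Rd d"
  shows "norm (A (replicate k h)) \<le> tensor_norm d k A * norm h ^ k"
proof (cases "h = 0")
  case True
  show ?thesis
  proof (cases k)
    case 0
    have "{hs. length hs = (0::nat) \<and> (\<forall>h\<in>set hs. h \<in> Rd d \<and> norm h \<le> 1)} = {[]}"
      by auto
    then show ?thesis using 0 by (simp add: tensor_norm_def)
  next
    case (Suc j)
    then show ?thesis
      using True multilinear_on_Rd_replicate[OF assms(1), of 0 0] by simp
  qed
next
  case False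
  define e where "e = h /\<^sub>R norm h"
  have e: "e \<in> Rd d" "norm e = 1" "h = norm h *\<^sub>R e"
    using assms(2) False by (auto simp: e_def)
  obtain B where B: "\<And>hs. length hs = k \<and> (\<forall>h\<in>set hs. h \<in> Rd d \<and> norm h \<le> 1) \<Longrightarrow> norm (A hs) \<le> B"
    using multilinear_on_Rd_bounded[OF assms(1)] by blast
  have "norm (A (replicate k e)) \<le> tensor_norm d k A"
    unfolding tensor_norm_def
  proof (rule cSUP_upper)
    show "bdd_above ((\<lambda>hs. norm (A hs)) ` {hs. length hs = k \<and> (\<forall>h\<in>set hs. h \<in> Rd d \<and> norm h \<le> 1)})"
      using B by (auto intro!: bdd_aboveI)
  qed (use e in auto)
  moreover have "norm (A (replicate k h)) = norm h ^ k * norm (A (replicate k e))"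
    by (subst e(3)) (simp add: multilinear_on_Rd_replicate[OF assms(1) e(1)])
  ultimately show ?thesis by (simp add: mult.commute[of _ "norm h ^ k"] mult_left_mono)
qed

lemma higher_deriv_has_derivative:
  assumes "cont_derivs_on d U k G" "x \<in> U" "set hs \<subseteq> Rd d" "length hs < k"
  shows "(higher_deriv d G hs has_derivative (\<lambda>h. higher_deriv d G (h # hs) x)) (at x within Rd d)"
proof -
  have "higher_deriv d G hs differentiable (at x within Rd d)"
    using assms unfolding cont_derivs_on_def by auto
  then show ?thesis by (simp add: frechet_derivative_works)
qed

lemma linear_on_Rd_derivative:
  assumes "(f has_derivative f') F"
  shows "linear_on_Rd d f'"
  using has_derivative_bounded_linear[OF assms]
  unfolding linear_on_Rd_def by (auto simp: linear_simps)

text \<open>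
  A derivative of a family of maps inherits every linear relation that the family satisfies on a
  neighbourhood of the point; a relation at the point alone would not suffice.
\<close>

lemma multilinear_frechet_derivative:
  assumes "openin (top_of_set (Rd d)) U" "x \<in> U" "h \<in> Rd d"
    and "\<And>z. z \<in> U \<Longrightarrow> multilinear_on_Rd d k (\<lambda>hs. B hs z)"
    and "\<And>hs. set hs \<subseteq> Rd d \<Longrightarrow> length hs = k \<Longrightarrow> B hs differentiable (at x within Rd d)"
  shows "multilinear_on_Rd d k (\<lambda>hs. frechet_derivative (B hs) (at x within Rd d) h)"
  using assms(4,5)
proof (induction k arbitrary: B)
  case (Suc k)
  have x: "x \<in> Rd d" using assms(1,2) openin_imp_subset by blast
  have deriv: "(B hs has_derivative frechet_derivative (B hs) (at x within Rd d)) (at x within Rd d)"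
    if "set hs \<subseteq> Rd d" "length hs = Suc k" for hs
    using Suc.prems(2)[OF that] by (simp add: frechet_derivative_works)
  have "linear_on_Rd d (\<lambda>g. frechet_derivative (B (g # hs)) (at x within Rd d) h)"
    if hs: "set hs \<subseteq> Rd d" "length hs = k" for hs
    unfolding linear_on_Rd_def
  proof (intro conjI ballI allI)
    have lin: "linear_on_Rd d (\<lambda>g. B (g # hs) z)" if "z \<in> U" for z
      using Suc.prems(1)[OF that] hs by auto
    fix g g' assume g: "g \<in> Rd d" "g' \<in> Rd d"
    have "((\<lambda>z. B (g # hs) z + B (g' # hs) z) has_derivative
        (\<lambda>h. frechet_derivative (B (g # hs)) (at x within Rd d) h
           + frechet_derivative (B (g' # hs)) (at x within Rd d) h)) (at x within Rd d)"
      by (intro has_derivative_add deriv) (use g hs in auto)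
    then have "(B ((g + g') # hs) has_derivative
        (\<lambda>h. frechet_derivative (B (g # hs)) (at x within Rd d) h
           + frechet_derivative (B (g' # hs)) (at x within Rd d) h)) (at x within Rd d)"
      by (rule has_derivative_cong_openin[OF assms(1,2), rotated])
        (use lin g in \<open>auto simp: linear_on_Rd_def\<close>)
    then show "frechet_derivative (B ((g + g') # hs)) (at x within Rd d) h
        = frechet_derivative (B (g # hs)) (at x within Rd d) h
        + frechet_derivative (B (g' # hs)) (at x within Rd d) h"
      using x assms(3) by (rule frechet_derivative_Rd)
  next
    have lin: "linear_on_Rd d (\<lambda>g. B (g # hs) z)" if "z \<in> U" for z
      using Suc.prems(1)[OF that] hs by auto
    fix r g assume g: "g \<in> Rd d"
    have "((\<lambda>z. r *\<^sub>R B (g # hs) z) has_derivative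
        (\<lambda>h. r *\<^sub>R frechet_derivative (B (g # hs)) (at x within Rd d) h)) (at x within Rd d)"
      by (intro has_derivative_scaleR_right deriv) (use g hs in auto)
    then have "(B ((r *\<^sub>R g) # hs) has_derivative
        (\<lambda>h. r *\<^sub>R frechet_derivative (B (g # hs)) (at x within Rd d) h)) (at x within Rd d)"
      by (rule has_derivative_cong_openin[OF assms(1,2), rotated])
        (use lin g in \<open>auto simp: linear_on_Rd_def\<close>)
    then show "frechet_derivative (B ((r *\<^sub>R g) # hs)) (at x within Rd d) h
        = r *\<^sub>R frechet_derivative (B (g # hs)) (at x within Rd d) h"
      using x assms(3) by (rule frechet_derivative_Rd)
  qed
  moreover have "multilinear_on_Rd d k (\<lambda>hs. frechet_derivative (B (g # hs)) (at x within Rd d) h)"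
    if "g \<in> Rd d" for g
    by (rule Suc.IH) (use Suc.prems that in auto)
  ultimately show ?case by auto
qed simp

lemma multilinear_higher_deriv:
  assumes "openin (top_of_set (Rd d)) U" "cont_derivs_on d U k G" "x \<in> U" "j \<le> k"
  shows "multilinear_on_Rd d j (\<lambda>hs. higher_deriv d G hs x)"
  using assms(3,4)
proof (induction j arbitrary: x)
  case (Suc j)
  have "linear_on_Rd d (\<lambda>h. higher_deriv d G (h # hs) x)" if "set hs \<subseteq> Rd d" "length hs = j" for hs
    by (rule linear_on_Rd_derivative, rule higher_deriv_has_derivative[OF assms(2)])
      (use Suc.prems that in auto)
  moreover have "multilinear_on_Rd d j (\<lambda>hs. higher_deriv d G (h # hs) x)" if "h \<in> Rd d" for h
    unfolding higher_deriv.simps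
  proof (rule multilinear_frechet_derivative[OF assms(1) Suc.prems(1) that])
    show "higher_deriv d G hs differentiable at x within Rd d"
      if "set hs \<subseteq> Rd d" "length hs = j" for hs
      using higher_deriv_has_derivative[OF assms(2) Suc.prems(1), of hs] that Suc.prems
      unfolding differentiable_def by fastforce
  qed (use Suc in auto)
  ultimately show ?case by auto
qed simp

section \<open>Taylor's formula and the addition of an affine term\<close>

text \<open>
  The constant \<open>1 / p!\<close> matters, because the number of steps in the adaptive method is computed with
  it. Applying the mean value form of the remainder to \<open>G\<close> itself would lose a factor \<open>p\<close>. The
  formula is applied instead to the scalar function \<open>t \<mapsto> \<langle>G(x + th), e\<rangle> - c t\<^sup>p / p!\<close>, where \<open>e\<close> is the
  error vector: the Lipschitz bound on the top derivative of \<open>G\<close> says that the top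
  derivative of this function is largest at \<open>t = 0\<close>.
\<close>

lemma taylor_model_error:
  assumes X: "X \<subseteq> Rd d" "convex X" and p: "p \<ge> 2" and G: "smooth_order d X p L G"
    and x: "x \<in> X" and y: "y \<in> X"
  shows "norm (G y - taylor_model d p G x y) \<le> L / fact p * norm (y - x) ^ p"
proof -
  obtain U where U: "openin (top_of_set (Rd d)) U" "X \<subseteq> U" "cont_derivs_on d U (p - 1) G"
    using G unfolding smooth_order_def by blast
  define h where "h = y - x"
  define e where "e = G y - taylor_model d p G x y"
  define c where "c = norm e * L * norm h ^ p"
  define \<phi> where "\<phi> = (\<lambda>k t. higher_deriv d G (replicate k h) (x + t *\<^sub>R h) \<bullet> e)"
  define \<psi> where "\<psi> = (\<lambda>k t. \<phi> k t - c * t ^ (p - k) / fact (p - k))"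
  have xR: "x \<in> Rd d" and hR: "h \<in> Rd d" using x y X by (auto simp: h_def)
  have seg: "x + t *\<^sub>R h \<in> X" if "0 \<le> t" "t \<le> 1" for t
  proof -
    have "x + t *\<^sub>R h = (1 - t) *\<^sub>R x + t *\<^sub>R y" by (simp add: h_def algebra_simps)
    then show ?thesis using convexD_alt[OF X(2) x y that] by simp
  qed
  have d\<phi>: "DERIV (\<phi> k) t :> \<phi> (Suc k) t" if k: "k < p - 1" and t: "0 \<le> t" "t \<le> 1" for k t
  proof -
    have sub: "set (replicate k h) \<subseteq> Rd d" using hR by (auto simp: set_replicate_conv_if)
    have xt: "x + t *\<^sub>R h \<in> U" using seg[OF t] U by auto
    have hd: "(higher_deriv d G (replicate k h) has_derivative
        (\<lambda>h'. higher_deriv d G (h' # replicate k h) (x + t *\<^sub>R h))) (at (x + t *\<^sub>R h) within Rd d)"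
      by (rule higher_deriv_has_derivative[OF U(3) xt sub]) (use k in simp)
    have lin: "bounded_linear (\<lambda>h'. higher_deriv d G (h' # replicate k h) (x + t *\<^sub>R h))"
      using hd by (rule has_derivative_bounded_linear)
    have "((\<lambda>s. higher_deriv d G (replicate k h) (x + s *\<^sub>R h)) has_derivative
        (\<lambda>s. higher_deriv d G ((s *\<^sub>R h) # replicate k h) (x + t *\<^sub>R h))) (at t)"
      by (rule has_derivative_line[OF hd xR hR])
    then have "(\<phi> k has_derivative
        (\<lambda>s. higher_deriv d G ((s *\<^sub>R h) # replicate k h) (x + t *\<^sub>R h) \<bullet> e)) (at t)"
      unfolding \<phi>_def by (rule has_derivative_inner_left)
    also have "(\<lambda>s. higher_deriv d G ((s *\<^sub>R h) # replicate k h) (x + t *\<^sub>R h) \<bullet> e)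
        = (*) (\<phi> (Suc k) t)"
    proof
      fix s
      have "higher_deriv d G ((s *\<^sub>R h) # replicate k h) (x + t *\<^sub>R h)
          = s *\<^sub>R higher_deriv d G (h # replicate k h) (x + t *\<^sub>R h)"
        using lin by (rule linear_simps(5))
      then show "higher_deriv d G ((s *\<^sub>R h) # replicate k h) (x + t *\<^sub>R h) \<bullet> e = \<phi> (Suc k) t * s"
        by (simp add: \<phi>_def mult.commute)
    qed
    finally show ?thesis unfolding has_field_derivative_def .
  qed
  have d\<psi>: "DERIV (\<psi> k) t :> \<psi> (Suc k) t" if k: "k < p - 1" and t: "0 \<le> t" "t \<le> 1" for k t
  proof -
    obtain j where j: "p - k = Suc j" "p - Suc k = j" using k by (cases "p - k") auto
    have "DERIV (\<lambda>t. c * t ^ Suc j / fact (Suc j)) t :> c * t ^ j / fact j"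
      by (auto intro!: derivative_eq_intros simp del: power_Suc simp: divide_simps)
    from DERIV_diff[OF d\<phi>[OF k t] this] show ?thesis
      unfolding \<psi>_def j by simp
  qed
  have "\<exists>t>0. t < 1 \<and> \<psi> 0 1 = (\<Sum>m<p-1. \<psi> m 0 / fact m * 1 ^ m) + \<psi> (p - 1) t / fact (p - 1) * 1 ^ (p - 1)"
    by (rule Maclaurin) (use p d\<psi> in auto)
  then obtain t where t: "0 < t" "t < 1"
    and eq: "\<psi> 0 1 = (\<Sum>m<p-1. \<psi> m 0 / fact m) + \<psi> (p - 1) t / fact (p - 1)" by auto
  have "\<phi> (p - 1) t - \<phi> (p - 1) 0 \<le> c * t"
  proof -
    define A where "A = (\<lambda>hs. higher_deriv d G hs (x + t *\<^sub>R h) - higher_deriv d G hs x)"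
    have xt: "x + t *\<^sub>R h \<in> X" using seg t by simp
    have ml: "multilinear_on_Rd d (p - 1) A"
      unfolding A_def
      by (intro multilinear_on_Rd_diff multilinear_higher_deriv[OF U(1,3)]) (use xt x U in auto)
    have "\<phi> (p - 1) t - \<phi> (p - 1) 0 = A (replicate (p - 1) h) \<bullet> e"
      by (simp add: \<phi>_def A_def inner_diff_left)
    also have "\<dots> \<le> norm (A (replicate (p - 1) h)) * norm e"
      by (rule norm_cauchy_schwarz)
    also have "norm (A (replicate (p - 1) h)) \<le> tensor_norm d (p - 1) A * norm h ^ (p - 1)"
      by (rule norm_le_tensor_norm[OF ml hR])
    also have "tensor_norm d (p - 1) A \<le> L * norm (x + t *\<^sub>R h - x)"
      using G xt x unfolding smooth_order_def A_def by blast
    also have "L * norm (x + t *\<^sub>R h - x) * norm h ^ (p - 1) * norm e = c * t"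
      using t p by (cases p) (auto simp: c_def mult_ac)
    finally show ?thesis by (simp add: mult_right_mono)
  qed
  then have top: "\<psi> (p - 1) t \<le> \<phi> (p - 1) 0"
    using p by (simp add: \<psi>_def)
  have \<psi>0: "\<psi> m 0 = \<phi> m 0" if "m < p" for m using that by (simp add: \<psi>_def)
  have "\<phi> 0 1 - c / fact p = (\<Sum>m<p-1. \<phi> m 0 / fact m) + \<psi> (p - 1) t / fact (p - 1)"
  proof -
    have "\<psi> 0 1 = \<phi> 0 1 - c / fact p" by (simp add: \<psi>_def)
    moreover have "(\<Sum>m<p-1. \<psi> m 0 / fact m) = (\<Sum>m<p-1. \<phi> m 0 / fact m)"
      by (rule sum.cong) (auto simp: \<psi>0)
    ultimately show ?thesis using eq by simp
  qed
  also have "\<dots> \<le> (\<Sum>m<p-1. \<phi> m 0 / fact m) + \<phi> (p - 1) 0 / fact (p - 1)"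
    using top by (simp add: divide_right_mono)
  also have "\<dots> = (\<Sum>m<p. \<phi> m 0 / fact m)"
    using p by (cases p) auto
  also have "\<dots> = taylor_model d p G x y \<bullet> e"
    by (simp add: taylor_model_def \<phi>_def h_def inner_sum_left)
  finally have "\<phi> 0 1 - taylor_model d p G x y \<bullet> e \<le> c / fact p" by simp
  moreover have "\<phi> 0 1 = G y \<bullet> e" by (simp add: \<phi>_def h_def)
  ultimately have "e \<bullet> e \<le> c / fact p"
    by (metis e_def inner_diff_left)
  then have ee: "norm e * norm e \<le> norm e * (L / fact p * norm h ^ p)"
    by (simp add: c_def power2_norm_eq_inner[symmetric] power2_eq_square)
  \<comment> \<open>If the error vanishes, there is nothing to cancel; the right-hand side is nonnegative because
        it dominates a norm.\<close>
  show ?thesis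
    unfolding e_def[symmetric] h_def[symmetric]
  proof (cases "e = 0")
    case True
    have "multilinear_on_Rd d (p-1) (\<lambda>hs. higher_deriv d G hs y - higher_deriv d G hs x)"
      by (intro multilinear_on_Rd_diff multilinear_higher_deriv[OF U(1,3)]) (use y x U in auto)
    from norm_le_tensor_norm[OF this hR]
    have "0 \<le> tensor_norm d (p-1) (\<lambda>hs. higher_deriv d G hs y - higher_deriv d G hs x) * norm h ^ (p-1)"
      by (rule order_trans[OF norm_ge_zero])
    also have "\<dots> \<le> (L * norm h) * norm h ^ (p-1)"
      using G x y unfolding smooth_order_def h_def by (intro mult_right_mono) auto
    also have "\<dots> = L * norm h ^ p" using p by (cases p) auto
    finally show "norm e \<le> L / fact p * norm h ^ p" using True by simp
  next
    case False
    then show "norm e \<le> L / fact p * norm h ^ p"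
      using mult_left_le_imp_le[OF ee] by simp
  qed
qed

text \<open>
  The derivatives of \<open>x \<mapsto> r (x - c)\<close>. Those of order at least two vanish and that of order one is constant,
  so the affine term has no effect on the Lipschitz constant of the derivative of order \<open>p - 1\<close>.
\<close>

primrec shift_deriv :: "real \<Rightarrow> vec \<Rightarrow> vec list \<Rightarrow> vec \<Rightarrow> vec" where
  "shift_deriv r c [] x = r *\<^sub>R (x - c)"
| "shift_deriv r c (h # hs) x = (if hs = [] then r *\<^sub>R h else 0)"

lemma shift_deriv_has_derivative:
  "(shift_deriv r c hs has_derivative (\<lambda>h. shift_deriv r c (h # hs) x)) (at x within S)"
proof (cases hs)
  case Nil
  have "((\<lambda>x. r *\<^sub>R (x - c)) has_derivative (\<lambda>h. r *\<^sub>R h)) (at x within S)"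
    by (auto intro!: derivative_eq_intros)
  moreover have "shift_deriv r c [] = (\<lambda>x. r *\<^sub>R (x - c))" by auto
  ultimately show ?thesis using Nil by simp
next
  case (Cons h' hs')
  then have "shift_deriv r c hs = (\<lambda>_. if hs' = [] then r *\<^sub>R h' else 0)" by auto
  then show ?thesis using Cons by simp
qed

lemma higher_deriv_shift:
  assumes U: "openin (top_of_set (Rd d)) U" and G: "cont_derivs_on d U k G"
    and "x \<in> U" "set hs \<subseteq> Rd d" "length hs \<le> k"
  shows "higher_deriv d (\<lambda>z. G z + r *\<^sub>R (z - c)) hs x = higher_deriv d G hs x + shift_deriv r c hs x"
  using assms(3-)
proof (induction hs arbitrary: x)
  case (Cons h hs)
  have x: "x \<in> Rd d" using Cons.prems(1) U openin_imp_subset by blast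
  have "((\<lambda>z. higher_deriv d G hs z + shift_deriv r c hs z) has_derivative
      (\<lambda>h. higher_deriv d G (h # hs) x + shift_deriv r c (h # hs) x)) (at x within Rd d)"
    using Cons.prems
    by (intro has_derivative_add higher_deriv_has_derivative[OF G] shift_deriv_has_derivative) auto
  then have "(higher_deriv d (\<lambda>z. G z + r *\<^sub>R (z - c)) hs has_derivative
      (\<lambda>h. higher_deriv d G (h # hs) x + shift_deriv r c (h # hs) x)) (at x within Rd d)"
    by (rule has_derivative_cong_openin[OF U Cons.prems(1), rotated]) (use Cons in auto)
  from frechet_derivative_Rd[OF this x, of h] Cons.prems show ?case by simp
qed simp

lemma cont_derivs_on_shift:
  assumes U: "openin (top_of_set (Rd d)) U" and G: "cont_derivs_on d U k G"
  shows "cont_derivs_on d U k (\<lambda>z. G z + r *\<^sub>R (z - c))"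
  unfolding cont_derivs_on_def
proof (intro conjI allI impI ballI)
  fix hs :: "vec list" and x assume hs: "set hs \<subseteq> Rd d \<and> length hs < k" and x: "x \<in> U"
  have "((\<lambda>z. higher_deriv d G hs z + shift_deriv r c hs z) has_derivative
      (\<lambda>h. higher_deriv d G (h # hs) x + shift_deriv r c (h # hs) x)) (at x within Rd d)"
    using hs x
    by (intro has_derivative_add higher_deriv_has_derivative[OF G] shift_deriv_has_derivative) auto
  then have "(higher_deriv d (\<lambda>z. G z + r *\<^sub>R (z - c)) hs has_derivative
      (\<lambda>h. higher_deriv d G (h # hs) x + shift_deriv r c (h # hs) x)) (at x within Rd d)"
    by (rule has_derivative_cong_openin[OF U x, rotated]) (use hs higher_deriv_shift[OF U G] in auto)
  then show "higher_deriv d (\<lambda>z. G z + r *\<^sub>R (z - c)) hs differentiable at x within Rd d"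
    by (auto simp: differentiable_def)
next
  fix hs :: "vec list" assume hs: "set hs \<subseteq> Rd d \<and> length hs \<le> k"
  have "continuous_on U (\<lambda>x. higher_deriv d G hs x + shift_deriv r c hs x)"
  proof (rule continuous_on_add)
    show "continuous_on U (higher_deriv d G hs)" using G hs unfolding cont_derivs_on_def by auto
    show "continuous_on U (shift_deriv r c hs)"
      unfolding continuous_on_eq_continuous_within
      by (intro ballI has_derivative_continuous[OF shift_deriv_has_derivative])
  qed
  then show "continuous_on U (higher_deriv d (\<lambda>z. G z + r *\<^sub>R (z - c)) hs)"
    by (rule continuous_on_eq) (use hs higher_deriv_shift[OF U G] in auto)
qed

lemma smooth_order_shift:
  assumes "p \<ge> 2" "smooth_order d X p L G"
  shows "smooth_order d X p L (\<lambda>z. G z + r *\<^sub>R (z - c))"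
proof -
  obtain U where U: "openin (top_of_set (Rd d)) U" "X \<subseteq> U" "cont_derivs_on d U (p - 1) G"
    using assms(2) unfolding smooth_order_def by blast
  have "tensor_norm d (p - 1) (\<lambda>hs. higher_deriv d (\<lambda>z. G z + r *\<^sub>R (z - c)) hs x
             - higher_deriv d (\<lambda>z. G z + r *\<^sub>R (z - c)) hs y)
      = tensor_norm d (p - 1) (\<lambda>hs. higher_deriv d G hs x - higher_deriv d G hs y)"
    if "x \<in> X" "y \<in> X" for x y
    unfolding tensor_norm_def
  proof (rule SUP_cong[OF refl])
    fix hs :: "vec list" assume hs: "hs \<in> {hs. length hs = p - 1 \<and> (\<forall>h\<in>set hs. h \<in> Rd d \<and> norm h \<le> 1)}"
    then obtain g gs where "hs = g # gs" using assms(1) by (cases hs) auto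
    then have "shift_deriv r c hs x = shift_deriv r c hs y" by simp
    then show "norm (higher_deriv d (\<lambda>z. G z + r *\<^sub>R (z - c)) hs x
             - higher_deriv d (\<lambda>z. G z + r *\<^sub>R (z - c)) hs y)
      = norm (higher_deriv d G hs x - higher_deriv d G hs y)"
      using hs that U by (subst (1 2) higher_deriv_shift[OF U(1,3)]) auto
  qed
  then show ?thesis
    using assms(2) cont_derivs_on_shift[OF U(1,3)] U(1,2) unfolding smooth_order_def by auto
qed

section \<open>Projections and variational inequalities\<close>

lemma proj_onto:
  assumes "compact X" "convex X" "X \<noteq> {}"
  shows "proj_onto X x \<in> X" and "z \<in> X \<Longrightarrow> (x - proj_onto X x) \<bullet> (z - proj_onto X x) \<le> 0"
proof -
  have "continuous_on X (\<lambda>z. norm (z - x))" by (intro continuous_intros)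
  then obtain y where y: "y \<in> X" "\<And>z. z \<in> X \<Longrightarrow> norm (y - x) \<le> norm (z - x)"
    using continuous_attains_inf[OF assms(1,3)] by blast
  then have "is_arg_min (\<lambda>z. norm (z - x)) (\<lambda>z. z \<in> X) y"
    by (auto simp: is_arg_min_linorder)
  then have "is_arg_min (\<lambda>z. norm (z - x)) (\<lambda>z. z \<in> X) (proj_onto X x)"
    unfolding proj_onto_def arg_min_on_def arg_min_def by (rule someI)
  then have P: "proj_onto X x \<in> X" "\<forall>z\<in>X. dist x (proj_onto X x) \<le> dist x z"
    by (auto simp: is_arg_min_linorder dist_norm norm_minus_commute)
  then show "proj_onto X x \<in> X" by simp
  show "(x - proj_onto X x) \<bullet> (z - proj_onto X x) \<le> 0" if "z \<in> X"
    using any_closest_point_dot[OF assms(2) compact_imp_closed[OF assms(1)] P(1) that P(2)] .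
qed

lemma proj_onto_nonexpansive:
  assumes "compact X" "convex X" "X \<noteq> {}"
  shows "norm (proj_onto X x - proj_onto X y) \<le> norm (x - y)"
proof -
  let ?P = "proj_onto X"
  have "(x - ?P x) \<bullet> (?P y - ?P x) \<le> 0" "(y - ?P y) \<bullet> (?P x - ?P y) \<le> 0"
    using proj_onto[OF assms] by auto
  then have "(?P x - ?P y) \<bullet> (?P x - ?P y) \<le> (x - y) \<bullet> (?P x - ?P y)"
    by (simp add: algebra_simps inner_commute)
  also have "\<dots> \<le> norm (x - y) * norm (?P x - ?P y)" by (rule norm_cauchy_schwarz)
  finally have "norm (?P x - ?P y) * norm (?P x - ?P y) \<le> norm (x - y) * norm (?P x - ?P y)"
    by (simp add: power2_norm_eq_inner[symmetric] power2_eq_square)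
  then show ?thesis
    by (metis mult_right_le_imp_le norm_ge_zero order.order_iff_strict)
qed

lemma proj_onto_id:
  assumes "compact X" "convex X" "x \<in> X"
  shows "proj_onto X x = x"
proof -
  have "X \<noteq> {}" using assms by auto
  then have "(x - proj_onto X x) \<bullet> (x - proj_onto X x) \<le> 0"
    using proj_onto(2)[OF assms(1,2) _ assms(3)] by blast
  then show ?thesis
    by (metis eq_iff_diff_eq_0 inner_ge_zero inner_eq_zero_iff order_antisym)
qed

definition vi_solution :: "vec set \<Rightarrow> (vec \<Rightarrow> vec) \<Rightarrow> vec \<Rightarrow> bool" where
  "vi_solution X G y \<longleftrightarrow> y \<in> X \<and> (\<forall>z\<in>X. G y \<bullet> (z - y) \<ge> 0)"

lemma plus_normal_cone_iff:
  assumes "g \<in> Rd d"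
  shows "v \<in> plus_normal_cone d X g y \<longleftrightarrow> v - g \<in> normal_cone d X y"
  unfolding plus_normal_cone_def by (auto simp: algebra_simps intro: exI[of _ "v - g"])

lemma zero_in_plus_normal_cone_iff:
  assumes "g \<in> Rd d"
  shows "0 \<in> plus_normal_cone d X g y \<longleftrightarrow> (\<forall>z\<in>X. g \<bullet> (z - y) \<ge> 0)"
  using plus_normal_cone_iff[OF assms, of 0 X y] assms
  by (auto simp: normal_cone_def)

text \<open>
  For \<open>p \<ge> 2\<close> the first derivative is continuous on the compact set \<open>X\<close>, hence bounded there.
\<close>

lemma smooth_order_Lipschitz:
  assumes X: "X \<subseteq> Rd d" "compact X" "convex X" and p: "p \<ge> 2" and G: "smooth_order d X p L G"
  shows "\<exists>\<Lambda>. \<forall>x\<in>X. \<forall>y\<in>X. norm (G x - G y) \<le> \<Lambda> * norm (x - y)"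
proof -
  obtain U where U: "openin (top_of_set (Rd d)) U" "X \<subseteq> U" "cont_derivs_on d U (p - 1) G"
    using G unfolding smooth_order_def by blast
  have deriv: "(G has_derivative (\<lambda>h. higher_deriv d G [h] x)) (at x within Rd d)" if "x \<in> X" for x
    using higher_deriv_has_derivative[OF U(3), of x "[]"] that U(2) p by auto
  have "\<exists>B. \<forall>x\<in>X. norm (higher_deriv d G [unit_vec i] x) \<le> B" if "i < d" for i
  proof -
    have "continuous_on X (higher_deriv d G [unit_vec i])"
      using U(3) p that
      by (intro continuous_on_subset[OF _ U(2)]) (auto simp: cont_derivs_on_def simp del: higher_deriv.simps)
    then have "bounded (higher_deriv d G [unit_vec i] ` X)"
      using X(2) compact_continuous_image compact_imp_bounded by blast
    then show ?thesis by (auto simp: bounded_iff)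
  qed
  then obtain B where B: "\<And>i x. i < d \<Longrightarrow> x \<in> X \<Longrightarrow> norm (higher_deriv d G [unit_vec i] x) \<le> B i"
    by metis
  define \<Lambda> where "\<Lambda> = (\<Sum>i<d. B i)"
  have bound: "norm (higher_deriv d G [h] x) \<le> \<Lambda> * norm h" if x: "x \<in> X" and h: "h \<in> Rd d" for x h
  proof -
    have lin: "linear_on_Rd d (\<lambda>h. higher_deriv d G [h] x)"
      by (rule linear_on_Rd_derivative[OF deriv[OF x]])
    have "higher_deriv d G [h] x
        = (\<Sum>i<d. Poly_Mapping.lookup h i *\<^sub>R higher_deriv d G [unit_vec i] x)"
      using linear_on_Rd_sum[OF lin, of "{..<d}" unit_vec "Poly_Mapping.lookup h"]
      by (subst Rd_expansion[OF h]) auto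
    also have "norm \<dots> \<le> (\<Sum>i<d. B i * norm h)"
    proof (rule order_trans[OF norm_sum], rule sum_mono)
      fix i assume "i \<in> {..<d}"
      then have "\<bar>Poly_Mapping.lookup h i\<bar> * norm (higher_deriv d G [unit_vec i] x) \<le> norm h * B i"
        using B[OF _ x] abs_lookup_le_norm[of h i] by (intro mult_mono) auto
      then show "norm (Poly_Mapping.lookup h i *\<^sub>R higher_deriv d G [unit_vec i] x) \<le> B i * norm h"
        by (simp add: mult.commute)
    qed
    finally show ?thesis by (simp add: \<Lambda>_def sum_distrib_right)
  qed
  have "norm (G x - G y) \<le> \<Lambda> * norm (x - y)" if x: "x \<in> X" and y: "y \<in> X" for x y
  proof -
    define h where "h = x - y"
    have yR: "y \<in> Rd d" and hR: "h \<in> Rd d" using x y X by (auto simp: h_def)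
    have seg: "y + t *\<^sub>R h \<in> X" if "t \<in> {0..1}" for t
    proof -
      have "y + t *\<^sub>R h = (1 - t) *\<^sub>R y + t *\<^sub>R x" by (simp add: h_def algebra_simps)
      then show ?thesis using convexD_alt[OF X(3) y x] that by simp
    qed
    have "norm (G (y + 1 *\<^sub>R h) - G (y + 0 *\<^sub>R h)) \<le> (\<Lambda> * norm h) * norm (1 - 0 :: real)"
    proof (rule differentiable_bound)
      fix t :: real assume t: "t \<in> {0..1}"
      show "((\<lambda>t. G (y + t *\<^sub>R h)) has_derivative
          (\<lambda>s. higher_deriv d G [s *\<^sub>R h] (y + t *\<^sub>R h))) (at t within {0..1})"
        using has_derivative_line[OF deriv[OF seg[OF t]] yR hR] has_derivative_at_withinI by blast
      show "onorm (\<lambda>s. higher_deriv d G [s *\<^sub>R h] (y + t *\<^sub>R h)) \<le> \<Lambda> * norm h"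
      proof (rule onorm_le)
        fix s :: real
        show "norm (higher_deriv d G [s *\<^sub>R h] (y + t *\<^sub>R h)) \<le> \<Lambda> * norm h * norm s"
          using bound[OF seg[OF t], of "s *\<^sub>R h"] hR by (simp add: mult_ac)
      qed
    qed auto
    then show ?thesis by (simp add: h_def)
  qed
  then show ?thesis by blast
qed

text \<open>
  A Lipschitz and strongly monotone operator makes the projected gradient map
  \<open>x \<mapsto> P(x - \<gamma> G x)\<close> a contraction for small \<open>\<gamma>\<close>, and its fixed points are the solutions. Banach's theorem
  therefore replaces Brouwer's.
\<close>

lemma vi_solution_exists:
  assumes X: "X \<subseteq> Rd d" "compact X" "convex X" "X \<noteq> {}" and p: "p \<ge> 2" and G: "smooth_order d X p L G"
    and \<mu>: "\<mu> > 0" and mono: "strongly_monotone_op X \<mu> G"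
  shows "\<exists>y. vi_solution X G y"
proof -
  obtain \<Lambda>0 where \<Lambda>0: "\<And>x y. x \<in> X \<Longrightarrow> y \<in> X \<Longrightarrow> norm (G x - G y) \<le> \<Lambda>0 * norm (x - y)"
    using smooth_order_Lipschitz[OF X(1-3) p G] by blast
  define \<Lambda> where "\<Lambda> = max \<mu> \<Lambda>0"
  have \<Lambda>: "\<Lambda> \<ge> \<mu>" "\<Lambda> > 0" using \<mu> by (auto simp: \<Lambda>_def)
  have lip: "norm (G x - G y) \<le> \<Lambda> * norm (x - y)" if "x \<in> X" "y \<in> X" for x y
    using \<Lambda>0[OF that] mult_right_mono[of \<Lambda>0 \<Lambda> "norm (x - y)"] by (simp add: \<Lambda>_def)
  \<comment> \<open>This step size minimises the squared contraction factor \<open>1 - 2 \<gamma> \<mu> + \<gamma>\<^sup>2 \<Lambda>\<^sup>2\<close>.\<close>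
  define \<gamma> where "\<gamma> = \<mu> / \<Lambda>\<^sup>2"
  define c where "c = sqrt (1 - (\<mu> / \<Lambda>)\<^sup>2)"
  have ratio: "0 < \<mu> / \<Lambda>" "\<mu> / \<Lambda> \<le> 1" using \<mu> \<Lambda> by auto
  then have ratio2: "0 < (\<mu> / \<Lambda>)\<^sup>2" "(\<mu> / \<Lambda>)\<^sup>2 \<le> 1"
    by (auto simp del: power_divide intro: power_le_one)
  then have c: "0 \<le> c" "c < 1" "c\<^sup>2 = 1 - (\<mu> / \<Lambda>)\<^sup>2" by (auto simp: c_def simp del: power_divide)
  have \<gamma>: "\<gamma> > 0" using \<mu> \<Lambda> by (simp add: \<gamma>_def)
  define P where "P = (\<lambda>x. proj_onto X (x - \<gamma> *\<^sub>R G x))"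
  have "\<exists>!y\<in>X. P y = y"
  proof (rule Banach_fix[of X c])
    show "complete X" using X(2) by (rule compact_imp_complete)
    show "P ` X \<subseteq> X" using proj_onto(1)[OF X(2-4)] by (auto simp: P_def)
    show "\<And>x y. x \<in> X \<Longrightarrow> y \<in> X \<Longrightarrow> dist (P x) (P y) \<le> c * dist x y"
    proof -
      fix x y assume x: "x \<in> X" and y: "y \<in> X"
      have "(norm ((x - \<gamma> *\<^sub>R G x) - (y - \<gamma> *\<^sub>R G y)))\<^sup>2
          = (norm (x - y))\<^sup>2 - 2 * \<gamma> * ((G x - G y) \<bullet> (x - y)) + \<gamma>\<^sup>2 * (norm (G x - G y))\<^sup>2"
        unfolding power2_norm_eq_inner power2_eq_square[of \<gamma>]
        by (simp add: algebra_simps inner_commute)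
      also have "\<dots> \<le> (norm (x - y))\<^sup>2 - 2 * \<gamma> * (\<mu> * (norm (x - y))\<^sup>2) + \<gamma>\<^sup>2 * (\<Lambda> * norm (x - y))\<^sup>2"
        using mono x y lip[OF x y] \<gamma> unfolding strongly_monotone_op_def
        by (intro add_mono diff_mono mult_left_mono power_mono) auto
      also have "\<dots> = (c * norm (x - y))\<^sup>2"
        using \<Lambda> by (simp add: \<gamma>_def c(3) power_mult_distrib) (simp add: field_simps power2_eq_square)
      finally have "norm ((x - \<gamma> *\<^sub>R G x) - (y - \<gamma> *\<^sub>R G y)) \<le> c * norm (x - y)"
        by (rule power2_le_imp_le) (use c in auto)
      then show "dist (P x) (P y) \<le> c * dist x y"
        using proj_onto_nonexpansive[OF X(2-4)] unfolding P_def dist_norm by (meson order_trans)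
    qed
  qed (use c X in auto)
  then obtain y where y: "y \<in> X" "proj_onto X (y - \<gamma> *\<^sub>R G y) = y" by (auto simp: P_def)
  have "G y \<bullet> (z - y) \<ge> 0" if "z \<in> X" for z
    using proj_onto(2)[OF X(2-4) that, of "y - \<gamma> *\<^sub>R G y"] y(2) \<gamma> by (simp add: zero_le_mult_iff)
  then show ?thesis using y(1) by (auto simp: vi_solution_def)
qed

lemma strongly_monotone_shift:
  assumes "strongly_monotone_op X \<mu> G"
  shows "strongly_monotone_op X (\<mu> + r) (\<lambda>z. G z + r *\<^sub>R (z - c))"
proof -
  have "(G x + r *\<^sub>R (x - c) - (G y + r *\<^sub>R (y - c))) \<bullet> (x - y)
      = (G x - G y) \<bullet> (x - y) + r * (norm (x - y))\<^sup>2" for x y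
    by (simp add: algebra_simps power2_norm_eq_inner)
  then show ?thesis using assms by (auto simp: strongly_monotone_op_def algebra_simps)
qed

text \<open>
  When the two variational inequalities are added, monotonicity of \<open>G\<close> leaves an inequality for the
  anchor term alone: the anchor can only pull the solution towards \<open>c\<close>.
\<close>

lemma vi_solution_anchored_dist:
  assumes mono: "strongly_monotone_op X \<mu> G" and \<mu>: "\<mu> > 0" and r: "r \<ge> 0"
    and y: "vi_solution X G y" and y': "vi_solution X (\<lambda>z. G z + r *\<^sub>R (z - c)) y'"
  shows "norm (y' - c) \<le> norm (y - c)"
proof -
  have in_X: "y \<in> X" "y' \<in> X" using y y' by (auto simp: vi_solution_def)
  have "G y \<bullet> (y' - y) \<ge> 0" "(G y' + r *\<^sub>R (y' - c)) \<bullet> (y - y') \<ge> 0"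
    using y y' by (auto simp: vi_solution_def)
  then have "(G y' - G y) \<bullet> (y' - y) \<le> r * ((y' - c) \<bullet> (y - y'))"
    by (simp add: algebra_simps)
  moreover have "\<mu> * (norm (y' - y))\<^sup>2 \<le> (G y' - G y) \<bullet> (y' - y)"
    using mono in_X by (auto simp: strongly_monotone_op_def)
  ultimately have le: "\<mu> * (norm (y' - y))\<^sup>2 \<le> r * ((y' - c) \<bullet> (y - y'))" by linarith
  show ?thesis
  proof (cases "y' = y")
    case False
    then have "0 < \<mu> * (norm (y' - y))\<^sup>2" using \<mu> by simp
    then have "0 < r * ((y' - c) \<bullet> (y - y'))" using le by linarith
    then have "0 < (y' - c) \<bullet> (y - y')" using r by (simp add: zero_less_mult_iff)
    then have "(y' - c) \<bullet> (y' - c) \<le> (y' - c) \<bullet> (y - c)" by (simp add: algebra_simps)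
    also have "\<dots> \<le> norm (y' - c) * norm (y - c)" by (rule norm_cauchy_schwarz)
    finally have "norm (y' - c) * norm (y' - c) \<le> norm (y' - c) * norm (y - c)"
      by (simp add: power2_norm_eq_inner[symmetric] power2_eq_square)
    then show ?thesis
      by (metis mult_left_le_imp_le norm_ge_zero order.order_iff_strict)
  qed simp
qed

text \<open>
  How fast the regularisation path moves. The larger parameter \<open>r\<close> supplies the strong
  monotonicity, so the distance of the solution for the smaller parameter to the anchor
  appears on the right.
\<close>

lemma vi_solution_path_dist:
  assumes mono: "strongly_monotone_op X \<mu> G" and \<mu>: "\<mu> + r > 0" and r: "s \<le> r"
    and y: "vi_solution X (\<lambda>z. G z + r *\<^sub>R (z - c)) y"
    and y': "vi_solution X (\<lambda>z. G z + s *\<^sub>R (z - c)) y'"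
  shows "(\<mu> + r) * norm (y' - y) \<le> (r - s) * norm (y' - c)"
proof -
  have in_X: "y \<in> X" "y' \<in> X" using y y' by (auto simp: vi_solution_def)
  have "(G y + r *\<^sub>R (y - c)) \<bullet> (y' - y) \<ge> 0" "(G y' + s *\<^sub>R (y' - c)) \<bullet> (y - y') \<ge> 0"
    using y y' by (auto simp: vi_solution_def)
  then have "(G y' - G y) \<bullet> (y' - y) + r * (norm (y' - y))\<^sup>2 \<le> (r - s) * ((y' - c) \<bullet> (y' - y))"
    by (simp add: algebra_simps power2_norm_eq_inner)
  moreover have "\<mu> * (norm (y' - y))\<^sup>2 \<le> (G y' - G y) \<bullet> (y' - y)"
    using mono in_X by (auto simp: strongly_monotone_op_def)
  moreover have "(r - s) * ((y' - c) \<bullet> (y' - y)) \<le> (r - s) * (norm (y' - c) * norm (y' - y))"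
    using r by (intro mult_left_mono norm_cauchy_schwarz) auto
  ultimately have "((\<mu> + r) * norm (y' - y)) * norm (y' - y) \<le> ((r - s) * norm (y' - c)) * norm (y' - y)"
    by (simp add: algebra_simps power2_eq_square)
  then show ?thesis
    using r by (cases "y' = y") (auto dest: mult_right_le_imp_le)
qed

section \<open>The anchored tensor method\<close>

locale tensor_vi =
  fixes d :: nat and X :: "vec set" and p :: nat and L a m \<theta> :: real
    and tstep :: "(vec \<Rightarrow> vec) \<Rightarrow> vec \<Rightarrow> vec"
  assumes p: "p \<ge> 2" and constants: "tensor_constants p a m \<theta>"
    and X_Rd: "X \<subseteq> Rd d" and X_ne: "X \<noteq> {}" and X_compact: "compact X" and X_convex: "convex X"
    and L: "L > 0" and selection: "tensor_step_selection d X p L (m * L) tstep"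
begin

abbreviation "\<rho> \<equiv> rho p L a"

definition well_posed :: "real \<Rightarrow> (vec \<Rightarrow> vec) \<Rightarrow> bool" where
  "well_posed \<mu> G \<longleftrightarrow>
     \<mu> > 0 \<and> G ` Rd d \<subseteq> Rd d \<and> strongly_monotone_op X \<mu> G \<and> smooth_order d X p L G"

lemma a: "a > 0" and m: "m \<ge> 1" and \<theta>: "0 < \<theta>" "\<theta> < 1"
  using constants by (auto simp: tensor_constants_def)

lemma well_posed_shift:
  assumes "well_posed \<mu> G" "r \<ge> 0" "c \<in> Rd d"
  shows "well_posed (\<mu> + r) (\<lambda>z. G z + r *\<^sub>R (z - c))"
  using assms strongly_monotone_shift smooth_order_shift[OF p]
  by (auto simp: well_posed_def image_subset_iff)

lemma well_posed_solution_exists: "well_posed \<mu> G \<Longrightarrow> \<exists>y. vi_solution X G y"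
  using vi_solution_exists[OF X_Rd X_compact X_convex X_ne p] by (auto simp: well_posed_def)

lemma tstep_is_tensor_step:
  assumes "well_posed \<mu> G" "x \<in> X"
  shows "is_tensor_step d X p (m * L) G x (tstep G x)"
  using assms selection by (auto simp: well_posed_def tensor_step_selection_def)

lemma tstep_in_X: "well_posed \<mu> G \<Longrightarrow> x \<in> X \<Longrightarrow> tstep G x \<in> X"
  using tstep_is_tensor_step by (auto simp: is_tensor_step_def)

text \<open>
  The defining property of the constants \<open>a\<close>, \<open>m\<close>, \<open>\<theta>\<close>, for the selected tensor step.
\<close>

lemma tstep_contraction:
  assumes G: "well_posed \<mu> G" and y: "y \<in> X" and ys: "vi_solution X G ys" and close: "norm (y - ys) \<le> \<rho> \<mu>"
  shows "norm (tstep G y - ys) \<le> \<theta> * norm (y - ys)"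
proof -
  have "ys \<in> X" "G ys \<in> Rd d" using ys G X_Rd by (auto simp: vi_solution_def well_posed_def)
  moreover have "0 \<in> plus_normal_cone d X (G ys) ys"
    using ys calculation by (simp add: zero_in_plus_normal_cone_iff vi_solution_def)
  moreover have "\<forall>d X L \<mu> G ys y z.
        X \<subseteq> Rd d \<and> X \<noteq> {} \<and> compact X \<and> convex X \<and> L > 0 \<and> \<mu> > 0 \<and>
        G ` Rd d \<subseteq> Rd d \<and> strongly_monotone_op X \<mu> G \<and> smooth_order d X p L G \<and>
        ys \<in> X \<and> 0 \<in> plus_normal_cone d X (G ys) ys \<and>
        y \<in> X \<and> norm (y - ys) \<le> rho p L a \<mu> \<and>
        is_tensor_step d X p (m * L) G y z
        \<longrightarrow> norm (z - ys) \<le> \<theta> * norm (y - ys)"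
    using constants by (simp add: tensor_constants_def)
  ultimately show ?thesis
    using G y close tstep_is_tensor_step[OF G y] X_Rd X_ne X_compact X_convex L unfolding well_posed_def by blast
qed

lemma rho_pos: "\<mu> > 0 \<Longrightarrow> \<rho> \<mu> > 0"
  using a L p by (simp add: rho_def)

lemma rho_power: "\<mu> > 0 \<Longrightarrow> \<rho> \<mu> ^ (p - 1) = a ^ (p - 1) * (\<mu> / L)"
  using L p by (simp add: rho_def power_mult_distrib)

text \<open>
  This is why \<open>atm_mu\<close> has the power \<open>p - 1\<close>: at strength \<open>\<mu> s\<^sup>p\<^sup>-\<^sup>1\<close> the radius of contraction
  is \<open>s\<close> times as large.
\<close>

lemma rho_scale:
  assumes "s \<ge> 0"
  shows "\<rho> (\<mu> * s ^ (p - 1)) = s * \<rho> \<mu>"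
proof -
  have "root (p - 1) (\<mu> * s ^ (p - 1) / L) = root (p - 1) (\<mu> / L) * root (p - 1) (s ^ (p - 1))"
    by (simp add: real_root_mult[symmetric])
  also have "root (p - 1) (s ^ (p - 1)) = s" using p assms by (simp add: real_root_power_cancel)
  finally show ?thesis by (simp add: rho_def)
qed

text \<open>
  In terms of this constant the radii are \<open>r\<^sub>k = R / (1 + k decay)\<close> until they reach \<open>\<rho>(\<mu>)\<close>.
\<close>

definition decay :: real where
  "decay = (1 - \<theta>) / (2 * real (p - 1))"

lemma decay: "0 < decay" "decay \<le> (1 - \<theta>) / 2" "decay \<le> 1" "real (p - 1) * decay = (1 - \<theta>) / 2"
proof -
  define P where "P = real (p - 1)"
  have P: "1 \<le> P" using p by (simp add: P_def)
  have eq: "decay = (1 - \<theta>) / (2 * P)" by (simp add: decay_def P_def)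
  show "0 < decay" using eq P \<theta> by simp
  show "decay \<le> (1 - \<theta>) / 2" unfolding eq using P \<theta> by (intro divide_left_mono) auto
  then show "decay \<le> 1" using \<theta> by simp
  have "P * decay = (1 - \<theta>) / 2" using eq P by simp
  then show "real (p - 1) * decay = (1 - \<theta>) / 2" by (simp only: P_def)
qed

abbreviation "rad \<equiv> atm_r p L a \<theta>"
abbreviation "strength \<equiv> atm_mu p L a \<theta>"
abbreviation "steps \<equiv> atm_K p L a \<theta>"

lemma rad_eq: "R > 0 \<Longrightarrow> rad \<mu> R k = max (\<rho> \<mu>) (R / (1 + real k * decay))"
proof -
  assume R: "R > 0"
  have "1 / R + real k * (1 - \<theta>) / (2 * R * real (p - 1)) = (1 + real k * decay) / R"
    using R by (simp add: decay_def add_divide_distrib mult_ac del: of_nat_diff)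
  then show ?thesis by (simp add: atm_r_def)
qed

lemma rad_0: "\<rho> \<mu> > 0 \<Longrightarrow> \<rho> \<mu> \<le> R \<Longrightarrow> rad \<mu> R 0 = R"
  by (simp add: atm_r_def)

lemma rad_ge_rho: "rad \<mu> R k \<ge> \<rho> \<mu>"
  by (simp add: atm_r_def)

lemma
  assumes \<mu>: "\<mu> > 0" and R: "\<rho> \<mu> \<le> R"
  shows rad_steps: "rad \<mu> R (steps \<mu> R) = \<rho> \<mu>"
    and steps_le: "real (steps \<mu> R) \<le> R / \<rho> \<mu> / decay"
proof -
  have \<rho>: "\<rho> \<mu> > 0" using rho_pos[OF \<mu>] .
  define k where "k = nat \<lceil>(R / \<rho> \<mu> - 1) / decay\<rceil>"
  have "(R / \<rho> \<mu> - 1) / decay \<le> real k" unfolding k_def by linarith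
  then have "R / \<rho> \<mu> - 1 \<le> real k * decay" using decay by (simp add: pos_divide_le_eq)
  then have "R / (1 + real k * decay) \<le> \<rho> \<mu>"
    using \<rho> decay by (simp add: pos_divide_le_eq add_pos_nonneg diff_le_eq algebra_simps)
  then have rk: "rad \<mu> R k = \<rho> \<mu>" using \<rho> R by (subst rad_eq) auto
  show "rad \<mu> R (steps \<mu> R) = \<rho> \<mu>"
    unfolding atm_K_def by (rule LeastI[of _ k]) (rule rk)
  have "steps \<mu> R \<le> k" unfolding atm_K_def by (rule Least_le) (rule rk)
  moreover have "real k \<le> (R / \<rho> \<mu> - 1) / decay + 1"
  proof -
    have "0 \<le> (R / \<rho> \<mu> - 1) / decay" using R \<rho> decay by simp
    then show ?thesis unfolding k_def by linarith
  qed
  moreover have "(R / \<rho> \<mu> - 1) / decay + 1 \<le> R / \<rho> \<mu> / decay"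
  proof -
    have "1 \<le> 1 / decay" using decay by simp
    then show ?thesis by (simp add: diff_divide_distrib)
  qed
  ultimately show "real (steps \<mu> R) \<le> R / \<rho> \<mu> / decay" by linarith
qed

lemma rad_before_steps:
  assumes "k < steps \<mu> R" "R > 0"
  shows "rad \<mu> R k = R / (1 + real k * decay)"
proof -
  have "rad \<mu> R k \<noteq> \<rho> \<mu>" using assms(1) not_less_Least unfolding atm_K_def by blast
  then show ?thesis using assms(2) by (auto simp: rad_eq max_def split: if_splits)
qed

text \<open>
  One tensor step brings the iterate within \<open>\<theta> r\<close> of the current path point, and the path then moves by
  at most \<open>(1 - (r'/r)\<^sup>p\<^sup>-\<^sup>1) R\<close>. By Bernoulli's inequality the second term is at most
  \<open>(p - 1) decay r' = (1 - \<theta>)/2 r'\<close>, and \<open>r \<le> (1 + decay) r'\<close> bounds the first by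
  \<open>(1 + \<theta>)/2 r'\<close>. The constant \<open>decay\<close> is chosen to make these two numbers add up to \<open>r'\<close>.
\<close>

lemma radius_step_inequality:
  fixes r r' R :: real and k :: nat
  assumes R: "R > 0" and r: "r = R / (1 + real k * decay)" and r': "R / (1 + real (Suc k) * decay) \<le> r'"
    and le: "r' \<le> r"
  shows "\<theta> * r + (1 - (r' / r) ^ (p - 1)) * R \<le> r'"
proof -
  define A where "A = 1 + real k * decay"
  have A: "A \<ge> 1" using decay by (simp add: A_def)
  have A': "1 + real (Suc k) * decay = A + decay" by (simp add: A_def algebra_simps)
  have rpos: "r > 0" using r R A unfolding A_def by simp
  have r'pos: "r' > 0"
  proof -
    have "0 < R / (A + decay)" using R A decay by simp
    then show ?thesis using r' unfolding A' by (rule less_le_trans)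
  qed
  have R_le: "R \<le> r' * (A + decay)"
    using r' A' A decay by (simp add: pos_divide_le_eq)
  have R_eq: "R = r * A" using r A by (simp add: A_def)
  have "1 - real (p - 1) * (1 - r' / r) \<le> (r' / r) ^ (p - 1)"
    using Bernoulli_inequality[of "r' / r - 1" "p - 1"] rpos r'pos by (simp add: algebra_simps)
  then have "(1 - (r' / r) ^ (p - 1)) * R \<le> (real (p - 1) * (1 - r' / r)) * R"
    using R by (intro mult_right_mono) auto
  also have "\<dots> = real (p - 1) * (R - r' * A)"
    unfolding R_eq using rpos by (simp add: algebra_simps)
  also have "\<dots> \<le> real (p - 1) * (r' * decay)"
    using R_le by (intro mult_left_mono) (auto simp: algebra_simps)
  also have "\<dots> = r' * ((1 - \<theta>) / 2)" 
    using decay(4) by (simp only: mult.left_commute)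
  finally have 1: "(1 - (r' / r) ^ (p - 1)) * R \<le> r' * ((1 - \<theta>) / 2)" .
  have "r * A \<le> r' * (A + decay)" using R_le R_eq by simp
  also have "\<dots> \<le> r' * (A + A * decay)" using r'pos decay A by (intro mult_left_mono) auto
  also have "\<dots> = (r' * (1 + decay)) * A" by (simp add: algebra_simps)
  finally have "r \<le> r' * (1 + decay)" using A by (simp add: mult_le_cancel_right)
  then have "\<theta> * r \<le> \<theta> * (r' * (1 + decay))" using \<theta> by (intro mult_left_mono) auto
  also have "\<dots> \<le> r' * ((1 + \<theta>) / 2)"
  proof -
    have "\<theta> * decay \<le> 1 * ((1 - \<theta>) / 2)" using \<theta> decay by (intro mult_mono) auto
    then have "\<theta> * (1 + decay) \<le> (1 + \<theta>) / 2" by (simp add: algebra_simps)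
    then have "r' * (\<theta> * (1 + decay)) \<le> r' * ((1 + \<theta>) / 2)" using r'pos by (intro mult_left_mono) auto
    then show ?thesis by (simp add: algebra_simps)
  qed
  finally have "\<theta> * r \<le> r' * ((1 + \<theta>) / 2)" .
  moreover have "r' * ((1 + \<theta>) / 2) + r' * ((1 - \<theta>) / 2) = r'" by (simp add: field_simps)
  ultimately show ?thesis using 1 by linarith
qed

abbreviation "iter \<equiv> atm_iter p L a \<theta> tstep"

definition anchored :: "(vec \<Rightarrow> vec) \<Rightarrow> vec \<Rightarrow> real \<Rightarrow> real \<Rightarrow> nat \<Rightarrow> vec \<Rightarrow> vec" where
  "anchored G z0 \<mu> R k z = G z + (strength \<mu> R k - \<mu>) *\<^sub>R (z - z0)"

lemma strength_ge:
  assumes "\<mu> > 0"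
  shows "strength \<mu> R k \<ge> \<mu>"
proof -
  have "1 \<le> rad \<mu> R k / \<rho> \<mu>" using rad_ge_rho rho_pos[OF assms] by simp
  then have "1 \<le> (rad \<mu> R k / \<rho> \<mu>) ^ (p - 1)" by (rule one_le_power)
  then show ?thesis using assms by (simp add: atm_mu_def)
qed

lemma well_posed_anchored:
  assumes "well_posed \<mu> G" "z0 \<in> X"
  shows "well_posed (strength \<mu> R k) (anchored G z0 \<mu> R k)"
proof -
  have "well_posed (\<mu> + (strength \<mu> R k - \<mu>)) (anchored G z0 \<mu> R k)"
    unfolding anchored_def[abs_def]
    by (rule well_posed_shift) (use assms strength_ge X_Rd in \<open>auto simp: well_posed_def\<close>)
  then show ?thesis by simp
qed

lemma iter_Suc:
  "iter G z0 \<mu> R (Suc k)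
    = tstep (if k < steps \<mu> R then anchored G z0 \<mu> R k else G) (iter G z0 \<mu> R k)"
  by (simp add: anchored_def[abs_def])

lemma iter_in_X:
  assumes "well_posed \<mu> G" "z0 \<in> X"
  shows "iter G z0 \<mu> R k \<in> X"
proof (induction k)
  case (Suc k)
  then show ?case
    unfolding iter_Suc using tstep_in_X[OF assms(1)] tstep_in_X[OF well_posed_anchored[OF assms]] by simp
qed (use assms in simp)

lemma rho_strength:
  assumes "\<mu> > 0"
  shows "\<rho> (strength \<mu> R k) = rad \<mu> R k"
  using rho_pos[OF assms] rad_ge_rho[of \<mu> R k] rho_scale[of "rad \<mu> R k / \<rho> \<mu>" \<mu>]
  by (simp add: atm_mu_def)

text \<open>
  The invariant of the path-following phase: the iterate lies in the region of contraction of the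
  problem that the next step addresses.
\<close>

lemma anchored_phase:
  assumes G: "well_posed \<mu> G" and z0: "z0 \<in> X" and ys: "vi_solution X G ys"
    and R: "\<rho> \<mu> \<le> R" "norm (z0 - ys) \<le> R"
    and k: "k \<le> steps \<mu> R" and y: "vi_solution X (anchored G z0 \<mu> R k) y"
  shows "norm (iter G z0 \<mu> R k - y) \<le> rad \<mu> R k"
  using k y
proof (induction k arbitrary: y)
  have \<mu>: "\<mu> > 0" and mono: "strongly_monotone_op X \<mu> G" using G by (auto simp: well_posed_def)
  have anchor_dist: "norm (y - z0) \<le> R" if "vi_solution X (anchored G z0 \<mu> R k) y" for k y
    using vi_solution_anchored_dist[OF mono \<mu> _ ys that[unfolded anchored_def[abs_def]]]
      strength_ge[OF \<mu>, of R k] R(2) by (simp add: norm_minus_commute)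
  {
    case 0
    then show ?case
      using anchor_dist[OF 0(2)] R(1) rho_pos[OF \<mu>] by (simp add: rad_0 norm_minus_commute)
  next
    case (Suc k)
    have Rpos: "R > 0" using rho_pos[OF \<mu>] R(1) by linarith
    let ?r = "rad \<mu> R k" and ?r' = "rad \<mu> R (Suc k)"
    have rpos: "?r > 0" "?r' > 0" using rad_ge_rho rho_pos[OF \<mu>] less_le_trans by blast+
    obtain y0 where y0: "vi_solution X (anchored G z0 \<mu> R k) y0"
      using well_posed_solution_exists[OF well_posed_anchored[OF G z0]] by blast
    have "norm (iter G z0 \<mu> R k - y0) \<le> ?r" using Suc.IH[OF _ y0] Suc.prems by simp
    then have "norm (iter G z0 \<mu> R (Suc k) - y0) \<le> \<theta> * norm (iter G z0 \<mu> R k - y0)"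
      unfolding iter_Suc using Suc.prems
      by (simp add: tstep_contraction[OF well_posed_anchored[OF G z0] iter_in_X[OF G z0] y0]
          rho_strength[OF \<mu>])
    also have "\<dots> \<le> \<theta> * ?r" using Suc.IH[OF _ y0] Suc.prems \<theta> by (intro mult_left_mono) auto
    finally have 1: "norm (iter G z0 \<mu> R (Suc k) - y0) \<le> \<theta> * ?r" .
    have r_eq: "?r = R / (1 + real k * decay)"
      using rad_before_steps Suc.prems(1) Rpos by auto
    have r'_ge: "R / (1 + real (Suc k) * decay) \<le> ?r'" using rad_eq[OF Rpos] by simp
    have "R / (1 + real (Suc k) * decay) \<le> R / (1 + real k * decay)"
      using Rpos decay by (intro divide_left_mono) (auto intro!: mult_pos_pos add_pos_nonneg)
    then have r'_le: "?r' \<le> ?r" using rad_eq[OF Rpos] by (auto simp: max_def)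
    \<comment> \<open>The path moves by a controlled amount: the strengths have the ratio \<open>(r'/r)\<^sup>p\<^sup>-\<^sup>1\<close>, and the
          new path point is within \<open>R\<close> of the anchor.\<close>
    have \<mu>': "strength \<mu> R (Suc k) = strength \<mu> R k * (?r' / ?r) ^ (p - 1)"
      using rpos rho_pos[OF \<mu>] by (simp add: atm_mu_def power_divide)
    have ratio: "(?r' / ?r) ^ (p - 1) \<le> 1"
      using r'_le rpos by (intro power_le_one) auto
    have spos: "strength \<mu> R k > 0" using strength_ge[OF \<mu>, of R k] \<mu> by linarith
    have "strength \<mu> R k * norm (y - y0) \<le> (strength \<mu> R k - strength \<mu> R (Suc k)) * norm (y - z0)"
      using vi_solution_path_dist[OF mono _ _ y0[unfolded anchored_def[abs_def]]
          Suc.prems(2)[unfolded anchored_def[abs_def]]] spos ratio \<mu>'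
      by (simp add: mult_left_le)
    also have "\<dots> \<le> (strength \<mu> R k - strength \<mu> R (Suc k)) * R"
      using anchor_dist[OF Suc.prems(2)] ratio spos \<mu>' by (intro mult_left_mono) (auto simp: mult_left_le)
    also have "\<dots> = strength \<mu> R k * ((1 - (?r' / ?r) ^ (p - 1)) * R)"
      by (simp add: \<mu>' algebra_simps)
    finally have "norm (y - y0) \<le> (1 - (?r' / ?r) ^ (p - 1)) * R"
      using spos by simp
    then show ?case
      using radius_step_inequality[OF Rpos r_eq r'_ge r'_le] 1
        norm_triangle_ineq4[of "iter G z0 \<mu> R (Suc k) - y0" "y - y0"] by simp
  }
qed

text \<open>
  At the end of the path the anchor term has strength zero, and linear convergence starts from the
  radius \<open>\<rho>(\<mu>)\<close>.
\<close>

lemma restored_phase: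
  assumes G: "well_posed \<mu> G" and z0: "z0 \<in> X" and ys: "vi_solution X G ys"
    and R: "\<rho> \<mu> \<le> R" "norm (z0 - ys) \<le> R"
  shows "norm (iter G z0 \<mu> R (steps \<mu> R + s) - ys) \<le> \<theta> ^ s * \<rho> \<mu>"
proof (induction s)
  case 0
  have \<mu>: "\<mu> > 0" using G by (auto simp: well_posed_def)
  have "anchored G z0 \<mu> R (steps \<mu> R) = G"
    using rad_steps[OF \<mu> R(1)] rho_pos[OF \<mu>] by (simp add: anchored_def[abs_def] atm_mu_def)
  then show ?case
    using anchored_phase[OF G z0 ys R order_refl] ys rad_steps[OF \<mu> R(1)] by simp
next
  case (Suc s)
  have \<mu>: "\<mu> > 0" using G by (auto simp: well_posed_def)
  have "\<theta> ^ s \<le> 1" using \<theta> by (intro power_le_one) auto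
  then have "\<theta> ^ s * \<rho> \<mu> \<le> 1 * \<rho> \<mu>" using rho_pos[OF \<mu>] by (intro mult_right_mono) auto
  then have "norm (iter G z0 \<mu> R (steps \<mu> R + s) - ys) \<le> \<rho> \<mu>" using Suc by linarith
  then have "norm (iter G z0 \<mu> R (steps \<mu> R + Suc s) - ys)
      \<le> \<theta> * norm (iter G z0 \<mu> R (steps \<mu> R + s) - ys)"
    unfolding add_Suc_right iter_Suc using tstep_contraction[OF G iter_in_X[OF G z0] ys] by simp
  also have "\<dots> \<le> \<theta> * (\<theta> ^ s * \<rho> \<mu>)" using Suc \<theta> by (intro mult_left_mono) auto
  finally show ?case by simp
qed

section \<open>The adaptive choice of the radius\<close>

abbreviation "fine_steps \<equiv> adaptive_S p L a m \<theta>"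

lemma fine_steps_pos: "fine_steps \<mu> \<delta> \<ge> 1"
  by (simp add: adaptive_S_def)

lemma h_const_pos: "h_const p a m > 0"
  using a m by (simp add: h_const_def)

text \<open>
  The left-hand side is the bound on \<open>\<mu>\<^sup>-\<^sup>1 \<parallel>G u + n\<parallel>\<close> after that many steps of linear convergence,
  see \<open>stops_if_radius_large\<close>.
\<close>

lemma fine_steps_suffice:
  assumes \<mu>: "\<mu> > 0" and \<delta>: "\<delta> > 0"
  shows "h_const p a m * \<rho> \<mu> * \<theta> ^ (p * fine_steps \<mu> \<delta>) \<le> \<delta>"
proof -
  let ?S = "fine_steps \<mu> \<delta>" and ?x = "h_const p a m * \<rho> \<mu> / \<delta>"
  have x: "?x > 0" using h_const_pos rho_pos[OF \<mu>] \<delta> by simp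
  have l: "ln (1 / \<theta>) > 0" using \<theta> by (simp add: ln_div)
  have pl: "real p * ln (1 / \<theta>) > 0" using l p by simp
  have "log_plus ?x / (real p * ln (1 / \<theta>)) \<le> real ?S"
    unfolding adaptive_S_def by linarith
  then have "log_plus ?x \<le> real ?S * (real p * ln (1 / \<theta>))"
    using pl by (simp only: pos_divide_le_eq)
  then have "ln ?x \<le> real (p * ?S) * ln (1 / \<theta>)" by (simp add: log_plus_def mult_ac)
  then have "?x \<le> exp (real (p * ?S) * ln (1 / \<theta>))"
    using x by (metis exp_le_cancel_iff exp_ln)
  also have "\<dots> = (1 / \<theta>) ^ (p * ?S)"
    using \<theta> by (subst exp_of_nat_mult) (simp add: exp_ln)
  finally show ?thesis
    using \<delta> \<theta> by (simp add: power_one_over pos_divide_le_eq pos_le_divide_eq)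
qed

abbreviation "pass \<equiv> adaptive_pass d p L a m \<theta> tstep"
abbreviation "stops \<equiv> adaptive_stop d p L a m \<theta> tstep"

definition radius_guess :: "real \<Rightarrow> real \<Rightarrow> nat \<Rightarrow> real" where
  "radius_guess \<mu> \<delta> j = 2 ^ j * real (fine_steps \<mu> \<delta>) * \<rho> \<mu>"

lemma radius_guess_ge:
  assumes "\<mu> > 0"
  shows "\<rho> \<mu> \<le> radius_guess \<mu> \<delta> j"
proof -
  have "1 * 1 \<le> 2 ^ j * real (fine_steps \<mu> \<delta>)"
    using fine_steps_pos[of \<mu> \<delta>] by (intro mult_mono) auto
  then have "1 * \<rho> \<mu> \<le> 2 ^ j * real (fine_steps \<mu> \<delta>) * \<rho> \<mu>"
    using rho_pos[OF assms] by (intro mult_right_mono) auto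
  then show ?thesis by (simp add: radius_guess_def)
qed

definition pass_end :: "(vec \<Rightarrow> vec) \<Rightarrow> vec \<Rightarrow> real \<Rightarrow> real \<Rightarrow> nat \<Rightarrow> vec" where
  "pass_end G y \<mu> \<delta> j =
     iter G y \<mu> (radius_guess \<mu> \<delta> j) (steps \<mu> (radius_guess \<mu> \<delta> j) + fine_steps \<mu> \<delta>)"

lemma pass_eq:
  "pass G y \<mu> \<delta> j =
    (let w = pass_end G y \<mu> \<delta> j; u = tstep G w
     in (u, - reg_model d p (m * L) G w u, steps \<mu> (radius_guess \<mu> \<delta> j) + fine_steps \<mu> \<delta> + 2))"
  by (simp add: adaptive_pass_def anchored_tensor_method_def Let_def pass_end_def radius_guess_def)

lemma pass_result:
  assumes G: "well_posed \<mu> G" and y: "y \<in> X" and res: "pass G y \<mu> \<delta> j = (u, n, c)"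
  shows "u \<in> X" "n \<in> normal_cone d X u"
    "real c \<le> 2 ^ j * real (fine_steps \<mu> \<delta>) / decay + 3 * real (fine_steps \<mu> \<delta>)"
proof -
  have \<mu>: "\<mu> > 0" using G by (auto simp: well_posed_def)
  have "is_tensor_step d X p (m * L) G (pass_end G y \<mu> \<delta> j) u" "n = - reg_model d p (m * L) G (pass_end G y \<mu> \<delta> j) u"
    using res tstep_is_tensor_step[OF G iter_in_X[OF G y]] by (auto simp: pass_eq Let_def pass_end_def)
  then show "u \<in> X" "n \<in> normal_cone d X u"
    by (auto simp: is_tensor_step_def plus_normal_cone_def add_eq_0_iff)
  have "real (steps \<mu> (radius_guess \<mu> \<delta> j)) \<le> 2 ^ j * real (fine_steps \<mu> \<delta>) / decay"
    using steps_le[OF \<mu> radius_guess_ge[OF \<mu>], of \<delta> j] rho_pos[OF \<mu>] by (simp add: radius_guess_def)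
  moreover have "c = steps \<mu> (radius_guess \<mu> \<delta> j) + fine_steps \<mu> \<delta> + 2"
    using res by (simp add: pass_eq Let_def)
  moreover have "1 \<le> real (fine_steps \<mu> \<delta>)" using fine_steps_pos[of \<mu> \<delta>] by simp
  ultimately show "real c \<le> 2 ^ j * real (fine_steps \<mu> \<delta>) / decay + 3 * real (fine_steps \<mu> \<delta>)" by simp
qed

lemma stops_iff:
  assumes "\<mu> > 0" "pass G y \<mu> \<delta> j = (u, n, c)"
  shows "stops G y \<mu> \<delta> j \<longleftrightarrow> norm (G u + n) \<le> \<mu> * \<delta>"
  using assms by (simp add: adaptive_stop_def field_simps)

text \<open>
  The vector \<open>G u + n\<close> is the Taylor error of the last step minus its regularisation term, so its norm is at
  most \<open>(m + 1) L / p! \<parallel>u - w\<parallel>\<^sup>p\<close>. Both \<open>w\<close> and \<open>u\<close> are within \<open>t = \<theta>\<^sup>S \<rho>(\<mu>)\<close> of the solution, and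
  \<open>\<rho>(\<mu>)\<^sup>p\<^sup>-\<^sup>1 = a\<^sup>p\<^sup>-\<^sup>1 \<mu> / L\<close> turns \<open>(m + 1) L / p! (2t)\<^sup>p\<close> into \<open>\<mu>\<close> times the quantity of
  \<open>fine_steps_suffice\<close>.
\<close>

lemma stops_if_radius_large:
  assumes G: "well_posed \<mu> G" and y: "y \<in> X" and ys: "vi_solution X G ys" and \<delta>: "\<delta> > 0"
    and R: "norm (y - ys) \<le> radius_guess \<mu> \<delta> j"
  shows "stops G y \<mu> \<delta> j"
proof -
  have \<mu>: "\<mu> > 0" and smooth: "smooth_order d X p L G" using G by (auto simp: well_posed_def)
  define w where "w = pass_end G y \<mu> \<delta> j"
  define u where "u = tstep G w"
  define n where "n = - reg_model d p (m * L) G w u"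
  define t where "t = \<theta> ^ fine_steps \<mu> \<delta> * \<rho> \<mu>"
  obtain c where res: "pass G y \<mu> \<delta> j = (u, n, c)"
    by (simp add: pass_eq w_def u_def n_def Let_def)
  have w: "w \<in> X" "norm (w - ys) \<le> t"
    unfolding w_def pass_end_def t_def
    using iter_in_X[OF G y] restored_phase[OF G y ys radius_guess_ge[OF \<mu>] R] by auto
  have "\<theta> ^ fine_steps \<mu> \<delta> \<le> 1" using \<theta> by (intro power_le_one) auto
  then have "t \<le> 1 * \<rho> \<mu>" unfolding t_def using rho_pos[OF \<mu>] by (intro mult_right_mono) auto
  then have "norm (u - ys) \<le> \<theta> * norm (w - ys)"
    unfolding u_def using w by (intro tstep_contraction[OF G w(1) ys]) auto
  also have "\<dots> \<le> 1 * norm (w - ys)" using \<theta> by (intro mult_right_mono) auto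
  finally have uw: "norm (u - w) \<le> 2 * t"
    using w(2) norm_triangle_ineq4[of "u - ys" "w - ys"] by simp
  have u: "u \<in> X" unfolding u_def by (rule tstep_in_X[OF G w(1)])
  let ?reg = "(m * L / fact p * norm (u - w) ^ (p - 1)) *\<^sub>R (u - w)"
  have "G u + n = (G u - taylor_model d p G w u) - ?reg"
    by (simp add: n_def reg_model_def)
  then have "norm (G u + n) \<le> norm (G u - taylor_model d p G w u) + norm ?reg"
    by (simp only: norm_triangle_ineq4)
  also have "norm ?reg = m * L / fact p * norm (u - w) ^ p"
    using m L p by (cases p) auto
  also have "norm (G u - taylor_model d p G w u) \<le> L / fact p * norm (u - w) ^ p"
    by (rule taylor_model_error[OF X_Rd X_convex p smooth w(1) u])
  finally have "norm (G u + n) \<le> (m + 1) * L / fact p * norm (u - w) ^ p"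
    by (simp add: field_simps)
  also have "\<dots> \<le> (m + 1) * L / fact p * (2 * t) ^ p"
    using uw m L by (intro mult_left_mono power_mono) auto
  also have "\<dots> = \<mu> * (h_const p a m * \<rho> \<mu> * \<theta> ^ (p * fine_steps \<mu> \<delta>))"
  proof -
    have p': "p = Suc (p - 1)" using p by simp
    have "t ^ p = \<theta> ^ (p * fine_steps \<mu> \<delta>) * (\<rho> \<mu> * \<rho> \<mu> ^ (p - 1))"
      unfolding t_def power_mult_distrib
      by (subst (3) p') (simp add: power_mult[symmetric] mult.commute)
    moreover have "L * \<rho> \<mu> ^ (p - 1) = \<mu> * a ^ (p - 1)"
      using L by (simp add: rho_power[OF \<mu>] del: One_nat_def)
    moreover have "L * t ^ p = (L * \<rho> \<mu> ^ (p - 1)) * (\<rho> \<mu> * \<theta> ^ (p * fine_steps \<mu> \<delta>))"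
      unfolding calculation(1) by (simp only: mult_ac)
    ultimately have Lt: "L * t ^ p = \<mu> * a ^ (p - 1) * \<rho> \<mu> * \<theta> ^ (p * fine_steps \<mu> \<delta>)"
      by (simp only: mult.assoc)
    have "(m + 1) * L / fact p * (2 * t) ^ p = (m + 1) * 2 ^ p / fact p * (L * t ^ p)"
      by (simp only: power_mult_distrib) simp
    also have "\<dots> = \<mu> * (h_const p a m * \<rho> \<mu> * \<theta> ^ (p * fine_steps \<mu> \<delta>))"
      unfolding Lt h_const_def by (simp only: times_divide_eq_left times_divide_eq_right mult_ac)
    finally show ?thesis .
  qed
  also have "\<dots> \<le> \<mu> * \<delta>" using fine_steps_suffice[OF \<mu> \<delta>] \<mu> by simp
  finally show ?thesis using stops_iff[OF \<mu> res] by simp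
qed

definition adaptive_const :: real where
  "adaptive_const = 2 / decay + 3"

lemma adaptive_const_pos: "adaptive_const > 0"
  using decay by (simp add: adaptive_const_def add_pos_pos)

text \<open>
  A rejected radius is smaller than the distance \<open>\<parallel>y - ys\<parallel>\<close>, so the accepted one is less than twice this
  distance or the initial guess \<open>S \<rho>(\<mu>)\<close>. The cost of a pass is dominated by a term proportional to
  the radius, and the radii double, so the last pass determines the total.
\<close>

lemma r_adaptive_atm_guarantee:
  assumes G: "well_posed \<mu> G" and y: "y \<in> X" and ys: "vi_solution X G ys" and \<delta>: "\<delta> > 0"
  shows "\<exists>u n N. r_adaptive_atm d p L a m \<theta> tstep G y \<mu> \<delta> = Some (u, n, N) \<and>
    u \<in> X \<and> n \<in> normal_cone d X u \<and> norm (G u + n) \<le> \<mu> * \<delta> \<and>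
    real N \<le> adaptive_const * (real (fine_steps \<mu> \<delta>) + 2 * norm (y - ys) / \<rho> \<mu>)"
proof -
  have \<mu>: "\<mu> > 0" using G by (auto simp: well_posed_def)
  let ?S = "fine_steps \<mu> \<delta>"
  have S: "real ?S \<ge> 1" using fine_steps_pos[of \<mu> \<delta>] by simp
  have S\<rho>: "real ?S * \<rho> \<mu> > 0" using S rho_pos[OF \<mu>] by simp
  obtain j0 :: nat where "norm (y - ys) / (real ?S * \<rho> \<mu>) < 2 ^ j0"
    using real_arch_pow[of 2] by auto
  then have "norm (y - ys) \<le> radius_guess \<mu> \<delta> j0"
    using S\<rho> by (simp add: radius_guess_def pos_divide_less_eq mult_ac)
  then have ex: "\<exists>j. stops G y \<mu> \<delta> j" using stops_if_radius_large[OF G y ys \<delta>] by blast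
  define J where "J = (LEAST j. stops G y \<mu> \<delta> j)"
  have J: "stops G y \<mu> \<delta> J" unfolding J_def using ex by (rule LeastI_ex)
  obtain u n c where res: "pass G y \<mu> \<delta> J = (u, n, c)" by (cases "pass G y \<mu> \<delta> J")
  define N where "N = (\<Sum>j\<le>J. snd (snd (pass G y \<mu> \<delta> j)))"
  have eq: "r_adaptive_atm d p L a m \<theta> tstep G y \<mu> \<delta> = Some (u, n, N)"
    using ex res by (simp add: r_adaptive_atm_def J_def[symmetric] N_def Let_def)
  have J_bound: "2 ^ J * real ?S \<le> real ?S + 2 * norm (y - ys) / \<rho> \<mu>"
  proof (cases J)
    case 0
    then show ?thesis using rho_pos[OF \<mu>] by simp
  next
    case (Suc i)
    then have "\<not> stops G y \<mu> \<delta> i" unfolding J_def by (intro not_less_Least) simp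
    then have "radius_guess \<mu> \<delta> i < norm (y - ys)"
      using stops_if_radius_large[OF G y ys \<delta>] by (meson not_le)
    then have "2 ^ i * real ?S \<le> norm (y - ys) / \<rho> \<mu>"
      using rho_pos[OF \<mu>] by (simp add: radius_guess_def pos_le_divide_eq)
    then show ?thesis using Suc S by simp
  qed
  have "real N = (\<Sum>j\<le>J. real (snd (snd (pass G y \<mu> \<delta> j))))" by (simp add: N_def)
  also have "\<dots> \<le> (\<Sum>j\<le>J. 2 ^ j * real ?S / decay + 3 * real ?S)"
    by (rule sum_mono) (metis pass_result(3)[OF G y] prod.collapse)
  also have "\<dots> = (\<Sum>j\<le>J. 2 ^ j) * (real ?S / decay) + real (Suc J) * (3 * real ?S)"
    by (simp add: sum.distrib sum_distrib_right sum_divide_distrib)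
  also have "\<dots> \<le> (2 * 2 ^ J) * (real ?S / decay) + 2 ^ J * (3 * real ?S)"
  proof (intro add_mono mult_right_mono)
    have "(\<Sum>j\<le>J. 2 ^ j :: real) = 2 ^ Suc J - 1"
      using geometric_sum[of "2 :: real" "Suc J"] by (simp add: lessThan_Suc_atMost)
    then show "(\<Sum>j\<le>J. 2 ^ j :: real) \<le> 2 * 2 ^ J" by simp
    \<comment> \<open>The cost that does not grow with the radius is charged once in each of the \<open>J + 1\<close> passes.\<close>
    have "Suc J \<le> 2 ^ J" using less_exp[of J] by (simp add: Suc_le_eq)
    then show "real (Suc J) \<le> 2 ^ J" by (metis of_nat_le_iff of_nat_numeral of_nat_power)
  qed (use decay in auto)
  also have "\<dots> = adaptive_const * (2 ^ J * real ?S)" by (simp add: adaptive_const_def algebra_simps)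
  also have "\<dots> \<le> adaptive_const * (real ?S + 2 * norm (y - ys) / \<rho> \<mu>)"
    using J_bound adaptive_const_pos by simp
  finally show ?thesis
    using eq J stops_iff[OF \<mu> res] pass_result[OF G y res] by blast
qed

end

section \<open>Step sizes and weights of the Halpern iteration\<close>

lemma powr_Bernoulli:
  fixes x r :: real
  assumes "r \<ge> 1" "x > -1"
  shows "1 + r * x \<le> (1 + x) powr r"
proof -
  have "(1 + x) powr r - 1 powr r \<ge> r * ((1 + x) - 1)"
  proof (rule convex_on_imp_above_tangent[OF powr_convex[OF assms(1)]])
    show "((\<lambda>x. x powr r) has_real_derivative r) (at 1 within {0<..})"
      using has_real_derivative_powr[of 1 r] by (auto intro: has_field_derivative_at_within)
  qed (use assms in \<open>auto simp: interior_open\<close>)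
  then show ?thesis by simp
qed

locale halpern_weights =
  fixes q :: real and \<eta> :: "nat \<Rightarrow> real"
  assumes q: "q \<ge> 2" and \<eta>_0: "\<eta> 0 > 0"
    and \<eta>_Suc: "\<eta> (Suc t) = \<eta> t * (real (Suc t) + 2 * q - 1) / (real (Suc t) + q)"
begin

lemma \<eta>_pos: "\<eta> t > 0"
proof (induction t)
  case (Suc t)
  then show ?case unfolding \<eta>_Suc using q by (intro divide_pos_pos mult_pos_pos) auto
qed (rule \<eta>_0)

text \<open>
  The growth factor is \<open>1 + (q - 1)/(t + q + 1)\<close>, which Bernoulli's inequality compares with a
  telescoping quotient of powers.
\<close>

lemma \<eta>_le: "\<eta> t \<le> \<eta> 0 * (real t + 1) powr (q - 1)"
proof -
  have "\<eta> t \<le> \<eta> 0 * ((real t + q + 1) / (q + 1)) powr (q - 1)"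
  proof (induction t)
    case 0
    then show ?case using q by simp
  next
    case (Suc t)
    define s where "s = real t + q + 1"
    have s: "s > 0" using q by (simp add: s_def)
    have "1 + (q - 1) * (1 / s) \<le> (1 + 1 / s) powr (q - 1)"
      by (rule powr_Bernoulli) (use q s less_trans[of "-1" 0 "1 / s"] in auto)
    moreover have "1 + (q - 1) * (1 / s) = (s + q - 1) / s" "1 + 1 / s = (s + 1) / s"
      using s by (auto simp: field_simps)
    ultimately have gr: "(s + q - 1) / s \<le> ((s + 1) / s) powr (q - 1)" by simp
    have "\<eta> (Suc t) = \<eta> t * ((s + q - 1) / s)"
      by (simp add: \<eta>_Suc s_def algebra_simps)
    also have "\<dots> \<le> (\<eta> 0 * (s / (q + 1)) powr (q - 1)) * ((s + 1) / s) powr (q - 1)"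
      using Suc gr s q \<eta>_0 unfolding s_def[symmetric] by (intro mult_mono) auto
    also have "\<dots> = \<eta> 0 * ((s + 1) / (q + 1)) powr (q - 1)"
      using s q by (simp add: powr_mult[symmetric])
    finally show ?case by (simp add: s_def algebra_simps)
  qed
  also have "\<dots> \<le> \<eta> 0 * (real t + 1) powr (q - 1)"
  proof (intro mult_left_mono powr_mono2)
    show "(real t + q + 1) / (q + 1) \<le> real t + 1"
      using q by (simp add: pos_divide_le_eq algebra_simps)
  qed (use q \<eta>_0 in auto)
  finally show ?thesis .
qed

text \<open>
  Here Bernoulli's inequality is applied to the reciprocal \<open>1 - (q - 1)/(t + 2q)\<close> of the growth factor.
\<close>

lemma \<eta>_ge: "\<eta> t \<ge> \<eta> 0 * ((real t + 1) / (2 * q - 1)) powr (q - 1)"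
proof -
  have "\<eta> 0 * ((real t + 1) / (2 * q - 1)) powr (q - 1)
      \<le> \<eta> 0 * ((real t + 2 * q - 1) / (2 * q - 1)) powr (q - 1)"
    using q \<eta>_0 by (intro mult_left_mono powr_mono2 divide_right_mono) auto
  also have "\<dots> \<le> \<eta> t"
  proof (induction t)
    case 0
    then show ?case using q by simp
  next
    case (Suc t)
    define s where "s = real t + 2 * q"
    have s: "s > 1" using q by (simp add: s_def)
    have "1 + (q - 1) * (- 1 / s) \<le> (1 + - 1 / s) powr (q - 1)"
      by (rule powr_Bernoulli) (use q s in auto)
    moreover have "1 + (q - 1) * (- 1 / s) = (s - q + 1) / s" "1 + - 1 / s = (s - 1) / s"
      using s by (auto simp: field_simps)
    ultimately have le: "(s - q + 1) / s \<le> ((s - 1) / s) powr (q - 1)" by simp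
    have sq: "s - q + 1 > 0" using q by (simp add: s_def)
    have "\<eta> 0 * (s / (2 * q - 1)) powr (q - 1) * ((s - q + 1) / s)
        \<le> \<eta> 0 * (s / (2 * q - 1)) powr (q - 1) * ((s - 1) / s) powr (q - 1)"
      using le \<eta>_0 by (intro mult_left_mono) auto
    also have "\<dots> = \<eta> 0 * ((s - 1) / (2 * q - 1)) powr (q - 1)"
      using s q by (simp add: powr_mult[symmetric])
    also have "\<dots> \<le> \<eta> t" using Suc by (simp add: s_def)
    finally have "\<eta> 0 * (s / (2 * q - 1)) powr (q - 1) \<le> \<eta> t * (s / (s - q + 1))"
      using s sq by (simp add: field_simps)
    also have "\<eta> t * (s / (s - q + 1)) = \<eta> (Suc t)"
      by (simp add: \<eta>_Suc s_def algebra_simps)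
    finally show ?case by (simp add: s_def algebra_simps)
  qed
  finally show ?thesis .
qed

text \<open>
  The weights for which the inner products \<open>\<langle>v\<^sub>t, u\<^sub>t - x\<^sub>0\<rangle>\<close> telescope; \<open>weight t\<close> equals
  \<open>\<Gamma>(t + q + 1) / (t! \<Gamma>(q + 1))\<close> and is of the order \<open>t\<^sup>q\<close>.
\<close>

primrec weight :: "nat \<Rightarrow> real" where
  "weight 0 = 1"
| "weight (Suc t) = weight t * (real (Suc t) + q) / real (Suc t)"

lemma weight_pos: "weight t > 0"
proof (induction t)
  case (Suc t)
  then show ?case unfolding weight.simps using q by (intro divide_pos_pos mult_pos_pos) auto
qed simp

declare weight.simps(2) [simp del]

text \<open>
  The factor that converts the weighted norm \<open>weight t * \<parallel>v\<^sub>t\<parallel>\<close> into the rescaled norm in which the rate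
  is constant. That it increases lets it be cancelled from sums over earlier indices, and that it is
  bounded makes sums over the increments of \<open>v\<close> comparable.
\<close>

definition gain :: "nat \<Rightarrow> real" where
  "gain t = weight t / (\<eta> t * (real t + 2 * q))"

lemma gain_weight: "weight t * real t / \<eta> t = gain t * (real t * (real t + 2 * q))"
proof -
  have "real t + 2 * q \<noteq> 0" using q by simp
  then show ?thesis by (simp add: gain_def)
qed

lemma gain_pos: "gain t > 0"
  using weight_pos \<eta>_pos q by (simp add: gain_def)

lemma gain_Suc: "gain (Suc t) = gain t * (1 + q\<^sup>2 / (real (Suc t) * (real (Suc t) + 2 * q)))"
proof -
  define s where "s = real (Suc t)"
  have s: "s > 0" "real t = s - 1" by (auto simp: s_def)
  have e: "\<eta> t \<noteq> 0" using \<eta>_pos[of t] by simp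
  have nz: "s + q \<noteq> 0" "s + 2 * q - 1 \<noteq> 0" "s + 2 * q \<noteq> 0" using s q by auto
  have "gain (Suc t) = (weight t * (s + q) / s) / ((\<eta> t * (s + 2 * q - 1) / (s + q)) * (s + 2 * q))"
    by (simp add: gain_def \<eta>_Suc weight.simps(2) s_def del: of_nat_Suc)
  also have "\<dots> = weight t / (\<eta> t * (s + 2 * q - 1)) * ((s + q)\<^sup>2 / (s * (s + 2 * q)))"
    using s e nz by (simp add: field_simps power2_eq_square)
  also have "weight t / (\<eta> t * (s + 2 * q - 1)) = gain t"
    by (simp add: gain_def s(2) algebra_simps)
  also have "(s + q)\<^sup>2 / (s * (s + 2 * q)) = 1 + q\<^sup>2 / (s * (s + 2 * q))"
  proof -
    have "(s + q)\<^sup>2 = s * (s + 2 * q) + q\<^sup>2" by (simp add: algebra_simps power2_eq_square)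
    then show ?thesis using s nz by (simp add: add_divide_distrib)
  qed
  finally show ?thesis unfolding s_def .
qed

lemma gain_mono: "s \<le> t \<Longrightarrow> gain s \<le> gain t"
proof (rule lift_Suc_mono_le[of gain])
  fix t
  have "0 \<le> q\<^sup>2 / (real (Suc t) * (real (Suc t) + 2 * q))" using q by simp
  then show "gain t \<le> gain (Suc t)"
    unfolding gain_Suc using gain_pos[of t] by (simp add: mult_le_cancel_left1)
qed

text \<open>
  Since \<open>2q \<ge> 1\<close>, the increments \<open>q\<^sup>2 / (s (s + 2q))\<close> are at most \<open>q\<^sup>2 (1/s - 1/(s + 1))\<close>, which telescopes.
\<close>

lemma gain_le: "gain t \<le> gain 0 * exp (q\<^sup>2)"
proof -
  have "gain t \<le> gain 0 * exp (q\<^sup>2 * (1 - 1 / (real t + 1)))"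
  proof (induction t)
    case (Suc t)
    define s where "s = real t + 1"
    have s: "s > 0" by (simp add: s_def)
    have "q\<^sup>2 / (s * (s + 2 * q)) \<le> q\<^sup>2 / (s * (s + 1))"
      using s q by (intro divide_left_mono mult_left_mono) auto
    also have "\<dots> = q\<^sup>2 * (1 / s - 1 / (s + 1))" using s by (simp add: field_simps)
    finally have "1 + q\<^sup>2 / (s * (s + 2 * q)) \<le> 1 + q\<^sup>2 * (1 / s - 1 / (s + 1))" by simp
    also have "\<dots> \<le> exp (q\<^sup>2 * (1 / s - 1 / (s + 1)))" by (rule exp_ge_add_one_self)
    finally have le: "1 + q\<^sup>2 / (s * (s + 2 * q)) \<le> exp (q\<^sup>2 * (1 / s - 1 / (s + 1)))" .
    have "gain (Suc t) = gain t * (1 + q\<^sup>2 / (s * (s + 2 * q)))"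
      by (simp add: gain_Suc s_def add.commute)
    also have "\<dots> \<le> (gain 0 * exp (q\<^sup>2 * (1 - 1 / s))) * exp (q\<^sup>2 * (1 / s - 1 / (s + 1)))"
      using Suc le gain_pos s q by (intro mult_mono) (auto simp: s_def less_imp_le)
    also have "\<dots> = gain 0 * exp (q\<^sup>2 * (1 - 1 / (s + 1)))"
      by (simp add: exp_add[symmetric] algebra_simps)
    finally show ?case by (simp add: s_def add.commute)
  qed simp
  also have "\<dots> \<le> gain 0 * exp (q\<^sup>2)"
  proof -
    have "q\<^sup>2 * (1 - 1 / (real t + 1)) \<le> q\<^sup>2 * 1" by (intro mult_left_mono) auto
    then show ?thesis using gain_pos[of 0] by simp
  qed
  finally show ?thesis .
qed

end

section \<open>The potential of the inexact Halpern iteration\<close>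

text \<open>
  The iteration in an arbitrary inner product space: \<open>v t\<close> is the operator value at \<open>u t\<close> and \<open>e t\<close>
  the residual of the resolvent equation.
\<close>

locale halpern_run = halpern_weights q \<eta> for q \<eta> +
  fixes u v e :: "nat \<Rightarrow> 'a :: real_inner" and x0 xs :: 'a and D \<delta> :: real and T :: nat
  assumes D: "D = norm (x0 - xs)" "D > 0" and T: "T \<ge> 1" and \<delta>: "\<delta> = D / real T powr (3 / 2)"
    and u_0: "u 0 = x0 - \<eta> 0 *\<^sub>R v 0 + e 0"
    and u_Suc: "Suc t < T \<Longrightarrow> u (Suc t) = (1 - q / (real (Suc t) + q)) *\<^sub>R u t
        + (q / (real (Suc t) + q)) *\<^sub>R x0 - \<eta> (Suc t) *\<^sub>R v (Suc t) + e (Suc t)"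
    and mono_steps: "Suc t < T \<Longrightarrow> (v (Suc t) - v t) \<bullet> (u (Suc t) - u t) \<ge> 0"
    and mono_solution: "t < T \<Longrightarrow> v t \<bullet> (u t - xs) \<ge> 0"
    and e_le: "t < T \<Longrightarrow> norm (e t) \<le> \<delta>"
begin

definition potential :: "nat \<Rightarrow> real" where
  "potential t = weight t *
     (\<eta> t * (real t + 2 * q) / (2 * q) * (norm (v t))\<^sup>2 + v t \<bullet> (u t - x0))"

lemma \<delta>_pos: "\<delta> > 0"
  using D T \<delta> by simp

lemma \<delta>_bounds: "\<delta> * real T \<le> D" "\<delta> \<le> D" "\<delta>\<^sup>2 * real T ^ 3 = D\<^sup>2"
proof -
  have T': "real T \<ge> 1" using T by simp
  have "real T powr 1 \<le> real T powr (3 / 2)" using T' by (intro powr_mono) auto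
  then have le: "real T \<le> real T powr (3 / 2)" using T' by simp
  then show "\<delta> * real T \<le> D" unfolding \<delta> using D T' by (simp add: pos_divide_le_eq)
  moreover have "\<delta> * 1 \<le> \<delta> * real T" using \<delta>_pos T' by (intro mult_left_mono) auto
  ultimately show "\<delta> \<le> D" by simp
  have "(real T powr (3 / 2))\<^sup>2 = real T ^ 3"
    using T' by (simp add: powr_power powr_realpow)
  then show "\<delta>\<^sup>2 * real T ^ 3 = D\<^sup>2" unfolding \<delta> using T' by (simp add: power_divide)
qed

text \<open>
  The recursion gives two formulas for \<open>u\<^sub>t\<^sub>+\<^sub>1 - u\<^sub>t\<close>, one in terms of \<open>x\<^sub>0 - u\<^sub>t\<^sub>+\<^sub>1\<close> and one in terms of
  \<open>x\<^sub>0 - u\<^sub>t\<close>. The inner product of the first with \<open>v\<^sub>t\<^sub>+\<^sub>1\<close> minus that of the second with \<open>v\<^sub>t\<close> is nonnegative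
  by monotonicity. The mixed product \<open>\<langle>v\<^sub>t, v\<^sub>t\<^sub>+\<^sub>1\<rangle>\<close> is replaced by polarisation, which leaves a negative
  multiple of \<open>\<parallel>v\<^sub>t\<^sub>+\<^sub>1 - v\<^sub>t\<parallel>\<^sup>2\<close>. One half of it absorbs the larger part of the error, which is
  quadratic in \<open>\<delta>\<close> afterwards; the other half is kept, as it pays for the warm starts.
\<close>

lemma potential_step:
  assumes "Suc t < T"
  shows "potential (Suc t) + weight (Suc t) * \<eta> (Suc t) * real (Suc t) / (4 * q) * (norm (v (Suc t) - v t))\<^sup>2
    \<le> potential t + weight (Suc t) * real (Suc t) * \<delta>\<^sup>2 / (q * \<eta> (Suc t)) + weight (Suc t) * norm (v (Suc t)) * \<delta>"
proof -
  define s where "s = real (Suc t)"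
  define B where "B = weight (Suc t)"
  define h where "h = \<eta> (Suc t)"
  define a where "a = v (Suc t)"
  define b where "b = v t"
  define f where "f = e (Suc t)"
  define x where "x = u (Suc t)"
  define y where "y = u t"
  have s: "s \<ge> 1" by (simp add: s_def)
  have B: "B > 0" using weight_pos by (simp add: B_def)
  have h: "h > 0" using \<eta>_pos by (simp add: h_def)
  have sq: "s + q > 0" using s q by simp
  have Wt: "weight t = B * s / (s + q)"
    using sq s by (simp add: B_def weight.simps(2) s_def del: of_nat_Suc)
  have \<eta>t: "\<eta> t * (real t + 2 * q) = h * (s + q)"
  proof -
    have "h = \<eta> t * (s + 2 * q - 1) / (s + q)" by (simp add: h_def \<eta>_Suc s_def)
    moreover have "real t + 2 * q = s + 2 * q - 1" by (simp add: s_def)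
    ultimately show ?thesis using sq by simp
  qed
  have x_eq: "x = (1 - q / (s + q)) *\<^sub>R y + (q / (s + q)) *\<^sub>R x0 - h *\<^sub>R a + f"
    using u_Suc[OF assms] by (simp add: x_def y_def s_def h_def a_def f_def)
  have "(s + q) *\<^sub>R x = s *\<^sub>R y + q *\<^sub>R x0 + (s + q) *\<^sub>R (f - h *\<^sub>R a)"
  proof -
    have "(s + q) * (1 - q / (s + q)) = s" "(s + q) * (q / (s + q)) = q"
      using sq by (auto simp: field_simps)
    then show ?thesis unfolding x_eq
      by (simp only: scaleR_add_right scaleR_diff_right scaleR_scaleR) (simp add: algebra_simps)
  qed
  then have 1: "s *\<^sub>R (x - y) = q *\<^sub>R (x0 - x) + (s + q) *\<^sub>R (f - h *\<^sub>R a)"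
    and 2: "(s + q) *\<^sub>R (x - y) = q *\<^sub>R (x0 - y) + (s + q) *\<^sub>R (f - h *\<^sub>R a)"
    by (auto simp: algebra_simps)
  \<comment> \<open>Monotonicity, with both products expanded by \<open>1\<close> and \<open>2\<close> and scaled by \<open>B s / q\<close>.\<close>
  have m: "0 \<le> a \<bullet> (x - y) - b \<bullet> (x - y)"
    using mono_steps[OF assms] by (simp add: a_def b_def x_def y_def inner_diff_left)
  have e1: "s * (a \<bullet> (x - y)) = q * (a \<bullet> (x0 - x)) + (s + q) * (a \<bullet> f - h * (a \<bullet> a))"
    using arg_cong[OF 1, of "\<lambda>z. a \<bullet> z"] by (simp only: inner_scaleR_right inner_add_right inner_diff_right)
  have e2: "(s + q) * (b \<bullet> (x - y)) = q * (b \<bullet> (x0 - y)) + (s + q) * (b \<bullet> f - h * (b \<bullet> a))"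
    using arg_cong[OF 2, of "\<lambda>z. b \<bullet> z"] by (simp only: inner_scaleR_right inner_add_right inner_diff_right)
  have "B / q * (s * (a \<bullet> (x - y))) = B * (a \<bullet> (x0 - x)) + B * (s + q) / q * (a \<bullet> f - h * (a \<bullet> a))"
    unfolding e1 using q by (simp add: distrib_left)
  then have e1': "B * s / q * (a \<bullet> (x - y)) = B * (a \<bullet> (x0 - x)) + B * (s + q) / q * (a \<bullet> f - h * (a \<bullet> a))"
    by simp
  have "B * s / (q * (s + q)) * ((s + q) * (b \<bullet> (x - y)))
     = B * s / (s + q) * (b \<bullet> (x0 - y)) + B * s / q * (b \<bullet> f - h * (b \<bullet> a))"
  proof -
    have "B * s / (q * w) * (q * X + w * Y) = B * s / w * X + B * s / q * Y" if "w > 0" for w X Y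
      using q that by (simp add: distrib_left)
    then show ?thesis unfolding e2 using sq by blast
  qed
  then have e2': "B * s / q * (b \<bullet> (x - y)) = weight t * (b \<bullet> (x0 - y)) + B * s / q * (b \<bullet> f - h * (b \<bullet> a))"
    unfolding Wt using sq by simp
  have "0 \<le> B * s / q * (a \<bullet> (x - y) - b \<bullet> (x - y))"
    using m B s q by simp
  then have main: "B * (a \<bullet> (x - x0)) \<le> weight t * (b \<bullet> (y - x0))
      + B * (s + q) / q * (a \<bullet> f - h * (a \<bullet> a)) - B * s / q * (b \<bullet> f - h * (b \<bullet> a))"
    unfolding right_diff_distrib e1' e2' by (simp add: inner_diff_right algebra_simps)
  have ba: "b \<bullet> a = ((norm a)\<^sup>2 + (norm b)\<^sup>2 - (norm (a - b))\<^sup>2) / 2"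
    by (simp add: power2_norm_eq_inner algebra_simps inner_commute)
  \<comment> \<open>The part of the error that meets \<open>v\<^sub>t\<^sub>+\<^sub>1 - v\<^sub>t\<close> carries the large factor \<open>s\<close>, the other part does not.\<close>
  have noise: "B * (s + q) / q * (a \<bullet> f) - B * s / q * (b \<bullet> f) = B * s / q * ((a - b) \<bullet> f) + B * (a \<bullet> f)"
    using q by (simp add: field_simps inner_diff_left)
  have n1: "(a - b) \<bullet> f \<le> h / 4 * (norm (a - b))\<^sup>2 + \<delta>\<^sup>2 / h"
  proof -
    have fd: "norm f \<le> \<delta>" using e_le[OF assms] by (simp add: f_def)
    have "(a - b) \<bullet> f \<le> norm (a - b) * norm f" by (rule norm_cauchy_schwarz)
    also have "\<dots> \<le> norm (a - b) * \<delta>" using fd by (intro mult_left_mono) auto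
    also have "\<dots> \<le> h / 4 * (norm (a - b))\<^sup>2 + \<delta>\<^sup>2 / h"
    proof -
      have "0 \<le> (h / 2 * norm (a - b) - \<delta>)\<^sup>2 / h" using h by simp
      also have "\<dots> = h / 4 * (norm (a - b))\<^sup>2 + \<delta>\<^sup>2 / h - norm (a - b) * \<delta>"
        using h by (simp add: field_simps power2_eq_square)
      finally show ?thesis by simp
    qed
    finally show ?thesis .
  qed
  have n2: "a \<bullet> f \<le> norm a * \<delta>"
    using norm_cauchy_schwarz[of a f] mult_left_mono[of "norm f" \<delta> "norm a"] e_le[OF assms]
    by (simp add: f_def)
  have n1': "B * s / q * ((a - b) \<bullet> f) \<le> B * s / q * (h / 4 * (norm (a - b))\<^sup>2 + \<delta>\<^sup>2 / h)"
    using n1 B s q by (intro mult_left_mono) auto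
  have n2': "B * (a \<bullet> f) \<le> B * (norm a * \<delta>)" using n2 B by (intro mult_left_mono) auto
  have pS: "potential (Suc t) = B * (h * (s + 2 * q) / (2 * q) * (norm a)\<^sup>2) + B * (a \<bullet> (x - x0))"
    by (simp add: potential_def B_def h_def s_def a_def x_def distrib_left)
  have pt: "potential t = B * s * h / (2 * q) * (norm b)\<^sup>2 + weight t * (b \<bullet> (y - x0))"
  proof -
    have "weight t * (\<eta> t * (real t + 2 * q) / (2 * q) * (norm b)\<^sup>2) = B * s * h / (2 * q) * (norm b)\<^sup>2"
      unfolding \<eta>t Wt using sq by simp
    then show ?thesis by (simp add: potential_def b_def y_def distrib_left)
  qed
  have "potential (Suc t) + B * h * s / (4 * q) * (norm (a - b))\<^sup>2
     \<le> potential t + (B * s / q * ((a - b) \<bullet> f) + B * (a \<bullet> f)) - B * s * h / (4 * q) * (norm (a - b))\<^sup>2"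
  proof -
    have "B * (s + q) / q * (h * (norm a)\<^sup>2) - B * s / q * (h * (b \<bullet> a))
      = B * (h * (s + 2 * q) / (2 * q) * (norm a)\<^sup>2) - B * s * h / (2 * q) * (norm b)\<^sup>2
        + B * s * h / (2 * q) * (norm (a - b))\<^sup>2"
      unfolding ba using q by (simp add: field_simps)
    moreover have "B * h * s / (4 * q) * (norm (a - b))\<^sup>2 + B * s * h / (4 * q) * (norm (a - b))\<^sup>2
      = B * s * h / (2 * q) * (norm (a - b))\<^sup>2" using q by (simp add: field_simps)
    moreover have "P + Pa + V1 \<le> Pb + W + (N1 + N2) - V2"
      if "E1 - E2 = P - Pb + V" "V1 + V2 = V" "Pa \<le> W + (F1 - E1) - (F2 - E2)" "F1 - F2 = N1 + N2"
      for P Pa Pb V V1 V2 W E1 E2 F1 F2 N1 N2 :: real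
      using that by linarith
    ultimately show ?thesis
      using main noise unfolding pS pt right_diff_distrib power2_norm_eq_inner by blast
  qed
  also have "\<dots> \<le> potential t + B * s * \<delta>\<^sup>2 / (q * h) + B * norm a * \<delta>"
    using n1' n2' by (simp add: distrib_left mult_ac)
  finally show ?thesis by (simp only: B_def h_def s_def a_def b_def)
qed

text \<open>
  The norm of \<open>v t\<close> relative to the claimed rate. In this unit the lower bound for the potential is
  a multiple of \<open>speed\<^sup>2 - speed\<close>.
\<close>

definition speed :: "nat \<Rightarrow> real" where
  "speed t = \<eta> t * (real t + 2 * q) * norm (v t) / (2 * q * D)"

lemma weighted_norm: "weight t * norm (v t) = 2 * q * D * gain t * speed t"
proof -
  have "real t + 2 * q \<noteq> 0" "\<eta> t \<noteq> 0" using q \<eta>_pos[of t] by auto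
  then show ?thesis using q D(2) by (simp add: gain_def speed_def)
qed

lemma speed_nonneg: "speed t \<ge> 0"
  using \<eta>_pos[of t] q D(2) by (simp add: speed_def)

lemma potential_0: "potential 0 \<le> weight 0 * norm (v 0) * \<delta>"
proof -
  have "potential 0 = v 0 \<bullet> e 0"
    using q by (simp add: potential_def u_0 inner_diff_right inner_add_right power2_norm_eq_inner)
  also have "\<dots> \<le> norm (v 0) * norm (e 0)" by (rule norm_cauchy_schwarz)
  also have "\<dots> \<le> norm (v 0) * \<delta>" using e_le[of 0] T by (intro mult_left_mono) auto
  finally show ?thesis by simp
qed

lemma potential_ge:
  assumes "t < T"
  shows "potential t \<ge> 2 * q * D\<^sup>2 * gain t * ((speed t)\<^sup>2 - speed t)"
proof -
  have "v t \<bullet> (u t - x0) = v t \<bullet> (u t - xs) - v t \<bullet> (x0 - xs)" by (simp add: algebra_simps)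
  moreover have "v t \<bullet> (x0 - xs) \<le> norm (v t) * D" unfolding D(1) by (rule norm_cauchy_schwarz)
  ultimately have "- (norm (v t) * D) \<le> v t \<bullet> (u t - x0)" using mono_solution[OF assms] by linarith
  then have "weight t * (\<eta> t * (real t + 2 * q) / (2 * q) * (norm (v t))\<^sup>2 - norm (v t) * D) \<le> potential t"
    unfolding potential_def using weight_pos[of t] by (intro mult_left_mono) auto
  moreover have "weight t * (\<eta> t * (real t + 2 * q) / (2 * q) * (norm (v t))\<^sup>2 - norm (v t) * D)
      = (weight t * norm (v t)) * D * (speed t - 1)"
    using q D(2) by (simp add: speed_def field_simps power2_eq_square)
  moreover have "\<dots> = 2 * q * D\<^sup>2 * gain t * ((speed t)\<^sup>2 - speed t)"
    unfolding weighted_norm by (simp add: power2_eq_square algebra_simps)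
  ultimately show ?thesis by simp
qed

definition variation :: "nat \<Rightarrow> real" where
  "variation t = weight (Suc t) * \<eta> (Suc t) * real (Suc t) / (4 * q) * (norm (v (Suc t) - v t))\<^sup>2"

lemma potential_sum:
  assumes "t < T"
  shows "potential t + (\<Sum>s<t. variation s)
    \<le> (\<Sum>s\<le>t. weight s * norm (v s) * \<delta>) + (\<Sum>s<t. weight (Suc s) * real (Suc s) * \<delta>\<^sup>2 / (q * \<eta> (Suc s)))"
  using assms
proof (induction t)
  case 0
  then show ?case using potential_0 by simp
next
  case (Suc t)
  then show ?case using potential_step[of t] unfolding variation_def by simp
qed

text \<open>
  The sum of the error terms that are quadratic in \<open>\<delta>\<close> is bounded because \<open>\<delta>\<^sup>2 T\<^sup>3 = D\<^sup>2\<close>; the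
  exponent \<open>3/2\<close> in the tolerance comes from here.
\<close>

lemma speed_inequality:
  assumes "t < T"
  shows "(speed t)\<^sup>2 - speed t + (\<Sum>s<t. variation s) / (2 * q * D\<^sup>2 * gain t)
    \<le> \<delta> / D * (\<Sum>s\<le>t. speed s) + 2"
proof -
  define M where "M = 2 * q * D\<^sup>2 * gain t"
  have M: "M > 0" using q D(2) gain_pos by (simp add: M_def)
  have "M * ((speed t)\<^sup>2 - speed t) + (\<Sum>s<t. variation s) \<le> potential t + (\<Sum>s<t. variation s)"
    using potential_ge[OF assms] by (simp add: M_def)
  also have "\<dots> \<le> (\<Sum>s\<le>t. weight s * norm (v s) * \<delta>)
      + (\<Sum>s<t. weight (Suc s) * real (Suc s) * \<delta>\<^sup>2 / (q * \<eta> (Suc s)))"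
    by (rule potential_sum[OF assms])
  also have "(\<Sum>s\<le>t. weight s * norm (v s) * \<delta>) \<le> (\<Sum>s\<le>t. M * (\<delta> / D * speed s))"
  proof (rule sum_mono)
    fix s assume "s \<in> {..t}"
    then have "gain s * (speed s * (2 * q * D * \<delta>)) \<le> gain t * (speed s * (2 * q * D * \<delta>))"
      using gain_mono speed_nonneg q D(2) \<delta>_pos by (intro mult_right_mono) auto
    then show "weight s * norm (v s) * \<delta> \<le> M * (\<delta> / D * speed s)"
      unfolding weighted_norm M_def using D(2) by (simp add: power2_eq_square mult_ac)
  qed
  also have "\<dots> = M * (\<delta> / D * (\<Sum>s\<le>t. speed s))" by (simp only: sum_distrib_left)
  also have "(\<Sum>s<t. weight (Suc s) * real (Suc s) * \<delta>\<^sup>2 / (q * \<eta> (Suc s)))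
      \<le> (\<Sum>s<t. gain t * (real T ^ 2 * (1 + 2 * q)) * \<delta>\<^sup>2 / q)"
  proof (rule sum_mono)
    fix s assume s: "s \<in> {..<t}"
    have "weight (Suc s) * real (Suc s) / \<eta> (Suc s) = gain (Suc s) * (real (Suc s) * (real (Suc s) + 2 * q))"
      by (rule gain_weight)
    also have "\<dots> \<le> gain t * (real T * (real T + 2 * q))"
      using s assms gain_mono[of "Suc s" t] gain_pos[of t] q
      by (intro mult_mono mult_nonneg_nonneg) auto
    also have "\<dots> \<le> gain t * (real T ^ 2 * (1 + 2 * q))"
    proof (intro mult_left_mono)
      have "2 * q * real T * 1 \<le> 2 * q * real T * real T" using q T by (intro mult_left_mono) auto
      then show "real T * (real T + 2 * q) \<le> real T ^ 2 * (1 + 2 * q)"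
        by (simp add: algebra_simps power2_eq_square)
    qed (use gain_pos[of t] in simp)
    finally have "weight (Suc s) * real (Suc s) / \<eta> (Suc s) * (\<delta>\<^sup>2 / q)
      \<le> gain t * (real T ^ 2 * (1 + 2 * q)) * (\<delta>\<^sup>2 / q)" using q by (intro mult_right_mono) auto
    then show "weight (Suc s) * real (Suc s) * \<delta>\<^sup>2 / (q * \<eta> (Suc s))
      \<le> gain t * (real T ^ 2 * (1 + 2 * q)) * \<delta>\<^sup>2 / q" by (simp add: mult.commute)
  qed
  also have "\<dots> \<le> M * 2"
  proof -
    have "(\<Sum>s<t. gain t * (real T ^ 2 * (1 + 2 * q)) * \<delta>\<^sup>2 / q)
        = real t * (gain t * (real T ^ 2 * (1 + 2 * q)) * \<delta>\<^sup>2 / q)" by simp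
    also have "\<dots> \<le> real T * (gain t * (real T ^ 2 * (1 + 2 * q)) * \<delta>\<^sup>2 / q)"
      using assms gain_pos[of t] q by (intro mult_right_mono) auto
    also have "\<dots> = gain t * (1 + 2 * q) / q * (\<delta>\<^sup>2 * real T ^ 3)"
      by (simp add: power2_eq_square power3_eq_cube)
    also have "\<dots> = gain t * D\<^sup>2 * ((1 + 2 * q) / q)" by (simp add: \<delta>_bounds(3))
    also have "\<dots> \<le> gain t * D\<^sup>2 * (4 * q)"
    proof (intro mult_left_mono)
      have "2 * q \<le> q * q" using q by (intro mult_right_mono) auto
      then have "1 + 2 * q \<le> 4 * q * q" using q by linarith
      then show "(1 + 2 * q) / q \<le> 4 * q" using q by (simp add: pos_divide_le_eq)
    qed (use gain_pos[of t] in auto)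
    finally show ?thesis by (simp only: M_def mult_ac)
  qed
  finally have "M * ((speed t)\<^sup>2 - speed t) + (\<Sum>s<t. variation s)
      \<le> M * (\<delta> / D * (\<Sum>s\<le>t. speed s)) + M * 2" by simp
  then have "M * ((speed t)\<^sup>2 - speed t + (\<Sum>s<t. variation s) / M) \<le> M * (\<delta> / D * (\<Sum>s\<le>t. speed s) + 2)"
    using M by (simp add: distrib_left)
  then show ?thesis using M unfolding M_def[symmetric] by (rule mult_left_le_imp_le)
qed

lemma variation_nonneg: "variation t \<ge> 0"
  using weight_pos[of "Suc t"] \<eta>_pos[of "Suc t"] q by (simp add: variation_def)

text \<open>
  If all earlier values are at most \<open>4\<close>, then the last value \<open>z\<close> satisfies \<open>z\<^sup>2 - z \<le> (4 + z) + 2\<close> because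
  \<open>\<delta> T \<le> D\<close>, hence \<open>(z - 1)\<^sup>2 \<le> 7 \<le> 9\<close>.
\<close>

lemma speed_le: "t < T \<Longrightarrow> speed t \<le> 4"
proof (induction t rule: less_induct)
  case (less t)
  have \<delta>D: "0 \<le> \<delta> / D" "\<delta> / D \<le> 1" "\<delta> / D * real T \<le> 1"
    using \<delta>_pos D(2) \<delta>_bounds by (auto simp: pos_divide_le_eq)
  have "(\<Sum>s<t. speed s) \<le> (\<Sum>s<t. 4)"
    using less by (intro sum_mono) auto
  then have "(\<Sum>s\<le>t. speed s) \<le> (\<Sum>s<t. 4) + speed t"
    by (simp flip: lessThan_Suc_atMost)
  also have "(\<Sum>s<t. 4) \<le> 4 * real T" using less.prems by simp
  finally have "\<delta> / D * (\<Sum>s\<le>t. speed s) \<le> \<delta> / D * (4 * real T + speed t)"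
    using \<delta>D(1) by (intro mult_left_mono) auto
  also have "\<dots> \<le> 4 + speed t"
  proof -
    have "\<delta> / D * (4 * real T + speed t) = 4 * (\<delta> / D * real T) + \<delta> / D * speed t"
      by (simp add: algebra_simps)
    then show ?thesis using \<delta>D(3) mult_right_mono[OF \<delta>D(2) speed_nonneg[of t]] by linarith
  qed
  finally have "\<delta> / D * (\<Sum>s\<le>t. speed s) \<le> 4 + speed t" .
  moreover have "0 \<le> (\<Sum>s<t. variation s) / (2 * q * D\<^sup>2 * gain t)"
    using q gain_pos[of t] by (intro divide_nonneg_nonneg sum_nonneg variation_nonneg) auto
  ultimately have "(speed t)\<^sup>2 \<le> 2 * speed t + 6"
    using speed_inequality[OF less.prems] by linarith
  then have "(speed t - 1)\<^sup>2 \<le> 3\<^sup>2" by (simp add: power2_eq_square algebra_simps)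
  then have "speed t - 1 \<le> 3" by (rule power2_le_imp_le) simp
  then show ?case by simp
qed

lemma norm_v_le:
  assumes "t < T"
  shows "\<eta> t * (real t + 1) * norm (v t) \<le> 8 * q * D"
proof -
  have "\<eta> t * (real t + 1) * norm (v t) \<le> \<eta> t * (real t + 2 * q) * norm (v t)"
    using \<eta>_pos[of t] q by (intro mult_right_mono mult_left_mono) auto
  also have "\<dots> = speed t * (2 * q * D)" using q D(2) by (simp add: speed_def)
  also have "\<dots> \<le> 4 * (2 * q * D)" using speed_le[OF assms] q D(2) by (intro mult_right_mono) auto
  finally show ?thesis by simp
qed

text \<open>
  With all speeds at most \<open>4\<close>, \<open>speed_inequality\<close> bounds the sum of the variations by
  \<open>4 + 2 + 1/4\<close> times the factor \<open>2 q D\<^sup>2 gain t\<close>. Each variation is at least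
  \<open>gain 0 / (4 q)\<close> times the square that is summed here.
\<close>

lemma variation_sum_le:
  assumes "t < T"
  shows "(\<Sum>s<t. (real (Suc s) * \<eta> (Suc s) * norm (v (Suc s) - v s))\<^sup>2) \<le> 56 * q\<^sup>2 * exp (q\<^sup>2) * D\<^sup>2"
proof -
  have \<delta>D: "0 \<le> \<delta> / D" "\<delta> / D * real T \<le> 1"
    using \<delta>_pos D(2) \<delta>_bounds by (auto simp: pos_divide_le_eq)
  have "(\<Sum>s\<le>t. speed s) \<le> (\<Sum>s\<le>t. 4)" using assms by (intro sum_mono speed_le) auto
  also have "\<dots> \<le> 4 * real T" using assms by simp
  finally have "\<delta> / D * (\<Sum>s\<le>t. speed s) \<le> \<delta> / D * (4 * real T)"
    using \<delta>D(1) by (intro mult_left_mono) auto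
  also have "\<dots> = 4 * (\<delta> / D * real T)" by simp
  also have "\<dots> \<le> 4" using \<delta>D(2) by linarith
  finally have 1: "\<delta> / D * (\<Sum>s\<le>t. speed s) \<le> 4" .
  have "0 \<le> (speed t - 1 / 2)\<^sup>2" by simp
  then have 2: "(speed t)\<^sup>2 - speed t \<ge> - (1 / 4)" by (simp add: power2_eq_square algebra_simps)
  have "(\<Sum>s<t. variation s) / (2 * q * D\<^sup>2 * gain t) \<le> 7"
    using speed_inequality[OF assms] 1 2 by linarith
  then have "(\<Sum>s<t. variation s) \<le> 7 * (2 * q * D\<^sup>2 * gain t)"
    using q D(2) gain_pos[of t] by (simp add: pos_divide_le_eq)
  also have "\<dots> \<le> 7 * (2 * q * D\<^sup>2 * (gain 0 * exp (q\<^sup>2)))"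
    using q gain_le by (intro mult_left_mono) auto
  finally have 3: "(\<Sum>s<t. variation s) \<le> 7 * (2 * q * D\<^sup>2 * (gain 0 * exp (q\<^sup>2)))" .
  have "gain 0 / (4 * q) * (real (Suc s) * \<eta> (Suc s) * norm (v (Suc s) - v s))\<^sup>2 \<le> variation s" for s
  proof -
    let ?s = "real (Suc s)" and ?n = "norm (v (Suc s) - v s)" and ?e = "\<eta> (Suc s)"
    have "gain 0 * (?s * ?s) \<le> gain (Suc s) * (?s * (?s + 2 * q))"
      using gain_mono[of 0 "Suc s"] gain_pos[of 0] gain_pos[of "Suc s"] q
      by (intro mult_mono) auto
    also have "\<dots> = weight (Suc s) * ?s / ?e"
      by (rule gain_weight[symmetric])
    finally have "gain 0 * (?s * ?s) * (?e\<^sup>2 * ?n\<^sup>2 / (4 * q)) \<le> weight (Suc s) * ?s / ?e * (?e\<^sup>2 * ?n\<^sup>2 / (4 * q))"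
      using q by (intro mult_right_mono) auto
    also have "\<dots> = variation s"
      using \<eta>_pos[of "Suc s"] by (simp add: variation_def power2_eq_square)
    finally show ?thesis by (simp add: power_mult_distrib power2_eq_square mult_ac)
  qed
  then have "(\<Sum>s<t. gain 0 / (4 * q) * (real (Suc s) * \<eta> (Suc s) * norm (v (Suc s) - v s))\<^sup>2) \<le> (\<Sum>s<t. variation s)"
    by (intro sum_mono)
  then have "gain 0 / (4 * q) * (\<Sum>s<t. (real (Suc s) * \<eta> (Suc s) * norm (v (Suc s) - v s))\<^sup>2)
      \<le> gain 0 / (4 * q) * (56 * q\<^sup>2 * exp (q\<^sup>2) * D\<^sup>2)"
    using 3 q by (simp add: sum_distrib_left power2_eq_square mult_ac)
  moreover have "gain 0 / (4 * q) > 0" using gain_pos[of 0] q by simp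
  ultimately show ?thesis by (rule mult_left_le_imp_le)
qed

text \<open>
  Cauchy-Schwarz for the factors \<open>\<surd>r\<close> and \<open>r \<eta> \<parallel>\<Delta>v\<parallel>\<close> with \<open>r = s + 2\<close>, in the form \<open>2 x y \<le> \<kappa> x\<^sup>2 + y\<^sup>2 / \<kappa>\<close>
  with \<open>\<kappa>\<close> proportional to \<open>D / T\<close>. The squares of the first factor add up to \<open>O(T\<^sup>2)\<close> and those of the second to
  \<open>O(D\<^sup>2)\<close>.
\<close>

lemma displacement_sum_le:
  assumes "t < T"
  shows "(\<Sum>s<t. (real (Suc s) + 1) powr (3 / 2) * (\<eta> (Suc s) * norm (v (Suc s) - v s)))
    \<le> (1 + 112 * q\<^sup>2 * exp (q\<^sup>2)) * D * real T"
proof -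
  define b where "b = (\<lambda>s. real (Suc s) * \<eta> (Suc s) * norm (v (Suc s) - v s))"
  have T': "real T \<ge> 1" using T by simp
  have "(real (Suc s) + 1) powr (3 / 2) * (\<eta> (Suc s) * norm (v (Suc s) - v s))
      \<le> D + 2 * (real T / D) * (b s)\<^sup>2" if "s < t" for s
  proof -
    define r where "r = real (Suc s) + 1"
    have r: "r \<ge> 2" "r \<le> 2 * real (Suc s)" "r \<le> 2 * real T" using that assms by (auto simp: r_def)
    have "r powr (3 / 2) * (\<eta> (Suc s) * norm (v (Suc s) - v s))
        = sqrt r * (r * (\<eta> (Suc s) * norm (v (Suc s) - v s)))"
      using r powr_add[of r "1/2" 1] by (simp add: powr_half_sqrt)
    also have "\<dots> \<le> sqrt r * (2 * real (Suc s) * (\<eta> (Suc s) * norm (v (Suc s) - v s)))"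
      using r \<eta>_pos[of "Suc s"] by (intro mult_left_mono mult_right_mono) auto
    also have "\<dots> = 2 * (sqrt r * b s)" by (simp add: b_def mult_ac)
    also have "\<dots> \<le> D / (2 * real T) * r + 2 * (real T / D) * (b s)\<^sup>2"
    proof -
      have "0 \<le> (D * sqrt r - 2 * real T * b s)\<^sup>2 / (2 * real T * D)" using D(2) by simp
      also have "\<dots> = D / (2 * real T) * r + 2 * (real T / D) * (b s)\<^sup>2 - 2 * (sqrt r * b s)"
        using D(2) T' r by (simp add: field_simps power2_eq_square)
      finally show ?thesis by simp
    qed
    also have "D / (2 * real T) * r \<le> D" using r D(2) T' by (simp add: field_simps)
    finally show ?thesis by (simp add: r_def)
  qed
  then have "(\<Sum>s<t. (real (Suc s) + 1) powr (3 / 2) * (\<eta> (Suc s) * norm (v (Suc s) - v s)))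
      \<le> (\<Sum>s<t. D + 2 * (real T / D) * (b s)\<^sup>2)" by (intro sum_mono) auto
  also have "\<dots> = real t * D + 2 * (real T / D) * (\<Sum>s<t. (b s)\<^sup>2)"
    by (simp add: sum.distrib sum_distrib_left)
  also have "\<dots> \<le> real T * D + 2 * (real T / D) * (56 * q\<^sup>2 * exp (q\<^sup>2) * D\<^sup>2)"
    using variation_sum_le[OF assms] assms D(2) unfolding b_def[symmetric]
    by (intro add_mono mult_left_mono mult_right_mono) (auto simp: b_def)
  also have "\<dots> = (1 + 112 * q\<^sup>2 * exp (q\<^sup>2)) * D * real T"
    using D(2) by (simp add: power2_eq_square algebra_simps)
  finally show ?thesis .
qed

end

section \<open>The constants of the theorem\<close>

text \<open>
  This is \<open>T\<^sup>T / T! \<le> e\<^sup>T\<close> in logarithmic form.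
\<close>

lemma sum_ln_le:
  assumes "T \<ge> 1"
  shows "(\<Sum>t<T. ln (real T / (real t + 1))) \<le> real T"
proof -
  have *: "real T * ln (real T) - real T \<le> (\<Sum>t<T. ln (real t + 1))"
    using assms
  proof (induction T rule: dec_induct)
    case base
    then show ?case by simp
  next
    case (step T)
    have T: "real T \<ge> 1" using step.hyps by simp
    have "ln (1 + 1 / real T) \<le> 1 / real T" by (rule ln_add_one_self_le_self) simp
    moreover have "1 + 1 / real T = (real T + 1) / real T" using T by (simp add: field_simps)
    ultimately have "ln (real T + 1) - ln (real T) \<le> 1 / real T" using T by (simp add: ln_div)
    then have "real T * (ln (real T + 1) - ln (real T)) \<le> 1" using T by (simp add: pos_le_divide_eq mult.commute)
    then show ?case using step.IH by (simp add: algebra_simps)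
  qed
  have "(\<Sum>t<T. ln (real T / (real t + 1))) = (\<Sum>t<T. ln (real T) - ln (real t + 1))"
    using assms by (intro sum.cong) (auto simp: ln_div)
  also have "\<dots> = real T * ln (real T) - (\<Sum>t<T. ln (real t + 1))" by (simp add: sum_subtractf)
  finally show ?thesis using * by simp
qed

lemma log_plus_le_mult:
  assumes "0 < x" "x \<le> H * y" "H > 0" "y \<ge> 1"
  shows "log_plus x \<le> log_plus H + ln y"
proof -
  have "ln x \<le> ln (H * y)" using assms by simp
  also have "\<dots> = ln H + ln y" using assms by (simp add: ln_mult)
  finally show ?thesis using assms(4) by (auto simp: log_plus_def max_def)
qed

text \<open>
  The four constants are defined outside the locale of a fixed problem, which makes it visible that
  they depend on \<open>p\<close>, \<open>a\<close>, \<open>m\<close> and \<open>\<theta>\<close> only.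
\<close>

definition residual_const :: "nat \<Rightarrow> real" where
  "residual_const p = 8 * halpern_q p * (2 * halpern_q p - 1) powr (halpern_q p - 1)"

definition fine_steps_const :: "nat \<Rightarrow> real \<Rightarrow> real \<Rightarrow> real \<Rightarrow> real" where
  "fine_steps_const p a m \<theta> =
     1 + (log_plus (h_const p a m * a * (2 * halpern_q p - 1) powr (3 / 2)) + 3 / 2) / (real p * ln (1 / \<theta>))"

definition displacement_const :: "nat \<Rightarrow> real \<Rightarrow> real" where
  "displacement_const p a = (4 + 112 * (halpern_q p)\<^sup>2 * exp ((halpern_q p)\<^sup>2)) / a"

definition call_const :: "nat \<Rightarrow> real \<Rightarrow> real \<Rightarrow> real \<Rightarrow> real" where
  "call_const p a m \<theta> =
     (4 * real (p - 1) / (1 - \<theta>) + 3) * (fine_steps_const p a m \<theta> + 2 * displacement_const p a) + 1"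

section \<open>The Halpern iteration with the adaptive inner solver\<close>

locale halpern_problem = tensor_vi +
  fixes F :: "vec \<Rightarrow> vec" and xs x0 :: vec and D :: real and T :: nat
  assumes F_Rd: "F ` Rd d \<subseteq> Rd d" and F_mono: "monotone_op X F" and F_smooth: "smooth_order d X p L F"
    and xs: "xs \<in> X" "0 \<in> plus_normal_cone d X (F xs) xs"
    and x0: "x0 \<in> X" and D_eq: "D = norm (x0 - xs)" and D_pos: "D > 0" and T_ge: "T \<ge> 1"
begin

abbreviation "q \<equiv> halpern_q p"
abbreviation "\<eta> \<equiv> halpern_eta p L D"

definition \<delta> :: real where "\<delta> = D / real T powr (3 / 2)"

lemma q_ge: "q \<ge> 2"
  using p by (simp add: halpern_q_def)

sublocale weights: halpern_weights q \<eta>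
proof
  show "\<eta> 0 > 0" using L D_pos by simp
qed (use q_ge in auto)

(* Otherwise the simplifier replaces the initial step size by a quotient and p - 1 by p - Suc 0,
   and the general facts about step sizes and radii no longer match. *)
declare halpern_eta.simps [simp del] One_nat_def [simp del]

lemma \<delta>_pos: "\<delta> > 0"
  using D_pos T_ge by (simp add: \<delta>_def)

lemma F_in_Rd: "x \<in> X \<Longrightarrow> F x \<in> Rd d"
  using F_Rd X_Rd by auto

lemma xs_solution: "vi_solution X F xs"
  using xs zero_in_plus_normal_cone_iff[OF F_in_Rd[OF xs(1)]] by (auto simp: vi_solution_def)

lemma well_posed_resolvent:
  assumes "\<mu> > 0" "c \<in> X"
  shows "well_posed \<mu> (\<lambda>x. F x + \<mu> *\<^sub>R (x - c))"
proof -
  have "strongly_monotone_op X 0 F" using F_mono by (simp add: strongly_monotone_op_def monotone_op_def)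
  then have "strongly_monotone_op X (0 + \<mu>) (\<lambda>x. F x + \<mu> *\<^sub>R (x - c))"
    by (rule strongly_monotone_shift)
  then show ?thesis
    using assms F_Rd X_Rd smooth_order_shift[OF p F_smooth] by (auto simp: well_posed_def image_subset_iff)
qed

text \<open>
  An inner call solves the resolvent equation with centre \<open>c\<close> up to \<open>\<delta>\<close>. By strong monotonicity the
  residual bounds the distance of \<open>u\<close> to the exact resolvent \<open>ys\<close>.
\<close>

lemma resolvent_step:
  assumes \<mu>: "\<mu> > 0" and c: "c \<in> X" and y: "y \<in> X"
  obtains u n N ys where
    "r_adaptive_atm d p L a m \<theta> tstep (\<lambda>x. F x + \<mu> *\<^sub>R (x - c)) y \<mu> \<delta> = Some (u, n, N)"
    "u \<in> X" "n \<in> normal_cone d X u" "norm (u - c + inverse \<mu> *\<^sub>R (F u + n)) \<le> \<delta>"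
    "vi_solution X (\<lambda>x. F x + \<mu> *\<^sub>R (x - c)) ys" "norm (u - ys) \<le> \<delta>"
    "real N \<le> adaptive_const * (real (fine_steps \<mu> \<delta>) + 2 * norm (y - ys) / \<rho> \<mu>)"
proof -
  let ?G = "\<lambda>x. F x + \<mu> *\<^sub>R (x - c)"
  have G: "well_posed \<mu> ?G" by (rule well_posed_resolvent[OF \<mu> c])
  obtain ys where ys: "vi_solution X ?G ys" using well_posed_solution_exists[OF G] by blast
  obtain u n N where res: "r_adaptive_atm d p L a m \<theta> tstep ?G y \<mu> \<delta> = Some (u, n, N)"
    and u: "u \<in> X" "n \<in> normal_cone d X u" and e: "norm (?G u + n) \<le> \<mu> * \<delta>"
    and N: "real N \<le> adaptive_const * (real (fine_steps \<mu> \<delta>) + 2 * norm (y - ys) / \<rho> \<mu>)"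
    using r_adaptive_atm_guarantee[OF G y ys \<delta>_pos] by blast
  have ysX: "ys \<in> X" using ys by (simp add: vi_solution_def)
  have "u - c + inverse \<mu> *\<^sub>R (F u + n) = inverse \<mu> *\<^sub>R (?G u + n)"
    using \<mu> by (simp add: algebra_simps)
  then have "norm (u - c + inverse \<mu> *\<^sub>R (F u + n)) = inverse \<mu> * norm (?G u + n)"
    using \<mu> by simp
  also have "\<dots> \<le> inverse \<mu> * (\<mu> * \<delta>)" using e \<mu> by (intro mult_left_mono) auto
  also have "\<dots> = \<delta>" using \<mu> by simp
  finally have 1: "norm (u - c + inverse \<mu> *\<^sub>R (F u + n)) \<le> \<delta>" .
  have "\<mu> * (norm (u - ys))\<^sup>2 \<le> (?G u - ?G ys) \<bullet> (u - ys)"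
    using G u(1) ysX unfolding well_posed_def strongly_monotone_op_def by blast
  also have "\<dots> \<le> (?G u + n) \<bullet> (u - ys)"
  proof -
    have "?G ys \<bullet> (u - ys) \<ge> 0" using ys u(1) unfolding vi_solution_def by blast
    moreover have "n \<bullet> (ys - u) \<le> 0" using u(2) ysX by (auto simp: normal_cone_def)
    ultimately show ?thesis
      unfolding inner_diff_left inner_add_left[of "?G u"] by (simp add: inner_diff_right)
  qed
  also have "\<dots> \<le> norm (?G u + n) * norm (u - ys)" by (rule norm_cauchy_schwarz)
  also have "\<dots> \<le> (\<mu> * \<delta>) * norm (u - ys)" using e by (rule mult_right_mono) simp
  finally have "norm (u - ys) * norm (u - ys) \<le> \<delta> * norm (u - ys)"
    using \<mu> by (simp add: power2_eq_square)
  then have "norm (u - ys) \<le> \<delta>"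
    using \<delta>_pos by (cases "u = ys") (auto dest: mult_right_le_imp_le)
  then show ?thesis using that res u 1 ys N by blast
qed

abbreviation "state \<equiv> halpern_state d X p L a m \<theta> tstep F x0 D \<delta>"

abbreviation "centre t w \<equiv> (1 - halpern_beta p t) *\<^sub>R w + halpern_beta p t *\<^sub>R x0"

lemma centre_in_X: "w \<in> X \<Longrightarrow> centre t w \<in> X"
  using q_ge x0 by (intro convexD_alt[OF X_convex]) (auto simp: halpern_beta_def)

text \<open>
  A bound on the distance between the warm start of outer step \<open>t\<close> and the exact resolvent, where \<open>v\<close>
  and \<open>v'\<close> are the operator values before and after the step.
\<close>

definition start_dist :: "nat \<Rightarrow> vec \<Rightarrow> vec \<Rightarrow> real" where
  "start_dist t v v' = \<eta> t * norm (v' - v) + 2 * \<delta>"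

definition call_bound :: "nat \<Rightarrow> real \<Rightarrow> real" where
  "call_bound t r = adaptive_const * (real (fine_steps (inverse (\<eta> t)) \<delta>) + 2 * r / \<rho> (inverse (\<eta> t))) + 1"

lemma call_bound_mono: "r \<le> r' \<Longrightarrow> call_bound t r \<le> call_bound t r'"
  using rho_pos[of "inverse (\<eta> t)"] weights.\<eta>_pos[of t] adaptive_const_pos
  by (auto simp: call_bound_def intro!: mult_left_mono divide_right_mono)

text \<open>
  The resolvent fixes \<open>xs\<close> and is firmly nonexpansive, so the distance from \<open>x0\<close> to its resolvent is at most \<open>D\<close>.
\<close>

lemma state_0:
  obtains u v N where "state 0 = Some (u, v, N)" "u \<in> X" "v - F u \<in> normal_cone d X u"
    "norm (u - x0 + \<eta> 0 *\<^sub>R v) \<le> \<delta>" "real N \<le> call_bound 0 D"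
proof -
  define \<mu> where "\<mu> = inverse (\<eta> 0)"
  have \<mu>: "\<mu> > 0" "inverse \<mu> = \<eta> 0" unfolding \<mu>_def using weights.\<eta>_pos[of 0] by auto
  obtain u n N ys where res: "r_adaptive_atm d p L a m \<theta> tstep (\<lambda>x. F x + \<mu> *\<^sub>R (x - x0)) x0 \<mu> \<delta> = Some (u, n, N)"
    and u: "u \<in> X" "n \<in> normal_cone d X u" "norm (u - x0 + \<eta> 0 *\<^sub>R (F u + n)) \<le> \<delta>"
    and ys: "vi_solution X (\<lambda>x. F x + \<mu> *\<^sub>R (x - x0)) ys" "norm (u - ys) \<le> \<delta>"
    and N: "real N \<le> adaptive_const * (real (fine_steps \<mu> \<delta>) + 2 * norm (x0 - ys) / \<rho> \<mu>)"
    by (rule resolvent_step[OF \<mu>(1) x0 x0, unfolded \<mu>(2)])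
  have "norm (x0 - ys) \<le> D"
  proof -
    have ysX: "ys \<in> X" using ys by (simp add: vi_solution_def)
    have "(F ys + \<mu> *\<^sub>R (ys - x0)) \<bullet> (xs - ys) \<ge> 0" "F xs \<bullet> (ys - xs) \<ge> 0" "(F ys - F xs) \<bullet> (ys - xs) \<ge> 0"
      using ys xs_solution ysX xs(1) F_mono by (auto simp: vi_solution_def monotone_op_def)
    then have "\<mu> * ((ys - x0) \<bullet> (xs - ys)) \<ge> 0" by (simp add: algebra_simps)
    then have "(ys - x0) \<bullet> (xs - ys) \<ge> 0" using \<mu>(1) by (simp add: zero_le_mult_iff)
    then have "(ys - x0) \<bullet> (ys - x0) \<le> (ys - x0) \<bullet> (xs - x0)" by (simp add: algebra_simps)
    also have "\<dots> \<le> norm (ys - x0) * norm (xs - x0)" by (rule norm_cauchy_schwarz)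
    finally have "norm (ys - x0) * norm (ys - x0) \<le> norm (xs - x0) * norm (ys - x0)"
      by (simp add: power2_norm_eq_inner[symmetric] power2_eq_square mult.commute)
    then have "norm (ys - x0) \<le> norm (xs - x0)"
      by (cases "ys = x0") (auto dest: mult_right_le_imp_le)
    then show ?thesis by (simp add: D_eq norm_minus_commute)
  qed
  then have "real (N + 1) \<le> call_bound 0 D"
    using N call_bound_mono[of "norm (x0 - ys)" D 0] by (simp add: call_bound_def \<mu>_def)
  moreover have "state 0 = Some (u, F u + n, N + 1)"
    using res by (simp add: \<mu>_def Let_def)
  ultimately show ?thesis using u by (intro that[of u "F u + n" "N + 1"]) auto
qed

text \<open>
  The exact resolvent is its own projection, and projections are nonexpansive. Hence the warm start
  is at least as close to it as the unprojected point \<open>c - \<eta> z\<close>, and \<open>c\<close> itself equals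
  \<open>u + \<eta> v\<close> up to \<open>\<delta>\<close>.
\<close>

lemma state_Suc:
  assumes st: "state t = Some (w, z, N0)" and w: "w \<in> X"
  obtains u v N where "state (Suc t) = Some (u, v, N)" "u \<in> X" "v - F u \<in> normal_cone d X u"
    "norm (u - centre (Suc t) w + \<eta> (Suc t) *\<^sub>R v) \<le> \<delta>"
    "real N \<le> real N0 + call_bound (Suc t) (start_dist (Suc t) z v)"
proof -
  define \<mu> where "\<mu> = inverse (\<eta> (Suc t))"
  have \<mu>: "\<mu> > 0" "inverse \<mu> = \<eta> (Suc t)" unfolding \<mu>_def using weights.\<eta>_pos[of "Suc t"] by auto
  define c where "c = centre (Suc t) w"
  define y where "y = proj_onto X (c - \<eta> (Suc t) *\<^sub>R z)"
  have c: "c \<in> X" unfolding c_def by (rule centre_in_X[OF w])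
  have y: "y \<in> X" unfolding y_def by (rule proj_onto(1)[OF X_compact X_convex X_ne])
  obtain u n N ys where res: "r_adaptive_atm d p L a m \<theta> tstep (\<lambda>x. F x + \<mu> *\<^sub>R (x - c)) y \<mu> \<delta> = Some (u, n, N)"
    and u: "u \<in> X" "n \<in> normal_cone d X u" "norm (u - c + \<eta> (Suc t) *\<^sub>R (F u + n)) \<le> \<delta>"
    and ys: "vi_solution X (\<lambda>x. F x + \<mu> *\<^sub>R (x - c)) ys" "norm (u - ys) \<le> \<delta>"
    and N: "real N \<le> adaptive_const * (real (fine_steps \<mu> \<delta>) + 2 * norm (y - ys) / \<rho> \<mu>)"
    by (rule resolvent_step[OF \<mu>(1) c y, unfolded \<mu>(2)])
  define v where "v = F u + n"
  have "norm (y - ys) \<le> start_dist (Suc t) z v"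
  proof -
    have ysX: "ys \<in> X" using ys by (simp add: vi_solution_def)
    have "norm (y - ys) = norm (proj_onto X (c - \<eta> (Suc t) *\<^sub>R z) - proj_onto X ys)"
      by (simp add: y_def proj_onto_id[OF X_compact X_convex ysX])
    also have "\<dots> \<le> norm (c - \<eta> (Suc t) *\<^sub>R z - ys)"
      by (rule proj_onto_nonexpansive[OF X_compact X_convex X_ne])
    also have "c - \<eta> (Suc t) *\<^sub>R z - ys
        = \<eta> (Suc t) *\<^sub>R (v - z) + (u - ys) - (u - c + \<eta> (Suc t) *\<^sub>R v)" by (simp add: algebra_simps)
    also have "norm \<dots> \<le> norm (\<eta> (Suc t) *\<^sub>R (v - z)) + norm (u - ys) + norm (u - c + \<eta> (Suc t) *\<^sub>R v)"
      by (intro order_trans[OF norm_triangle_ineq4] add_mono norm_triangle_ineq order_refl)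
    also have "\<dots> \<le> start_dist (Suc t) z v"
      using u(3) ys(2) weights.\<eta>_pos[of "Suc t"] by (simp add: start_dist_def v_def)
    finally show ?thesis .
  qed
  then have "real (N0 + N + 1) \<le> real N0 + call_bound (Suc t) (start_dist (Suc t) z v)"
    using N call_bound_mono[of "norm (y - ys)" "start_dist (Suc t) z v" "Suc t"]
    by (simp add: call_bound_def \<mu>_def)
  moreover have "state (Suc t) = Some (u, v, N0 + N + 1)"
    using st res unfolding halpern_state.simps(2)
    by (simp add: \<mu>_def c_def y_def v_def Let_def)
  ultimately show ?thesis using u by (intro that[of u v "N0 + N + 1"]) (auto simp: v_def c_def)
qed

lemma state_defined: "\<exists>u v N. state t = Some (u, v, N) \<and> u \<in> X \<and> v - F u \<in> normal_cone d X u"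
proof (induction t)
  case 0
  then show ?case using state_0 by metis
next
  case (Suc t)
  then show ?case using state_Suc by metis
qed

text \<open>
  The components of the state, which is defined for every \<open>t\<close> by \<open>state_defined\<close>.
\<close>

definition u :: "nat \<Rightarrow> vec" where "u t = fst (the (state t))"
definition v :: "nat \<Rightarrow> vec" where "v t = fst (snd (the (state t)))"
definition calls :: "nat \<Rightarrow> nat" where "calls t = snd (snd (the (state t)))"

definition residual :: "nat \<Rightarrow> vec" where
  "residual t = u t - (case t of 0 \<Rightarrow> x0 | Suc s \<Rightarrow> centre t (u s)) + \<eta> t *\<^sub>R v t"

lemma state_eq: "state t = Some (u t, v t, calls t)"
  and u_in_X: "u t \<in> X"
  and v_normal: "v t - F (u t) \<in> normal_cone d X (u t)"
  using state_defined[of t] by (auto simp: u_def v_def calls_def)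

lemma residual_le: "norm (residual t) \<le> \<delta>"
proof (cases t)
  case 0
  then show ?thesis using state_0 state_eq[of 0] by (auto simp: residual_def)
next
  case (Suc s)
  obtain u' v' N where "state (Suc s) = Some (u', v', N)"
    "norm (u' - centre (Suc s) (u s) + \<eta> (Suc s) *\<^sub>R v') \<le> \<delta>"
    using state_Suc[OF state_eq u_in_X] by metis
  then show ?thesis using Suc state_eq[of "Suc s"] by (simp add: residual_def)
qed

definition step_dist :: "nat \<Rightarrow> real" where
  "step_dist t = (case t of 0 \<Rightarrow> D | Suc s \<Rightarrow> start_dist t (v s) (v t))"

lemma calls_le: "real (calls t) \<le> (\<Sum>s\<le>t. call_bound s (step_dist s))"
proof (induction t)
  case 0
  obtain u' v' N where "state 0 = Some (u', v', N)" "real N \<le> call_bound 0 D"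
    using state_0 by metis
  then show ?case using state_eq[of 0] by (simp add: step_dist_def)
next
  case (Suc t)
  obtain u' v' N where "state (Suc t) = Some (u', v', N)"
    "real N \<le> real (calls t) + call_bound (Suc t) (start_dist (Suc t) (v t) v')"
    using state_Suc[OF state_eq u_in_X] by metis
  then show ?case using Suc state_eq[of "Suc t"] by (simp add: step_dist_def)
qed

lemma v_monotone: "(v s - v t) \<bullet> (u s - u t) \<ge> 0"
proof -
  have "(v s - F (u s)) \<bullet> (u t - u s) \<le> 0" "(v t - F (u t)) \<bullet> (u s - u t) \<le> 0"
    "(F (u s) - F (u t)) \<bullet> (u s - u t) \<ge> 0"
    using v_normal u_in_X F_mono by (auto simp: normal_cone_def monotone_op_def)
  then show ?thesis by (simp add: algebra_simps)
qed

lemma v_solution: "v t \<bullet> (u t - xs) \<ge> 0"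
proof -
  have "(v t - F (u t)) \<bullet> (xs - u t) \<le> 0" "F xs \<bullet> (u t - xs) \<ge> 0" "(F (u t) - F xs) \<bullet> (u t - xs) \<ge> 0"
    using v_normal[of t] u_in_X[of t] F_mono xs xs_solution
    by (auto simp: normal_cone_def monotone_op_def vi_solution_def)
  then show ?thesis by (simp add: algebra_simps)
qed

sublocale run: halpern_run q \<eta> u v residual x0 xs D \<delta> T
proof
  show "D = norm (x0 - xs)" "D > 0" "T \<ge> 1" by (fact D_eq D_pos T_ge)+
  show "\<delta> = D / real T powr (3 / 2)" by (rule \<delta>_def)
  show "u 0 = x0 - \<eta> 0 *\<^sub>R v 0 + residual 0" by (simp add: residual_def)
  show "u (Suc t) = (1 - q / (real (Suc t) + q)) *\<^sub>R u t + (q / (real (Suc t) + q)) *\<^sub>R x0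
      - \<eta> (Suc t) *\<^sub>R v (Suc t) + residual (Suc t)" for t
    by (simp add: residual_def halpern_beta_def del: of_nat_Suc)
qed (use v_monotone v_solution residual_le in auto)

text \<open>
  With \<open>\<eta>\<^sub>0 = 1 / (L D\<^sup>p\<^sup>-\<^sup>1)\<close> and \<open>\<eta>\<^sub>t\<close> of the order \<open>\<eta>\<^sub>0 t\<^sup>q\<^sup>-\<^sup>1\<close>, the bound \<open>D / (t \<eta>\<^sub>t)\<close> on the norm becomes
  \<open>L D\<^sup>p / t\<^sup>q\<close>.
\<close>

lemma norm_final_v_le: "norm (v (T - 1)) \<le> residual_const p * L * D ^ p / real T powr ((3 * real p - 1) / 2)"
proof -
  have T: "real (T - 1) + 1 = real T" "real T \<ge> 1" using T_ge by (auto simp: of_nat_diff)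
  have q1: "2 * q - 1 > 0" using q_ge by simp
  have "\<eta> 0 * (real T / (2 * q - 1)) powr (q - 1) * real T * norm (v (T - 1))
      \<le> \<eta> (T - 1) * real T * norm (v (T - 1))"
    using weights.\<eta>_ge[of "T - 1"] T by (intro mult_right_mono) auto
  also have "\<dots> \<le> 8 * q * D" using run.norm_v_le[of "T - 1"] T T_ge by simp
  finally have "\<eta> 0 * (real T powr (q - 1) / (2 * q - 1) powr (q - 1)) * real T * norm (v (T - 1)) \<le> 8 * q * D"
    using q1 by (simp add: powr_divide)
  moreover have "real T powr q = real T powr (q - 1) * real T"
    using T powr_add[of "real T" "q - 1" 1] by simp
  ultimately have "real T powr q * norm (v (T - 1)) \<le> 8 * q * D * (2 * q - 1) powr (q - 1) / \<eta> 0"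
    using q1 weights.\<eta>_0 by (simp add: field_simps)
  also have "\<dots> = residual_const p * L * D ^ p"
  proof -
    have "D * D ^ (p - 1) = D ^ p" using p by (cases p) auto
    then show ?thesis using L D_pos by (simp add: halpern_eta.simps residual_const_def mult_ac)
  qed
  finally have "norm (v (T - 1)) \<le> residual_const p * L * D ^ p / real T powr q"
    using T by (simp add: pos_le_divide_eq mult.commute)
  then show ?thesis by (simp only: halpern_q_def)
qed

lemma rho_mono: "0 \<le> \<mu> \<Longrightarrow> \<mu> \<le> \<mu>' \<Longrightarrow> \<rho> \<mu> \<le> \<rho> \<mu>'"
  using a L p by (simp add: rho_def divide_right_mono)

lemma rho_L_power: "s \<ge> 0 \<Longrightarrow> \<rho> (L * s ^ (p - 1)) = a * s"
  using rho_scale[of s L] L p by (simp add: rho_def)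

text \<open>
  The identity \<open>q - 1 = 3/2 (p - 1)\<close> behind the choice of \<open>q\<close>: as \<open>1 / \<eta>\<^sub>t\<close> decays like \<open>t\<^sup>1\<^sup>-\<^sup>q\<close>, the radius
  \<open>\<rho>(1/\<eta>\<^sub>t)\<close> decays like \<open>t\<^sup>-\<^sup>3\<^sup>/\<^sup>2\<close>.
\<close>

lemma powr_q: "x > 0 \<Longrightarrow> (x powr (3 / 2)) ^ (p - 1) = x powr (q - 1)"
  using p by (simp add: powr_power halpern_q_def of_nat_diff) (simp add: field_simps)

lemma inverse_\<eta>_0: "inverse (\<eta> 0) = L * D ^ (p - 1)"
  using L D_pos by (simp add: halpern_eta.simps)

lemma rho_ge: "\<rho> (inverse (\<eta> t)) \<ge> a * D / (real t + 1) powr (3 / 2)"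
proof -
  define s where "s = (real t + 1) powr (3 / 2)"
  have s: "s > 0" by (simp add: s_def)
  have "\<eta> t \<le> \<eta> 0 * s ^ (p - 1)" using weights.\<eta>_le[of t] by (simp add: s_def powr_q)
  then have "inverse (\<eta> 0 * s ^ (p - 1)) \<le> inverse (\<eta> t)"
    using weights.\<eta>_pos[of t] by (rule le_imp_inverse_le)
  moreover have "inverse (\<eta> 0 * s ^ (p - 1)) = L * (D / s) ^ (p - 1)"
    by (simp add: inverse_\<eta>_0 power_divide) (simp add: divide_inverse)
  ultimately have "\<rho> (L * (D / s) ^ (p - 1)) \<le> \<rho> (inverse (\<eta> t))"
    using L D_pos s by (intro rho_mono) auto
  then show ?thesis using D_pos s by (simp add: rho_L_power s_def)
qed

lemma rho_le: "\<rho> (inverse (\<eta> t)) \<le> a * D * ((2 * q - 1) / (real t + 1)) powr (3 / 2)"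
proof -
  define s where "s = ((real t + 1) / (2 * q - 1)) powr (3 / 2)"
  have q1: "2 * q - 1 > 0" using q_ge by simp
  have s: "s > 0" using q1 by (simp add: s_def)
  have "\<eta> 0 * s ^ (p - 1) \<le> \<eta> t" using weights.\<eta>_ge[of t] q1 by (simp add: s_def powr_q)
  then have "inverse (\<eta> t) \<le> inverse (\<eta> 0 * s ^ (p - 1))"
    using weights.\<eta>_0 s by (intro le_imp_inverse_le mult_pos_pos) auto
  moreover have "inverse (\<eta> 0 * s ^ (p - 1)) = L * (D / s) ^ (p - 1)"
    by (simp add: inverse_\<eta>_0 power_divide) (simp add: divide_inverse)
  ultimately have "\<rho> (inverse (\<eta> t)) \<le> \<rho> (L * (D / s) ^ (p - 1))"
    using weights.\<eta>_pos[of t] by (intro rho_mono) (auto simp: less_imp_le)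
  also have "\<dots> = a * (D / s)" using D_pos s by (simp add: rho_L_power)
  also have "D / s = D * ((2 * q - 1) / (real t + 1)) powr (3 / 2)"
    using q1 by (simp add: s_def powr_divide)
  finally show ?thesis by simp
qed

text \<open>
  The accuracy relative to the radius, \<open>\<rho>(1/\<eta>\<^sub>t) / \<delta>\<close>, is of the order \<open>(T/(t + 1))\<^sup>3\<^sup>/\<^sup>2\<close>, so the inner steps
  sum up to a multiple of \<open>T + \<Sum> log (T/(t + 1))\<close>.
\<close>

lemma fine_steps_sum: "(\<Sum>t<T. real (fine_steps (inverse (\<eta> t)) \<delta>)) \<le> fine_steps_const p a m \<theta> * real T"
proof -
  define H where "H = h_const p a m * a * (2 * q - 1) powr (3 / 2)"
  define l where "l = real p * ln (1 / \<theta>)"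
  have q1: "2 * q - 1 > 0" using q_ge by simp
  have H: "H > 0" using h_const_pos a q1 by (simp add: H_def)
  have "ln (1 / \<theta>) > 0" using \<theta> by (simp add: ln_div)
  then have l: "l > 0" using p by (simp add: l_def)
  have "real (fine_steps (inverse (\<eta> t)) \<delta>) \<le> 1 + (log_plus H + 3 / 2 * ln (real T / (real t + 1))) / l"
    if t: "t < T" for t
  proof -
    define x where "x = h_const p a m * \<rho> (inverse (\<eta> t)) / \<delta>"
    define y where "y = real T / (real t + 1)"
    have y: "y \<ge> 1" using t by (simp add: y_def)
    have x: "x > 0" using h_const_pos rho_pos weights.\<eta>_pos[of t] \<delta>_pos by (simp add: x_def)
    have "x \<le> h_const p a m * (a * D * ((2 * q - 1) / (real t + 1)) powr (3 / 2)) / \<delta>"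
      unfolding x_def using rho_le[of t] h_const_pos \<delta>_pos
      by (intro divide_right_mono mult_left_mono) auto
    also have "\<dots> = H * y powr (3 / 2)"
      using D_pos q1 T_ge by (simp add: H_def y_def \<delta>_def powr_divide)
    finally have "x \<le> H * y powr (3 / 2)" .
    then have "log_plus x \<le> log_plus H + ln (y powr (3 / 2))"
      using x H y by (intro log_plus_le_mult) (auto simp: ge_one_powr_ge_zero)
    then have lx: "log_plus x \<le> log_plus H + 3 / 2 * ln y" using y by (simp add: ln_powr)
    have "0 \<le> log_plus x / l" using l by (simp add: log_plus_def)
    then have "real (fine_steps (inverse (\<eta> t)) \<delta>) \<le> 1 + log_plus x / l"
      unfolding adaptive_S_def x_def[symmetric] l_def[symmetric] by linarith
    also have "\<dots> \<le> 1 + (log_plus H + 3 / 2 * ln y) / l"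
      using lx l by (intro add_left_mono divide_right_mono) auto
    finally show ?thesis by (simp add: y_def)
  qed
  then have "(\<Sum>t<T. real (fine_steps (inverse (\<eta> t)) \<delta>))
      \<le> (\<Sum>t<T. 1 + (log_plus H + 3 / 2 * ln (real T / (real t + 1))) / l)"
    by (intro sum_mono) auto
  also have "\<dots> = real T + (real T * log_plus H + 3 / 2 * (\<Sum>t<T. ln (real T / (real t + 1)))) / l"
    by (simp add: sum.distrib sum_distrib_left sum_divide_distrib[symmetric])
  also have "\<dots> \<le> real T + (real T * log_plus H + 3 / 2 * real T) / l"
    using sum_ln_le[OF T_ge] l by (intro add_left_mono divide_right_mono mult_left_mono) auto
  also have "\<dots> = fine_steps_const p a m \<theta> * real T"
    unfolding fine_steps_const_def H_def[symmetric] l_def[symmetric] by (simp add: algebra_simps add_divide_distrib)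
  finally show ?thesis .
qed

text \<open>
  Dividing by the radius multiplies the distance of the warm start by at most \<open>(t + 1)\<^sup>3\<^sup>/\<^sup>2 / (a D)\<close>. The tolerance \<open>\<delta>\<close>
  then contributes at most \<open>O(1)\<close> per step, and the movement of \<open>v\<close> contributes \<open>O(T)\<close> in total.
\<close>

lemma step_dist_sum:
  "(\<Sum>t<T. step_dist t / \<rho> (inverse (\<eta> t))) \<le> displacement_const p a * real T"
proof -
  define Q where "Q = 1 + 112 * q\<^sup>2 * exp (q\<^sup>2)"
  have T: "real T \<ge> 1" using T_ge by simp
  have le: "step_dist t / \<rho> (inverse (\<eta> t)) \<le> (real t + 1) powr (3 / 2) * step_dist t / (a * D)" for t
  proof -
    have "0 \<le> step_dist t"
      using D_pos \<delta>_pos weights.\<eta>_pos[of t] by (auto simp: step_dist_def start_dist_def split: nat.split)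
    then have "step_dist t / \<rho> (inverse (\<eta> t)) \<le> step_dist t / (a * D / (real t + 1) powr (3 / 2))"
      using rho_ge[of t] a D_pos rho_pos weights.\<eta>_pos[of t]
      by (intro divide_left_mono mult_pos_pos) auto
    then show ?thesis by (simp add: mult.commute)
  qed
  obtain n where n: "T = Suc n" using T_ge by (cases T) auto
  then have nT: "n < T" "real n \<le> real T" by auto
  have first: "(\<Sum>t<T. (real t + 1) powr (3 / 2) * step_dist t)
      = D + (\<Sum>s<n. (real (Suc s) + 1) powr (3 / 2) * step_dist (Suc s))"
  proof -
    have "(\<Sum>t<T. f t) = f 0 + (\<Sum>s<n. f (Suc s))" for f :: "nat \<Rightarrow> real"
      unfolding n by (rule sum.lessThan_Suc_shift)
    then show ?thesis by (simp add: step_dist_def)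
  qed
  have "(\<Sum>s<n. (real (Suc s) + 1) powr (3 / 2) * step_dist (Suc s))
      \<le> (\<Sum>s<n. (real (Suc s) + 1) powr (3 / 2) * (\<eta> (Suc s) * norm (v (Suc s) - v s)) + 2 * D)"
  proof (rule sum_mono)
    fix s assume "s \<in> {..<n}"
    then have "real (Suc s) + 1 \<le> real T" using n by simp
    then have "(real (Suc s) + 1) powr (3 / 2) \<le> real T powr (3 / 2)" by (intro powr_mono2) auto
    then have "(real (Suc s) + 1) powr (3 / 2) * \<delta> \<le> real T powr (3 / 2) * \<delta>"
      using \<delta>_pos by (intro mult_right_mono) auto
    also have "\<dots> = D" using T by (simp add: \<delta>_def)
    finally show "(real (Suc s) + 1) powr (3 / 2) * step_dist (Suc s)
      \<le> (real (Suc s) + 1) powr (3 / 2) * (\<eta> (Suc s) * norm (v (Suc s) - v s)) + 2 * D"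
      by (simp add: step_dist_def start_dist_def distrib_left del: of_nat_Suc)
  qed
  also have "\<dots> = (\<Sum>s<n. (real (Suc s) + 1) powr (3 / 2) * (\<eta> (Suc s) * norm (v (Suc s) - v s))) + real n * (2 * D)"
    by (simp only: sum.distrib sum_constant card_lessThan)
  also have "\<dots> \<le> Q * D * real T + real T * (2 * D)"
    using run.displacement_sum_le[OF nT(1)] nT(2) D_pos unfolding Q_def
    by (intro add_mono mult_right_mono) auto
  finally have rest: "(\<Sum>s<n. (real (Suc s) + 1) powr (3 / 2) * step_dist (Suc s))
      \<le> Q * D * real T + real T * (2 * D)" .
  have "D + (Q * D * real T + real T * (2 * D)) \<le> (Q + 3) * D * real T"
    using T D_pos by (simp add: algebra_simps)
  then have sum: "(\<Sum>t<T. (real t + 1) powr (3 / 2) * step_dist t) \<le> (Q + 3) * D * real T"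
    using first rest by linarith
  have "(\<Sum>t<T. step_dist t / \<rho> (inverse (\<eta> t))) \<le> (\<Sum>t<T. (real t + 1) powr (3 / 2) * step_dist t) / (a * D)"
    unfolding sum_divide_distrib by (intro sum_mono le)
  also have "\<dots> \<le> (Q + 3) * D * real T / (a * D)"
    using sum a D_pos by (intro divide_right_mono) auto
  also have "\<dots> = displacement_const p a * real T"
    using D_pos by (simp add: displacement_const_def Q_def add.commute)
  finally show ?thesis .
qed

lemma adaptive_const_eq: "adaptive_const = 4 * real (p - 1) / (1 - \<theta>) + 3"
  by (simp add: adaptive_const_def decay_def)

lemma total_calls: "real (calls (T - 1)) \<le> call_const p a m \<theta> * real T"
proof -
  have "{..T - 1} = {..<T}" using T_ge by auto
  then have "real (calls (T - 1)) \<le> (\<Sum>t<T. call_bound t (step_dist t))"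
    using calls_le[of "T - 1"] by simp
  also have "\<dots> = adaptive_const * ((\<Sum>t<T. real (fine_steps (inverse (\<eta> t)) \<delta>))
      + 2 * (\<Sum>t<T. step_dist t / \<rho> (inverse (\<eta> t)))) + real T"
  proof -
    have "call_bound t (step_dist t) = adaptive_const * real (fine_steps (inverse (\<eta> t)) \<delta>)
        + adaptive_const * 2 * (step_dist t / \<rho> (inverse (\<eta> t))) + 1" for t
      by (simp add: call_bound_def distrib_left)
    then have "(\<Sum>t<T. call_bound t (step_dist t))
        = adaptive_const * (\<Sum>t<T. real (fine_steps (inverse (\<eta> t)) \<delta>))
        + adaptive_const * 2 * (\<Sum>t<T. step_dist t / \<rho> (inverse (\<eta> t))) + real T"
      by (simp only: sum.distrib sum_distrib_left[symmetric]) simp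
    then show ?thesis by (simp only: distrib_left mult.assoc)
  qed
  also have "\<dots> \<le> adaptive_const * (fine_steps_const p a m \<theta> * real T
      + 2 * (displacement_const p a * real T)) + real T"
    using fine_steps_sum step_dist_sum adaptive_const_pos by (intro add_right_mono mult_left_mono add_mono) auto
  also have "\<dots> = call_const p a m \<theta> * real T"
  proof -
    have "A * (S * x + 2 * (B * x)) + x = (A * (S + 2 * B) + 1) * x" for A S B x :: real
      by (simp add: algebra_simps)
    then show ?thesis unfolding call_const_def adaptive_const_eq .
  qed
  finally show ?thesis .
qed

lemma inexact_halpern_guarantee:
  "\<exists>u v N. inexact_halpern d X p L a m \<theta> tstep F x0 D T = Some (u, v, N) \<and>
     real N \<le> call_const p a m \<theta> * real T \<and>
     norm v \<le> residual_const p * L * D ^ p / real T powr ((3 * real p - 1) / 2) \<and>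
     u \<in> X \<and> v \<in> plus_normal_cone d X (F u) u"
proof -
  have "inexact_halpern d X p L a m \<theta> tstep F x0 D T = Some (u (T - 1), v (T - 1), calls (T - 1))"
    unfolding inexact_halpern_def using state_eq[of "T - 1"] by (simp add: \<delta>_def)
  moreover have "v (T - 1) \<in> plus_normal_cone d X (F (u (T - 1))) (u (T - 1))"
    using v_normal plus_normal_cone_iff[OF F_in_Rd[OF u_in_X]] by blast
  ultimately show ?thesis using total_calls norm_final_v_le u_in_X by blast
qed

end

section \<open>Convergence rate and oracle complexity\<close>

lemma iterations_for_accuracy:
  fixes A c q :: real
  assumes "q > 0" "c > 0" "A > 0"
  obtains T :: nat where "T \<ge> 1" "c * A \<le> real T powr q"
    "real T \<le> 2 * max 1 (c powr (1 / q)) * max 1 (A powr (1 / q))"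
proof
  let ?B = "max 1 ((c * A) powr (1 / q))"
  define T where "T = nat \<lceil>?B\<rceil>"
  have B: "?B \<ge> 1" by simp
  then have T: "?B \<le> real T" "real T \<le> ?B + 1" unfolding T_def by linarith+
  show "T \<ge> 1" using T(1) B by linarith
  have "c * A = ((c * A) powr (1 / q)) powr q" using assms by (simp add: powr_powr)
  also have "\<dots> \<le> real T powr q" using T(1) assms by (intro powr_mono2) auto
  finally show "c * A \<le> real T powr q" .
  have "(c * A) powr (1 / q) = c powr (1 / q) * A powr (1 / q)" using assms by (simp add: powr_mult)
  also have "\<dots> \<le> max 1 (c powr (1 / q)) * max 1 (A powr (1 / q))" by (intro mult_mono) auto
  finally have "(c * A) powr (1 / q) \<le> max 1 (c powr (1 / q)) * max 1 (A powr (1 / q))" .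
  moreover have "1 * 1 \<le> max 1 (c powr (1 / q)) * max 1 (A powr (1 / q))" by (intro mult_mono) auto
  ultimately have "?B \<le> max 1 (c powr (1 / q)) * max 1 (A powr (1 / q))" by simp
  then show "real T \<le> 2 * max 1 (c powr (1 / q)) * max 1 (A powr (1 / q))" using T(2) B by linarith
qed

theorem theorem5p1:
  fixes p :: nat and a m \<theta> :: real
  assumes "p \<ge> 2" and "tensor_constants p a m \<theta>"
  shows "\<exists>c C C' :: real.
    \<forall>(d :: nat) (X :: vec set) (F :: vec \<Rightarrow> vec) (L :: real) (xs :: vec) (x0 :: vec)
      (tstep :: (vec \<Rightarrow> vec) \<Rightarrow> vec \<Rightarrow> vec) (D :: real).
      X \<subseteq> Rd d \<and> X \<noteq> {} \<and> compact X \<and> convex X \<and>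
      F ` Rd d \<subseteq> Rd d \<and> continuous_on (Rd d) F \<and> monotone_op X F \<and>
      L > 0 \<and> smooth_order d X p L F \<and>
      xs \<in> X \<and> 0 \<in> plus_normal_cone d X (F xs) xs \<and>
      x0 \<in> X \<and> D = norm (x0 - xs) \<and> D > 0 \<and>
      tensor_step_selection d X p L (m * L) tstep
      \<longrightarrow>
      (\<forall>T::nat. T \<ge> 1 \<longrightarrow>
        (\<exists>u v N. inexact_halpern d X p L a m \<theta> tstep F x0 D T = Some (u, v, N) \<and>
           real N \<le> C * real T \<and>
           norm v \<le> c * L * D ^ p / real T powr ((3 * real p - 1) / 2) \<and>
           u \<in> X \<and> v \<in> plus_normal_cone d X (F u) u)) \<and>
      (\<forall>\<epsilon>::real. \<epsilon> > 0 \<longrightarrow>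
        (\<exists>T::nat. T \<ge> 1 \<and>
          (\<exists>u v N. inexact_halpern d X p L a m \<theta> tstep F x0 D T = Some (u, v, N) \<and>
             u \<in> X \<and> infdist 0 (plus_normal_cone d X (F u) u) \<le> \<epsilon> \<and>
             real N \<le> C' * max 1 ((L * D ^ p / \<epsilon>) powr (2 / (3 * real p - 1))))))"
proof -
  let ?c = "residual_const p" and ?C = "call_const p a m \<theta>" and ?q = "halpern_q p"
  define K where "K = 2 * max 1 (?c powr (1 / ?q))"
  have q: "?q > 1" using assms(1) by (simp add: halpern_q_def)
  have c: "?c > 0" using q by (simp add: residual_const_def)
  have exponent: "1 / ?q = 2 / (3 * real p - 1)" by (simp add: halpern_q_def)
  show ?thesis
  proof (rule exI[of _ ?c], rule exI[of _ ?C], rule exI[of _ "\<bar>?C\<bar> * K"], intro allI impI)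
    fix d :: nat and X :: "vec set" and F :: "vec \<Rightarrow> vec" and L D :: real and xs x0 :: vec
      and tstep :: "(vec \<Rightarrow> vec) \<Rightarrow> vec \<Rightarrow> vec"
    assume H: "X \<subseteq> Rd d \<and> X \<noteq> {} \<and> compact X \<and> convex X \<and>
      F ` Rd d \<subseteq> Rd d \<and> continuous_on (Rd d) F \<and> monotone_op X F \<and>
      L > 0 \<and> smooth_order d X p L F \<and>
      xs \<in> X \<and> 0 \<in> plus_normal_cone d X (F xs) xs \<and>
      x0 \<in> X \<and> D = norm (x0 - xs) \<and> D > 0 \<and>
      tensor_step_selection d X p L (m * L) tstep"
    have run: "\<exists>u v N. inexact_halpern d X p L a m \<theta> tstep F x0 D T = Some (u, v, N) \<and>
           real N \<le> ?C * real T \<and>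
           norm v \<le> ?c * L * D ^ p / real T powr ((3 * real p - 1) / 2) \<and>
           u \<in> X \<and> v \<in> plus_normal_cone d X (F u) u" if "T \<ge> 1" for T
    proof -
      have "halpern_problem d X p L a m \<theta> tstep F xs x0 D T"
        using H that assms by unfold_locales auto
      then show ?thesis by (rule halpern_problem.inexact_halpern_guarantee)
    qed
    \<comment> \<open>The absolute value makes the bound increasing in \<open>T\<close> whatever the sign of the constant.\<close>
    have accuracy: "\<exists>T\<ge>1. \<exists>u v N. inexact_halpern d X p L a m \<theta> tstep F x0 D T = Some (u, v, N) \<and>
             u \<in> X \<and> infdist 0 (plus_normal_cone d X (F u) u) \<le> \<epsilon> \<and>
             real N \<le> \<bar>?C\<bar> * K * max 1 ((L * D ^ p / \<epsilon>) powr (2 / (3 * real p - 1)))"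
      if \<epsilon>: "\<epsilon> > 0" for \<epsilon> :: real
    proof -
      have "L > 0" "D > 0" using H by - (elim conjE, assumption)+
      then have A: "L * D ^ p / \<epsilon> > 0" using \<epsilon> by simp
      obtain T where T: "T \<ge> 1" "?c * (L * D ^ p / \<epsilon>) \<le> real T powr ?q"
        "real T \<le> K * max 1 ((L * D ^ p / \<epsilon>) powr (1 / ?q))"
        using iterations_for_accuracy[of ?q ?c "L * D ^ p / \<epsilon>"] q c A unfolding K_def by auto
      obtain u v N where res: "inexact_halpern d X p L a m \<theta> tstep F x0 D T = Some (u, v, N)"
        and N: "real N \<le> ?C * real T" and v: "norm v \<le> ?c * L * D ^ p / real T powr ?q"
        and u: "u \<in> X" "v \<in> plus_normal_cone d X (F u) u"
        using run[OF T(1)] unfolding halpern_q_def by blast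
      have "?c * L * D ^ p / real T powr ?q \<le> \<epsilon>"
        using T(1,2) \<epsilon> by (simp add: pos_divide_le_eq mult.commute mult.left_commute)
      then have "infdist 0 (plus_normal_cone d X (F u) u) \<le> \<epsilon>"
        using infdist_le[OF u(2), of 0] v by simp
      moreover have "real N \<le> \<bar>?C\<bar> * (K * max 1 ((L * D ^ p / \<epsilon>) powr (1 / ?q)))"
      proof -
        have "?C * real T \<le> \<bar>?C\<bar> * real T" by (intro mult_right_mono) auto
        also have "\<dots> \<le> \<bar>?C\<bar> * (K * max 1 ((L * D ^ p / \<epsilon>) powr (1 / ?q)))"
          using T(3) by (intro mult_left_mono) auto
        finally show ?thesis using N by linarith
      qed
      ultimately show ?thesis using res T(1) u(1) unfolding exponent mult.assoc by blast
    qed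
    show "(\<forall>T::nat. T \<ge> 1 \<longrightarrow>
        (\<exists>u v N. inexact_halpern d X p L a m \<theta> tstep F x0 D T = Some (u, v, N) \<and>
           real N \<le> ?C * real T \<and>
           norm v \<le> ?c * L * D ^ p / real T powr ((3 * real p - 1) / 2) \<and>
           u \<in> X \<and> v \<in> plus_normal_cone d X (F u) u)) \<and>
      (\<forall>\<epsilon>::real. \<epsilon> > 0 \<longrightarrow>
        (\<exists>T::nat. T \<ge> 1 \<and>
          (\<exists>u v N. inexact_halpern d X p L a m \<theta> tstep F x0 D T = Some (u, v, N) \<and>
             u \<in> X \<and> infdist 0 (plus_normal_cone d X (F u) u) \<le> \<epsilon> \<and>
             real N \<le> \<bar>?C\<bar> * K * max 1 ((L * D ^ p / \<epsilon>) powr (2 / (3 * real p - 1))))))"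
      using run accuracy by blast
  qed
qed

end
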